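(* Let $\mu$ be an atomless $\sigma$-finite positive measure and let $Y$ be a Banach space. Then $L_1(\mu,Y)$ has the polynomial WODP.
   Context: Banach spaces are over $\mathbb{K}\in\{\mathbb{R},\mathbb{C}\}$; $\mathbb{T}$ is the set of modulus-one scalars; $B_X$, $S_X$ are the closed unit ball and unit sphere. $L_1(\mu,Y)$ is the space of (classes of) Bochner integrable $Y$-valued functions. $\mathcal{P}(X)$ is the space of continuous scalar polynomials on $X$ (finite sums of continuous $k$-homogeneous polynomials, $k\geq0$, constant for $k=0$) with norm $\|P\|=\sup_{x\in B_X}|P(x)|$. For $x_1,\ldots,x_n\in S_X$, $x'\in B_X$, $\varepsilon>0$, let $\mathrm{OF}(x_1,\ldots,x_n;x',\varepsilon)$ be the set of $y\in B_X$ for which there is a bounded linear operator $T\colon X\to X$ with $\|T\|\leq1+\varepsilon$, $\|T(y)-x'\|<\varepsilon$ and $\|T(x_i)-x_i\|<\varepsilon$ for all $i$. $X$ has the polynomial weak operator Daugavet property (polynomial WODP) if for every $P\in\mathcal{P}(X)$ with $\|P\|=1$, every $x_1,\ldots,x_n\in S_X$, $x'\in B_X$, $\alpha>0$ and $\varepsilon>0$, there exist $y\in\mathrm{OF}(x_1,\ldots,x_n;x',\varepsilon)$ and $\omega\in\mathbb{T}$ with $\mathrm{Re}\,\omega P(y)>1-\alpha$. *)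

theory Defs
  imports "HOL-Analysis.Analysis"
begin

section \<open>Scalars and Banach spaces over them\<close>

text \<open>By the Gelfand--Mazur theorem a real normed field is (isometrically) \<open>\<real>\<close> or \<open>\<complex>\<close>, and the
  axioms below force \<open>re\<close> to be the real part. The class thus stands for \<open>\<K> \<in> {\<real>, \<complex>}\<close>.\<close>

class rc_field = real_normed_field +
  fixes re :: "'a \<Rightarrow> real"
  assumes re_add: "re (x + y) = re x + re y"
    and re_scaleR_one: "re (r *\<^sub>R 1) = r"
    and abs_re_le_norm: "\<bar>re x\<bar> \<le> norm x"

instantiation real :: rc_field
begin
definition re_real :: "real \<Rightarrow> real" where "re_real x = x"
instance by standard (auto simp: re_real_def)
end

instantiation complex :: rc_field
begin
definition re_complex :: "complex \<Rightarrow> real" where "re_complex = Re"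
instance by standard (auto simp: re_complex_def abs_Re_le_cmod)
end

text \<open>The type class \<open>banach\<close> only provides the real structure; over the reals the compatibility
  axiom makes \<open>smul\<close> coincide with \<open>scaleR\<close>.\<close>

locale banach_over = vector_space smul
  for smul :: "'k::rc_field \<Rightarrow> 'y::banach \<Rightarrow> 'y" +
  assumes scale_of_real: "smul (of_real r) y = r *\<^sub>R y"
    and norm_scale: "norm (smul a y) = norm a * norm y"


section \<open>Normed spaces with a carrier\<close>

text \<open>\<open>L\<^sub>1(\<mu>,Y)\<close> depends on the term \<open>\<mu>\<close> and is therefore not a type, so the notions concerning a
  general space \<open>X\<close> are stated for a carrier set with operations.\<close>

record ('k, 'v) nspace =
  points :: "'v set"
  nadd :: "'v \<Rightarrow> 'v \<Rightarrow> 'v"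
  nscale :: "'k \<Rightarrow> 'v \<Rightarrow> 'v"
  nnorm :: "'v \<Rightarrow> real"

definition ndiff :: "('k::rc_field, 'v) nspace \<Rightarrow> 'v \<Rightarrow> 'v \<Rightarrow> 'v" where
  "ndiff X u v = nadd X u (nscale X (- 1) v)"

definition unit_ball :: "('k, 'v) nspace \<Rightarrow> 'v set" where
  "unit_ball X = {x \<in> points X. nnorm X x \<le> 1}"

definition unit_sphere :: "('k, 'v) nspace \<Rightarrow> 'v set" where
  "unit_sphere X = {x \<in> points X. nnorm X x = 1}"

definition bounded_operator :: "('k, 'v) nspace \<Rightarrow> ('v \<Rightarrow> 'v) \<Rightarrow> bool" where
  "bounded_operator X T \<longleftrightarrow>
     (\<forall>u\<in>points X. T u \<in> points X) \<and>
     (\<forall>u\<in>points X. \<forall>v\<in>points X. T (nadd X u v) = nadd X (T u) (T v)) \<and>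
     (\<forall>a. \<forall>u\<in>points X. T (nscale X a u) = nscale X a (T u)) \<and>
     (\<exists>C. \<forall>u\<in>points X. nnorm X (T u) \<le> C * nnorm X u)"

definition operator_norm :: "('k, 'v) nspace \<Rightarrow> ('v \<Rightarrow> 'v) \<Rightarrow> real" where
  "operator_norm X T = (SUP x\<in>unit_ball X. nnorm X (T x))"


section \<open>Continuous polynomials\<close>

text \<open>The elements of \<open>X\<^sup>k\<close> are the lists of length \<open>k\<close> over \<open>points X\<close>.\<close>

definition power_points :: "('k, 'v) nspace \<Rightarrow> nat \<Rightarrow> 'v list set" where
  "power_points X k = {us. length us = k \<and> set us \<subseteq> points X}"

definition multilinear_form :: "('k::rc_field, 'v) nspace \<Rightarrow> nat \<Rightarrow> ('v list \<Rightarrow> 'k) \<Rightarrow> bool" where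
  "multilinear_form X k A \<longleftrightarrow>
     (\<forall>us\<in>power_points X k. \<forall>i<k. \<forall>u\<in>points X.
        (\<forall>v\<in>points X. A (us[i := nadd X u v]) = A (us[i := u]) + A (us[i := v])) \<and>
        (\<forall>a. A (us[i := nscale X a u]) = a * A (us[i := u])))"

definition continuous_form :: "('k::rc_field, 'v) nspace \<Rightarrow> nat \<Rightarrow> ('v list \<Rightarrow> 'k) \<Rightarrow> bool" where
  "continuous_form X k A \<longleftrightarrow>
     (\<forall>us\<in>power_points X k. \<forall>e>0. \<exists>d>0. \<forall>vs\<in>power_points X k.
        (\<forall>i<k. nnorm X (ndiff X (vs ! i) (us ! i)) < d) \<longrightarrow> dist (A vs) (A us) < e)"

definition homogeneous_polynomial :: "('k::rc_field, 'v) nspace \<Rightarrow> nat \<Rightarrow> ('v \<Rightarrow> 'k) \<Rightarrow> bool" where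
  "homogeneous_polynomial X k P \<longleftrightarrow>
     (\<exists>A. multilinear_form X k A \<and> continuous_form X k A \<and>
          (\<forall>x\<in>points X. P x = A (replicate k x)))"

definition continuous_polynomial :: "('k::rc_field, 'v) nspace \<Rightarrow> ('v \<Rightarrow> 'k) \<Rightarrow> bool" where
  "continuous_polynomial X P \<longleftrightarrow>
     (\<exists>m Q. (\<forall>k\<le>m. homogeneous_polynomial X k (Q k)) \<and>
            (\<forall>x\<in>points X. P x = (\<Sum>k\<le>m. Q k x)))"

definition polynomial_norm :: "('k::rc_field, 'v) nspace \<Rightarrow> ('v \<Rightarrow> 'k) \<Rightarrow> real" where
  "polynomial_norm X P = (SUP x\<in>unit_ball X. norm (P x))"


section \<open>The polynomial weak operator Daugavet property\<close>

definition OF_set :: "('k::rc_field, 'v) nspace \<Rightarrow> 'v list \<Rightarrow> 'v \<Rightarrow> real \<Rightarrow> 'v set" where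
  "OF_set X xs x' \<epsilon> =
     {y \<in> unit_ball X. \<exists>T. bounded_operator X T \<and> operator_norm X T \<le> 1 + \<epsilon> \<and>
        nnorm X (ndiff X (T y) x') < \<epsilon> \<and>
        (\<forall>x\<in>set xs. nnorm X (ndiff X (T x) x) < \<epsilon>)}"

definition polynomial_WODP :: "('k::rc_field, 'v) nspace \<Rightarrow> bool" where
  "polynomial_WODP X \<longleftrightarrow>
     (\<forall>P. continuous_polynomial X P \<and> polynomial_norm X P = 1 \<longrightarrow>
        (\<forall>xs x' \<alpha> \<epsilon>. set xs \<subseteq> unit_sphere X \<and> x' \<in> unit_ball X \<and> \<alpha> > 0 \<and> \<epsilon> > 0 \<longrightarrow>
           (\<exists>y\<in>OF_set X xs x' \<epsilon>. \<exists>\<omega>. norm \<omega> = 1 \<and> re (\<omega> * P y) > 1 - \<alpha>)))"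


section \<open>The space of Bochner integrable functions\<close>

text \<open>The library's \<open>integrable\<close> is restricted to second countable target spaces, whereas here
  \<open>Y\<close> may be nonseparable.\<close>

definition strongly_measurable :: "'a measure \<Rightarrow> ('a \<Rightarrow> 'y::banach) \<Rightarrow> bool" where
  "strongly_measurable M f \<longleftrightarrow>
     (\<exists>s. (\<forall>n. simple_function M (s n)) \<and> (AE x in M. (\<lambda>n. s n x) \<longlonglongrightarrow> f x))"

definition bochner_integrable :: "'a measure \<Rightarrow> ('a \<Rightarrow> 'y::banach) \<Rightarrow> bool" where
  "bochner_integrable M f \<longleftrightarrow>
     strongly_measurable M f \<and>
     (\<exists>s. (\<forall>n. Bochner_Integration.simple_bochner_integrable M (s n)) \<and>
          (\<lambda>n. \<integral>\<^sup>+x. ennreal (norm (f x - s n x)) \<partial>M) \<longlonglongrightarrow> 0)"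

definition L1_class :: "'a measure \<Rightarrow> ('a \<Rightarrow> 'y::banach) \<Rightarrow> ('a \<Rightarrow> 'y) set" where
  "L1_class M f = {g. bochner_integrable M g \<and> (AE x in M. g x = f x)}"

definition L1_rep :: "('a \<Rightarrow> 'y) set \<Rightarrow> 'a \<Rightarrow> 'y" where
  "L1_rep F = (SOME f. f \<in> F)"

text \<open>The norm is a \<open>nn_integral\<close> because a strongly measurable function, being only an almost
  everywhere limit, need not have a Borel measurable norm when \<open>M\<close> is incomplete.\<close>

definition L1_space :: "'a measure \<Rightarrow> ('k::rc_field \<Rightarrow> 'y::banach \<Rightarrow> 'y) \<Rightarrow> ('k, ('a \<Rightarrow> 'y) set) nspace" where
  "L1_space M smul =
     \<lparr> points = L1_class M ` {f. bochner_integrable M f},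
       nadd = (\<lambda>F G. L1_class M (\<lambda>x. L1_rep F x + L1_rep G x)),
       nscale = (\<lambda>a F. L1_class M (\<lambda>x. smul a (L1_rep F x))),
       nnorm = (\<lambda>F. enn2real (\<integral>\<^sup>+x. ennreal (norm (L1_rep F x)) \<partial>M)) \<rparr>"

definition atomless :: "'a measure \<Rightarrow> bool" where
  "atomless M \<longleftrightarrow>
     (\<forall>A\<in>sets M. emeasure M A > 0 \<longrightarrow>
        (\<exists>B\<in>sets M. B \<subseteq> A \<and> 0 < emeasure M B \<and> emeasure M B < emeasure M A))"

end

theory Submission
  imports Defs "HOL-Computational_Algebra.Fundamental_Theorem_Algebra" "HOL-Library.Function_Algebras"
begin

text \<open>
  Write \<open>X\<close> for \<open>L\<^sub>1(\<mu>,Y)\<close>, and let \<open>P\<close>, \<open>x\<^sub>1, \<dots>, x\<^sub>n\<close> and \<open>x'\<close> be given.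

  Suppose that \<open>h \<in> X\<close> has norm exactly \<open>1\<close> and vanishes off a set \<open>B\<close> on which all the \<open>x\<^sub>i\<close> have small
  integral. The Hahn--Banach theorem, applied in \<open>Y\<close> to the finitely many values of \<open>h\<close>, provides a linear
  functional \<open>\<phi>\<close> on \<open>X\<close> with \<open>\<phi>(h) = 1\<close> and \<open>|\<phi>(f)| \<le> \<integral>\<^sub>B \<parallel>f\<parallel>\<close>. Then \<open>T f = f 1\<^bsub>B\<^sup>c\<^esub> + \<phi>(f) x'\<close> is a
  contraction, it maps \<open>h\<close> to \<open>x'\<close>, and it moves \<open>x\<^sub>i\<close> by at most \<open>2 \<integral>\<^sub>B \<parallel>x\<^sub>i\<parallel>\<close>. So \<open>h\<close> is one of the
  points that are wanted (\<open>mem_OF_set\<close>), and it remains to find such an \<open>h\<close> for which \<open>|P(h)|\<close> is almost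
  \<open>\<parallel>P\<parallel>\<close> (\<open>concentrated_near_maximizer\<close>).

  For this, start from a simple function \<open>t\<close> of norm at most \<open>1\<close> with \<open>|P(t)|\<close> almost \<open>\<parallel>P\<parallel>\<close>, and cut its
  support into sets \<open>D\<close> so small that every block \<open>a = y 1\<^sub>D\<close> of \<open>t\<close> has norm at most \<open>\<delta>\<close>. Partition \<open>D\<close>
  into pieces \<open>D\<^sub>l\<close> of tiny measure. The functions \<open>b\<^sub>l = (\<mu>(D) / \<mu>(D\<^sub>l)) y 1\<^bsub>D\<^sub>l\<^esub>\<close> have the same norm as \<open>a\<close>,
  and \<open>a\<close> is their mean with the weights \<open>\<mu>(D\<^sub>l) / \<mu>(D)\<close>. A continuous polynomial satisfies
  \<open>P(z + u) = P(z) + D\<^sub>z(u) + O(\<parallel>u\<parallel>\<^sup>2)\<close> on the unit ball with \<open>D\<^sub>z\<close> linear, and the linear term is the same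
  for \<open>a\<close> as for the mean of the \<open>b\<^sub>l\<close>. Hence one of the \<open>b\<^sub>l\<close> can replace \<open>a\<close> at the cost of lowering
  \<open>|P|\<close> by at most \<open>O(\<parallel>a\<parallel>\<^sup>2)\<close> (\<open>better_than_mean\<close>). Replacing all blocks in turn costs
  \<open>O(\<Sum> \<parallel>a\<parallel>\<^sup>2) = O(\<delta>)\<close>, since the norms of the blocks add up to at most \<open>1\<close> (\<open>successive_choice\<close>), and the
  resulting function lives on a set of tiny measure.

  The same principle repairs the norm. Cut \<open>t\<close> to zero on a small set \<open>E\<close> and write the zero function on each
  small \<open>D \<subseteq> E\<close> as the mean of \<open>w 1\<^sub>D\<close> and \<open>- w 1\<^sub>D\<close>; with \<open>\<parallel>w\<parallel> \<mu>(E) = 1 - \<parallel>t 1\<^bsub>E\<^sup>c\<^esub>\<parallel>\<close>, choosing signs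
  brings the norm up to \<open>1\<close>. Rescaling \<open>t\<close> instead would not do, as a real polynomial such as
  \<open>1 - \<psi>\<^sup>2\<close> with a functional \<open>\<psi>\<close> may decrease along a ray.

  The functional \<open>\<phi>\<close> has to be linear over \<open>\<K>\<close>. It is obtained from a real-linear one in the usual way,
  which needs that a real normed field is \<open>\<real>\<close> or \<open>\<complex>\<close> with the usual absolute value
  (\<open>real_normed_field_cases\<close>).
\<close>

section \<open>Real normed fields\<close>

lemma map_poly_of_real_mult:
  "map_poly of_real (p * q) = (map_poly of_real p * map_poly of_real q :: 'k::real_normed_field poly)"
  by (intro poly_eqI) (simp add: coeff_map_poly coeff_mult)

lemma map_poly_of_real_add:
  "map_poly of_real (p + q) = (map_poly of_real p + map_poly of_real q :: 'k::real_normed_field poly)"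
  by (intro poly_eqI) (simp add: coeff_map_poly)

lemma poly_map_poly_of_real:
  "poly (map_poly of_real p) (of_real r :: 'k::real_normed_field) = of_real (poly p r)"
  by (induction p) (auto simp: map_poly_pCons)

text \<open>Over \<open>\<real>\<close> the polynomial splits into linear and quadratic factors. The value of a
  quadratic factor at \<open>a\<close> has norm at least \<open>m\<close>, and so has the square of the value of a linear one; squaring the norm lets both kinds count
  according to their degree.\<close>

lemma norm_real_poly_ge:
  fixes a :: "'k::real_normed_field"
  assumes m: "m > 0" and quad: "\<And>s t. m \<le> norm (a\<^sup>2 + of_real s * a + of_real t)"
    and monic: "lead_coeff p = 1"
  shows "m ^ degree p \<le> (norm (poly (map_poly of_real p) a))\<^sup>2"
  using monic
proof (induction "degree p" arbitrary: p rule: less_induct)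
  case less
  show ?case
  proof (cases "degree p = 0")
    case True
    with less.prems have "p = 1"
      by (auto elim!: degree_eq_zeroE)
    then show ?thesis by simp
  next
    case False
    then have "\<not> constant (poly (map_poly complex_of_real p))"
      by (simp add: constant_degree degree_map_poly)
    then obtain z where z: "poly (map_poly complex_of_real p) z = 0"
      using fundamental_theorem_of_algebra by blast
    have split: "m ^ degree p \<le> (norm (poly (map_poly of_real p) a))\<^sup>2"
      if d: "p = d * q" "lead_coeff d = 1" "degree d > 0"
        and bd: "m ^ degree d \<le> (norm (poly (map_poly of_real d) a))\<^sup>2" for d q :: "real poly"
    proof -
      have q: "lead_coeff q = 1"
        using less.prems d by (simp add: lead_coeff_mult)
      have deg: "degree p = degree d + degree q"
        using d q by (simp add: degree_mult_eq leading_coeff_neq_0 flip: leading_coeff_0_iff)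
      have "m ^ degree q \<le> (norm (poly (map_poly of_real q) a))\<^sup>2"
        using less.hyps[of q] q deg d(3) by simp
      with bd have "m ^ degree d * m ^ degree q \<le>
          (norm (poly (map_poly of_real d) a))\<^sup>2 * (norm (poly (map_poly of_real q) a))\<^sup>2"
        using m by (intro mult_mono) auto
      then show ?thesis
        by (simp add: d(1) map_poly_of_real_mult norm_mult power_mult_distrib deg[unfolded d(1)] power_add)
    qed
    show ?thesis
    proof (cases "Im z = 0")
      case True
      then have "z = of_real (Re z)" by (simp add: complex_eq_iff)
      then have "complex_of_real (poly p (Re z)) = 0"
        using z by (metis poly_map_poly_of_real)
      then have "poly p (Re z) = 0" by simp
      then obtain q where q: "p = [:- Re z, 1:] * q"
        by (auto simp: poly_eq_0_iff_dvd elim: dvdE)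
      have "m \<le> norm (a\<^sup>2 + of_real (- 2 * Re z) * a + of_real ((Re z)\<^sup>2))"
        by (rule quad)
      also have "a\<^sup>2 + of_real (- 2 * Re z) * a + of_real ((Re z)\<^sup>2) = (a - of_real (Re z))\<^sup>2"
        by (simp add: power2_eq_square algebra_simps)
      finally show ?thesis
        by (intro split[OF q]) (auto simp: map_poly_pCons norm_power)
    next
      case False
      define d where "d = [:(cmod z)\<^sup>2, - 2 * Re z, 1:]"
      define r where "r = p mod d"
      have degd: "degree d = 2" "d \<noteq> 0" by (auto simp: d_def)
      have dz: "poly (map_poly complex_of_real d) z = 0"
        by (simp add: d_def map_poly_pCons complex_eq_iff cmod_def power2_eq_square algebra_simps)
      have pdr: "p = d * (p div d) + r" by (simp add: r_def)
      then have "poly (map_poly complex_of_real p) z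
          = poly (map_poly complex_of_real d) z * poly (map_poly complex_of_real (p div d)) z
            + poly (map_poly complex_of_real r) z"
        by (metis map_poly_of_real_add map_poly_of_real_mult poly_add poly_mult)
      then have rz: "poly (map_poly complex_of_real r) z = 0"
        using z dz by simp
      have "degree r < 2 \<or> r = 0" using degree_mod_less[of d p] degd by (auto simp: r_def)
      then have "degree r \<le> 1" by auto
      then have "r = [:coeff r 0, coeff r 1:]"
        by (intro poly_eqI) (auto simp: coeff_pCons coeff_eq_0 split: nat.split)
      then obtain c e where r: "r = [:c, e:]" by blast
      have "c + e * Re z = 0" "e * Im z = 0"
        using rz by (auto simp: r map_poly_pCons complex_eq_iff algebra_simps)
      then have "r = 0" using False by (simp add: r)
      then have q: "p = d * (p div d)" using pdr by simp
      have "norm (poly (map_poly of_real d) a) \<ge> m"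
        using quad[of "- 2 * Re z" "(cmod z)\<^sup>2"]
        by (simp add: d_def map_poly_pCons power2_eq_square algebra_simps)
      then have "m ^ 2 \<le> (norm (poly (map_poly of_real d) a))\<^sup>2"
        using m by (intro power_mono) auto
      then show ?thesis
        by (intro split[OF q]) (auto simp: degd, simp add: d_def numeral_2_eq_2)
    qed
  qed
qed

text \<open>As \<open>a\<close> is not real, \<open>1\<close> and \<open>a\<close> are independent, so the values at \<open>a\<close> of the monic real
  quadratics tend to infinity with the coefficients and compactness applies.\<close>

lemma real_quadratic_minimum_attained:
  fixes a :: "'k::real_normed_field"
  assumes "\<And>r. a \<noteq> of_real r"
  obtains s0 t0 where "\<And>s t. norm (a\<^sup>2 + of_real s0 * a + of_real t0)
      \<le> norm (a\<^sup>2 + of_real s * a + of_real t)"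
proof -
  have sq: "continuous_on S (\<lambda>p::real\<times>real. norm (a\<^sup>2 + of_real (fst p) * a + of_real (snd p)))" for S
    by (intro continuous_intros)
  have lin: "continuous_on S (\<lambda>t::real. norm (a + of_real t))" for S
    by (intro continuous_intros)
  \<comment> \<open>Outside \<open>[-R, R]\<close> the values of \<open>t \<mapsto> \<parallel>a + t\<parallel>\<close> exceed the value at \<open>t = 0\<close>.\<close>
  define R where "R = 2 * norm a"
  have R0: "R \<ge> 0" by (simp add: R_def)
  have "\<exists>x\<in>cbox (-R) R. \<forall>y\<in>cbox (-R) R. norm (a + of_real x) \<le> norm (a + of_real y)"
    using R0 by (intro continuous_attains_inf compact_cbox lin) auto
  then obtain x where x: "x \<in> cbox (-R) R" "\<And>y. y\<in>cbox (-R) R \<Longrightarrow> norm (a + of_real x) \<le> norm (a + of_real y)"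
    by blast
  define d where "d = norm (a + of_real x)"
  have "a + of_real x \<noteq> 0"
    using assms[of "-x"] by (simp add: add_eq_0_iff2)
  then have d0: "d > 0" by (simp add: d_def)
  have dall: "d \<le> norm (a + of_real t)" for t
  proof (cases "t \<in> cbox (-R) R")
    case False
    then have "\<bar>t\<bar> > R" by auto
    moreover have "\<bar>t\<bar> \<le> norm (a + of_real t) + norm a"
      using norm_triangle_ineq4[of "a + of_real t" a] by simp
    moreover have "d \<le> norm a"
      using x(2)[of 0] R0 by (simp add: d_def)
    ultimately show ?thesis by (simp add: R_def)
  qed (use x in \<open>simp add: d_def\<close>)
  have sall: "\<bar>s\<bar> * d \<le> norm (of_real s * a + of_real t)" for s t
  proof (cases "s = 0")
    case False
    have "\<bar>s\<bar> * d \<le> \<bar>s\<bar> * norm (a + of_real (t/s))"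
      by (intro mult_left_mono dall) auto
    also have "\<dots> = norm (of_real s * (a + of_real (t/s)))"
      by (simp add: norm_mult)
    also have "of_real s * (a + of_real (t/s)) = of_real s * a + of_real t"
      using False by (simp add: algebra_simps)
    finally show ?thesis .
  qed auto
  \<comment> \<open>Quadratics with coefficients beyond \<open>S\<close> and \<open>T\<close> have values of larger norm at \<open>a\<close> than \<open>x\<^sup>2\<close> has.\<close>
  define S where "S = 2 * (norm a)\<^sup>2 / d"
  define T where "T = 2 * (norm a)\<^sup>2 + S * norm a"
  have S0: "S \<ge> 0" "T \<ge> 0" using d0 by (auto simp: S_def T_def)
  let ?f = "\<lambda>p::real\<times>real. norm (a\<^sup>2 + of_real (fst p) * a + of_real (snd p))"
  let ?K = "cbox (-S,-T) (S,T)"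
  have "(0, 0) \<in> ?K" using S0 by (simp add: cbox_Pair_eq)
  then have "?K \<noteq> {}" by blast
  then have "\<exists>x\<in>?K. \<forall>y\<in>?K. ?f x \<le> ?f y"
    by (intro continuous_attains_inf compact_cbox sq)
  then obtain p where p: "p\<in>?K" "\<And>y. y \<in> ?K \<Longrightarrow> ?f p \<le> ?f y" by blast
  have "?f p \<le> ?f (s,t)" for s t
  proof (cases "?f (s,t) \<le> (norm a)\<^sup>2")
    case True
    have "norm (of_real s * a + of_real t) \<le> ?f (s,t) + norm (a\<^sup>2)"
      using norm_triangle_ineq4[of "a\<^sup>2 + of_real s * a + of_real t" "a\<^sup>2"]
      by (simp add: algebra_simps)
    then have st: "norm (of_real s * a + of_real t) \<le> 2 * (norm a)\<^sup>2"
      using True by (simp add: norm_power)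
    then have "\<bar>s\<bar> * d \<le> 2 * (norm a)\<^sup>2" using sall[of s t] by linarith
    then have s: "\<bar>s\<bar> \<le> S" using d0 by (simp add: S_def field_simps)
    have "\<bar>t\<bar> \<le> norm (of_real s * a + of_real t) + norm (of_real s * a)"
      using norm_triangle_ineq4[of "of_real s * a + of_real t" "of_real s * a"] by simp
    also have "\<dots> \<le> 2 * (norm a)\<^sup>2 + S * norm a"
      using st s by (intro add_mono) (auto simp: norm_mult intro: mult_right_mono)
    finally have "\<bar>t\<bar> \<le> T" by (simp add: T_def)
    with s show ?thesis by (intro p(2)) auto
  next
    case False
    have "?f p \<le> ?f (0,0)" using S0 by (intro p(2)) auto
    then show ?thesis using False by (simp add: norm_power)
  qed
  then show thesis using that[of "fst p" "snd p"] by simp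
qed

text \<open>Suppose that the minimum \<open>m\<close> of \<open>\<parallel>a\<^sup>2 + s a + t\<parallel>\<close> is positive, and let it be attained at \<open>(s, t)\<close>. With
  \<open>g = x\<^sup>2 + s x + t\<close> and \<open>e = m / 2\<close>, the polynomial \<open>g - e\<close> divides \<open>g\<^sup>n - e\<^sup>n\<close>, whose value at \<open>a\<close> has norm at most
  \<open>m\<^sup>n + e\<^sup>n\<close>, while the cofactor has norm at least \<open>m\<^bsup>n - 1\<^esup>\<close>. For \<open>n \<longlonglongrightarrow> \<infinity>\<close> it follows that
  \<open>\<parallel>g(a) - e\<parallel> \<le> m\<close>, so the minimum is attained at \<open>(s, t - m / 2)\<close> as well. Iterating, it is attained
  with arbitrarily large constant coefficients, which is absurd.\<close>

lemma root_of_real_quadratic: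
  fixes a :: "'k::real_normed_field"
  shows "\<exists>s t. a\<^sup>2 + of_real s * a + of_real t = 0"
proof (cases "\<exists>r. a = of_real r")
  case True
  then obtain r where "a = of_real r" by blast
  then have "a\<^sup>2 + of_real 0 * a + of_real (- r\<^sup>2) = 0" by simp
  then show ?thesis by blast
next
  case False
  then obtain s0 t0 where min: "\<And>s t. norm (a\<^sup>2 + of_real s0 * a + of_real t0)
      \<le> norm (a\<^sup>2 + of_real s * a + of_real t)"
    using real_quadratic_minimum_attained[of a] by blast
  define m where "m = norm (a\<^sup>2 + of_real s0 * a + of_real t0)"
  show ?thesis
  proof (rule ccontr)
    assume contra: "\<nexists>s t. a\<^sup>2 + of_real s * a + of_real t = 0"
    then have m0: "m > 0" by (auto simp: m_def)
    have quad: "m \<le> norm (a\<^sup>2 + of_real s * a + of_real t)" for s t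
      using min by (simp add: m_def)
    have step: "norm (a\<^sup>2 + of_real s0 * a + of_real (t - m/2)) = m"
      if t: "norm (a\<^sup>2 + of_real s0 * a + of_real t) = m" for t
    proof -
      define g where "g = [:t, s0, 1:]"
      define e where "e = [:m/2:]"
      have ge: "g - e = [:t - m/2, s0, 1:]" by (simp add: g_def e_def)
      define v where "v = norm (a\<^sup>2 + of_real s0 * a + of_real (t - m/2))"
      have bound: "v \<le> m * (1 + (1/2) ^ n)" if n: "n \<ge> 1" for n
      proof -
        define H where "H = (\<Sum>i<n. e ^ (n - Suc i) * g ^ i)"
        have fac: "g ^ n - e ^ n = (g - e) * H"
          by (simp add: H_def power_diff_sumr2)
        have degg: "degree (g ^ n) = 2 * n" "lead_coeff (g ^ n) = 1"
          by (simp add: degree_power_eq g_def, simp only: lead_coeff_power, simp add: g_def)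
        have dege: "degree (e ^ n) = 0"
          using degree_power_le[of e n] by (simp add: e_def)
        have lc: "lead_coeff (g ^ n - e ^ n) = 1" and dg: "degree (g ^ n - e ^ n) = 2 * n"
        proof -
          have "degree (- (e ^ n)) < degree (g ^ n)"
            using n by (simp add: degg dege)
          from degree_add_eq_left[OF this] lead_coeff_add_le[of "- (e^n)" "g^n"] this
          show "degree (g ^ n - e ^ n) = 2 * n" 
            by (simp add: degg)
          then show "lead_coeff (g ^ n - e ^ n) = 1"
            using n degg dege by (simp add: coeff_eq_0)
        qed
        have lH: "lead_coeff H = 1"
          using lc unfolding fac lead_coeff_mult ge by simp
        then have "H \<noteq> 0" by auto
        moreover have "g - e \<noteq> 0" "degree (g - e) = 2" by (auto simp: ge)
        ultimately have "degree H + 2 = 2 * n"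
          using dg unfolding fac by (simp add: degree_mult_eq)
        then have dH: "degree H = 2 * (n - 1)" by simp
        have "(m ^ (n - 1))\<^sup>2 \<le> (norm (poly (map_poly of_real H) a))\<^sup>2"
          using norm_real_poly_ge[OF m0 quad lH] by (simp add: dH power_mult mult.commute flip: power_mult)
        then have Hge: "m ^ (n - 1) \<le> norm (poly (map_poly of_real H) a)"
          by (rule power2_le_imp_le) auto
        have pow: "poly (map_poly of_real (q ^ n)) a = (poly (map_poly of_real q) a) ^ n" for q :: "real poly"
          by (induction n) (auto simp: map_poly_of_real_mult)
        have "v * m ^ (n - 1) \<le> v * norm (poly (map_poly of_real H) a)"
          using Hge by (intro mult_left_mono) (auto simp: v_def)
        also have "\<dots> = norm (poly (map_poly of_real ((g - e) * H)) a)"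
          unfolding map_poly_of_real_mult poly_mult norm_mult
          by (simp add: ge map_poly_pCons v_def power2_eq_square algebra_simps)
        also have "(g - e) * H = g ^ n + (- 1) * e ^ n" using fac by simp
        also have "poly (map_poly of_real (g ^ n + (- 1) * e ^ n)) a
            = (a\<^sup>2 + of_real s0 * a + of_real t) ^ n - (of_real (m/2)) ^ n"
          unfolding map_poly_of_real_add map_poly_of_real_mult poly_add poly_mult pow
          by (simp add: g_def e_def map_poly_pCons power2_eq_square algebra_simps
              one_pCons)
        also have "norm \<dots> \<le> m ^ n + (m/2) ^ n"
          using m0 norm_triangle_ineq4[of "(a\<^sup>2 + of_real s0 * a + of_real t) ^ n" "(of_real (m/2)) ^ n"]
          by (simp only: norm_power t norm_of_real)
        also have "\<dots> = m * (1 + (1/2) ^ n) * m ^ (n - 1)"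
          using n by (cases n) (auto simp: power_divide algebra_simps)
        finally show ?thesis using m0 by simp
      qed
      have "(\<lambda>n. m * (1 + (1/2) ^ n)) \<longlonglongrightarrow> m * (1 + 0)"
        by (intro tendsto_intros LIMSEQ_realpow_zero) auto
      then have "v \<le> m * (1 + 0)"
        using bound by (intro LIMSEQ_le_const) auto
      then show ?thesis using quad[of s0 "t - m/2"] by (simp add: v_def)
    qed
    have all: "norm (a\<^sup>2 + of_real s0 * a + of_real (t0 - of_nat n * (m/2))) = m" for n
    proof (induction n)
      case (Suc n)
      from step[OF this] show ?case by (simp add: algebra_simps add_divide_distrib)
    qed (simp add: m_def)
    define b where "b = a\<^sup>2 + of_real s0 * a + of_real t0"
    obtain n where n: "real n * (m/2) > m + norm b"
      using reals_Archimedean3[of "m/2"] m0 by (meson half_gt_zero)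
    have "real n * (m/2) = norm (of_real (real n * (m/2)) :: 'k)"
      using m0 by (simp add: norm_mult)
    also have "\<dots> = norm (b - (a\<^sup>2 + of_real s0 * a + of_real (t0 - real n * (m/2))))"
      by (simp add: b_def)
    also have "\<dots> \<le> norm b + m"
      using norm_triangle_ineq4[of b "a\<^sup>2 + of_real s0 * a + of_real (t0 - real n * (m/2))"] all[of n]
      by simp
    finally show False using n by simp
  qed
qed

text \<open>A multiplicative norm is bounded on the powers of \<open>c + d i\<close> if \<open>c\<^sup>2 + d\<^sup>2 = 1\<close>, because these stay on the
  unit circle; hence it is at most \<open>1\<close> there. Multiplying by the conjugate gives the converse.\<close>

lemma norm_real_plus_imaginary:
  fixes i :: "'k::real_normed_field"
  assumes i: "i\<^sup>2 = - 1"
  shows "(norm (of_real c + of_real d * i))\<^sup>2 = c\<^sup>2 + d\<^sup>2"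
proof -
  have ni: "norm i = 1"
    by (metis assms norm_minus_cancel norm_one norm_power power2_eq_1_iff abs_norm_cancel norm_ge_zero real_sqrt_abs real_sqrt_one)
  have unit: "norm (of_real c + of_real d * i) \<le> 1" if cd: "c\<^sup>2 + d\<^sup>2 = 1" for c d
  proof (rule ccontr)
    define x where "x = of_real c + of_real d * i"
    assume "\<not> norm (of_real c + of_real d * i) \<le> 1"
    then have "norm x > 1" by (simp add: x_def)
    then obtain n where n: "2 < norm x ^ n"
      using real_arch_pow by blast
    have "\<exists>c d. c\<^sup>2 + d\<^sup>2 = 1 \<and> x ^ n = of_real c + of_real d * i" for n
    proof (induction n)
      case (Suc n)
      then obtain p q where pq: "p\<^sup>2 + q\<^sup>2 = 1" "x ^ n = of_real p + of_real q * i" by blast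
      have "x * (of_real p + of_real q * i) = of_real (c * p) + of_real (d * q) * i\<^sup>2 + of_real (c * q + d * p) * i"
        by (simp add: x_def algebra_simps power2_eq_square)
      then have "x ^ Suc n = of_real (c * p - d * q) + of_real (c * q + d * p) * i"
        by (simp add: pq(2) i)
      moreover have "(c * p - d * q)\<^sup>2 + (c * q + d * p)\<^sup>2 = (c\<^sup>2 + d\<^sup>2) * (p\<^sup>2 + q\<^sup>2)"
        by (simp add: power2_eq_square algebra_simps)
      ultimately show ?case using pq(1) cd by (metis mult_1)
    qed (intro exI[of _ 1] exI[of _ 0], auto)
    then obtain p q where pq: "p\<^sup>2 + q\<^sup>2 = 1" "x ^ n = of_real p + of_real q * i" by blast
    have "\<bar>p\<bar> \<le> 1" "\<bar>q\<bar> \<le> 1"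
      using pq(1) by (simp_all flip: abs_square_le_1) (smt (verit) zero_le_power2)+
    moreover have "norm (x ^ n) \<le> \<bar>p\<bar> + \<bar>q\<bar>"
      using norm_triangle_ineq[of "of_real p" "of_real q * i"] by (simp add: pq(2) norm_mult ni)
    ultimately show False using n by (simp add: norm_power)
  qed
  have le: "norm (of_real c + of_real d * i) \<le> sqrt (c\<^sup>2 + d\<^sup>2)" for c d
  proof (cases "c\<^sup>2 + d\<^sup>2 = 0")
    case False
    define r where "r = sqrt (c\<^sup>2 + d\<^sup>2)"
    have r: "r > 0" "r\<^sup>2 = c\<^sup>2 + d\<^sup>2" using False by (auto simp: r_def sum_power2_gt_zero_iff)
    have "(c / r)\<^sup>2 + (d / r)\<^sup>2 = 1"
      using r by (metis add_divide_distrib divide_self power_divide power_not_zero less_numeral_extra(3))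
    from unit[OF this] have "norm (of_real r * (of_real (c/r) + of_real (d/r) * i)) \<le> r"
      using r(1) by (simp add: norm_mult)
    also have "of_real r * (of_real (c/r) + of_real (d/r) * i) = of_real c + of_real d * i"
      using r(1) by (simp add: algebra_simps)
    finally show ?thesis by (simp add: r_def)
  qed (auto simp: sum_power2_eq_zero_iff)
  have "of_real (c\<^sup>2 + d\<^sup>2) = (of_real c + of_real d * i) * (of_real c + of_real (- d) * i)"
  proof -
    have "(of_real c + of_real d * i) * (of_real c + of_real (- d) * i) = of_real (c\<^sup>2) - of_real (d\<^sup>2) * i\<^sup>2"
      by (simp add: algebra_simps power2_eq_square)
    then show ?thesis by (simp add: i)
  qed
  then have "c\<^sup>2 + d\<^sup>2 = norm (of_real c + of_real d * i) * norm (of_real c + of_real (- d) * i)"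
    by (metis abs_of_nonneg norm_mult norm_of_real sum_power2_ge_zero)
  also have "\<dots> \<le> norm (of_real c + of_real d * i) * sqrt (c\<^sup>2 + d\<^sup>2)"
    using le[of c "-d"] by (intro mult_left_mono) auto
  finally have "sqrt (c\<^sup>2 + d\<^sup>2) \<le> norm (of_real c + of_real d * i)"
    by (cases "c\<^sup>2 + d\<^sup>2 = 0")
       (auto simp: real_div_sqrt divide_le_eq[symmetric] less_le sum_power2_ge_zero
         simp flip: pos_divide_le_eq)
  with le[of c d] have "norm (of_real c + of_real d * i) = sqrt (c\<^sup>2 + d\<^sup>2)" by simp
  then show ?thesis by simp
qed

text \<open>The theorem of Ostrowski and Mazur. Completing the square in a real quadratic with root \<open>a\<close> shows that
  \<open>a\<close> is real or yields a square root of \<open>-1\<close>.\<close>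

lemma real_normed_field_cases:
  obtains (real) "\<And>a::'k::real_normed_field. \<exists>r. a = of_real r"
  | (complex) i :: "'k::real_normed_field" where "i\<^sup>2 = - 1" "\<And>a::'k::real_normed_field. \<exists>c d. a = of_real c + of_real d * i"
proof (cases "\<forall>a::'k. \<exists>r. a = of_real r")
  case False
  have square: "\<exists>h c. (b + of_real h)\<^sup>2 = of_real c" for b :: 'k
  proof -
    obtain s t where "b\<^sup>2 + of_real s * b + of_real t = 0"
      using root_of_real_quadratic by blast
    moreover have "(b + of_real (s/2))\<^sup>2
        = (b\<^sup>2 + of_real s * b + of_real t) + of_real ((s/2)\<^sup>2 - t)"
      by (simp add: power2_eq_square field_simps)
    ultimately have "(b + of_real (s/2))\<^sup>2 = of_real ((s/2)\<^sup>2 - t)"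
      by simp
    then show ?thesis by blast
  qed
  have nonneg: "\<exists>r. b = of_real r" if "(b + of_real h)\<^sup>2 = of_real c" "c \<ge> 0" for b :: 'k and h c
  proof -
    have "(b + of_real h)\<^sup>2 = (of_real (sqrt c))\<^sup>2"
      using that by (simp flip: of_real_power)
    then consider "b + of_real h = of_real (sqrt c)" | "b + of_real h = - of_real (sqrt c)"
      unfolding power2_eq_iff by blast
    then show ?thesis
    proof cases
      case 1
      then have "b = of_real (sqrt c - h)" by (simp add: eq_diff_eq)
      then show ?thesis by blast
    next
      case 2
      then have "b = of_real (- sqrt c - h)" by (simp add: eq_diff_eq)
      then show ?thesis by blast
    qed
  qed
  from False obtain a :: 'k where a: "\<And>r. a \<noteq> of_real r" by blast
  obtain h c where hc: "(a + of_real h)\<^sup>2 = of_real c" using square by blast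
  with nonneg a have c: "c < 0" by (meson not_le)
  define i where "i = (a + of_real h) / of_real (sqrt (- c))"
  have i: "i\<^sup>2 = - 1"
    using c by (simp add: i_def power_divide hc flip: of_real_power)
  have "\<exists>c d. b = of_real c + of_real d * i" for b :: 'k
  proof -
    obtain h c where hc: "(b + of_real h)\<^sup>2 = of_real c" using square by blast
    show ?thesis
    proof (cases "c \<ge> 0")
      case True
      then obtain r where "b = of_real r" using nonneg hc by blast
      then have "b = of_real r + of_real 0 * i" by simp
      then show ?thesis by blast
    next
      case False
      then have "(b + of_real h)\<^sup>2 = (of_real (sqrt (- c)) * i)\<^sup>2"
        by (simp add: hc power_mult_distrib i flip: of_real_power)
      then consider "b + of_real h = of_real (sqrt (- c)) * i" | "b + of_real h = - (of_real (sqrt (- c)) * i)"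
        unfolding power2_eq_iff by blast
      then show ?thesis
      proof cases
        case 1
        then have "b = of_real (- h) + of_real (sqrt (- c)) * i" by (simp add: algebra_simps eq_diff_eq)
        then show ?thesis by blast
      next
        case 2
        then have "b = - (of_real (sqrt (- c)) * i) - of_real h" by (simp only: eq_diff_eq)
        then have "b = of_real (- h) + of_real (- sqrt (- c)) * i" by simp
        then show ?thesis by blast
      qed
    qed
  qed
  with i show thesis by (rule that(2))
qed (use that in blast)


section \<open>Norming functionals\<close>

definition sublinear :: "('y::real_vector \<Rightarrow> real) \<Rightarrow> bool" where
  "sublinear p \<longleftrightarrow> (\<forall>x y. p (x + y) \<le> p x + p y) \<and> (\<forall>x. \<forall>c>0. p (c *\<^sub>R x) = c * p x) \<and> p 0 = 0"

lemma sublinear_ge: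
  assumes "sublinear p" shows "- p (- x) \<le> p x"
proof -
  have "p (x + - x) \<le> p x + p (- x)" "p 0 = 0"
    using assms unfolding sublinear_def by blast+
  then show ?thesis by simp
qed

text \<open>The functional \<open>q(x) = inf\<^bsub>t \<ge> 0\<^esub> p(x + t y) - t p(y)\<close> is the largest sublinear one below \<open>p\<close> whose
  value at \<open>- y\<close> is at most \<open>- p(y)\<close>.\<close>

lemma sublinear_lower:
  fixes p :: "'y::real_vector \<Rightarrow> real"
  assumes p: "sublinear p"
  obtains q where "sublinear q" "\<And>x. q x \<le> p x" "q (- y) \<le> - p y"
proof -
  have add: "\<And>x y. p (x + y) \<le> p x + p y" and hom: "\<And>x c. c > 0 \<Longrightarrow> p (c *\<^sub>R x) = c * p x" and p0: "p 0 = 0"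
    using p by (auto simp: sublinear_def)
  have hom0: "p (c *\<^sub>R x) = c * p x" if "c \<ge> 0" for c x
    using that hom p0 by (cases "c = 0") auto
  define F where "F x t = p (x + t *\<^sub>R y) - t * p y" for x t
  define q where "q x = (INF t\<in>{0..}. F x t)" for x
  \<comment> \<open>The infimum is finite: by subadditivity, \<open>F\<close> is bounded below in \<open>t\<close>.\<close>
  have lb: "- p (- x) \<le> F x t" if "t \<ge> 0" for x t
    using add[of "x + t *\<^sub>R y" "- x"] hom0[OF that, of y] by (simp add: F_def)
  have bdd: "bdd_below (F x ` {0..})" for x
    using lb by (intro bdd_belowI2[of _ "- p (- x)"]) auto
  have le: "q x \<le> F x t" if "t \<ge> 0" for x t
    unfolding q_def using bdd that by (intro cINF_lower) auto
  have ge: "c \<le> q x" if "\<And>t. t \<ge> 0 \<Longrightarrow> c \<le> F x t" for c x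
    unfolding q_def using that by (intro cINF_greatest) auto
  have qp: "q x \<le> p x" for x
    using le[of 0 x] by (simp add: F_def)
  have scale: "q (c *\<^sub>R x) \<le> c * q x" if c: "c > 0" for c x
  proof -
    have "q (c *\<^sub>R x) / c \<le> q x"
    proof (rule ge)
      fix t :: real assume t: "t \<ge> 0"
      have "q (c *\<^sub>R x) \<le> F (c *\<^sub>R x) (c * t)" using t c by (intro le) auto
      also have "\<dots> = c * F x t"
        using hom[OF c, of "x + t *\<^sub>R y"] by (simp add: F_def algebra_simps)
      finally show "q (c *\<^sub>R x) / c \<le> F x t" using c by (simp add: field_simps)
    qed
    then show ?thesis using c by (simp add: field_simps)
  qed
  show thesis
  proof
    show "sublinear q"
      unfolding sublinear_def
    proof (intro conjI allI impI)
      fix x z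
      have "q (x + z) - q x \<le> q z"
      proof (rule ge)
        fix s :: real assume s: "s \<ge> 0"
        have "q (x + z) - F z s \<le> q x"
        proof (rule ge)
          fix t :: real assume t: "t \<ge> 0"
          have "q (x + z) \<le> F (x + z) (t + s)" using t s by (intro le) auto
          also have "\<dots> \<le> F x t + F z s"
            using add[of "x + t *\<^sub>R y" "z + s *\<^sub>R y"] by (simp add: F_def algebra_simps)
          finally show "q (x + z) - F z s \<le> F x t" by simp
        qed
        then show "q (x + z) - q x \<le> F z s" by simp
      qed
      then show "q (x + z) \<le> q x + q z" by simp
    next
      fix x and c :: real assume c: "c > 0"
      have "q ((1/c) *\<^sub>R (c *\<^sub>R x)) \<le> (1/c) * q (c *\<^sub>R x)" using c by (intro scale) auto
      with c have "c * q x \<le> q (c *\<^sub>R x)" by (simp add: field_simps)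
      with scale[OF c, of x] show "q (c *\<^sub>R x) = c * q x" by simp
    next
      have "0 \<le> q 0" using lb[of _ 0] p0 by (intro ge) simp
      with qp[of 0] p0 show "q 0 = 0" by simp
    qed
    show "q (- y) \<le> - p y"
      using le[of 1 "- y"] p0 by (simp add: F_def)
  qed (rule qp)
qed

lemma minimal_sublinear_imp_linear:
  assumes p: "sublinear p" and min: "\<And>q. sublinear q \<Longrightarrow> (\<And>x. q x \<le> p x) \<Longrightarrow> q = p"
  shows "linear p"
proof -
  have neg: "p (- y) = - p y" for y
  proof -
    obtain q where q: "sublinear q" "\<And>x. q x \<le> p x" "q (- y) \<le> - p y"
      using sublinear_lower[OF p] by blast
    with min[of q] have "p (- y) \<le> - p y" by auto
    with sublinear_ge[OF p, of y] show ?thesis by linarith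
  qed
  have add: "\<And>x y. p (x + y) \<le> p x + p y" and hom: "\<And>x c. c > 0 \<Longrightarrow> p (c *\<^sub>R x) = c * p x" and p0: "p 0 = 0"
    using p by (auto simp: sublinear_def)
  show ?thesis
  proof (rule linearI)
    fix x y
    have "- p (x + y) \<le> - p x + - p y"
      using add[of "- x" "- y"] neg[of x] neg[of y] neg[of "x + y"] by simp
    with add[of x y] show "p (x + y) = p x + p y" by simp
  next
    fix c x
    show "p (c *\<^sub>R x) = c *\<^sub>R p x"
    proof (cases c "0::real" rule: linorder_cases)
      case less
      then have "p ((- c) *\<^sub>R x) = - c * p x" by (intro hom) simp
      with neg[of "c *\<^sub>R x"] show ?thesis by simp
    qed (use p0 hom in auto)
  qed
qed

text \<open>The Hahn--Banach theorem: a minimal sublinear functional below \<open>p\<close> exists by Zorn's lemma, the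
  pointwise infimum of a chain being sublinear, and a minimal one is linear.\<close>

lemma linear_below_sublinear:
  fixes p :: "'y::real_vector \<Rightarrow> real"
  assumes p: "sublinear p"
  obtains u where "linear u" "\<And>x. u x \<le> p x"
proof -
  define A where "A = {q. sublinear q \<and> (\<forall>x. q x \<le> p x)}"
  define R :: "('y \<Rightarrow> real) \<Rightarrow> ('y \<Rightarrow> real) \<Rightarrow> bool" where "R q r \<longleftrightarrow> (\<forall>x. r x \<le> q x)" for q r
  have "\<exists>m\<in>A. \<forall>a\<in>A. R m a \<longrightarrow> a = m"
  proof (rule predicate_Zorn)
    show "partial_order_on A (relation_of R A)"
      by (rule partial_order_on_relation_ofI) (auto simp: R_def fun_eq_iff intro: order_trans antisym)
    fix C assume C: "C \<in> Chains (relation_of R A)"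
    then have CA: "C \<subseteq> A" and total: "\<And>q r. q \<in> C \<Longrightarrow> r \<in> C \<Longrightarrow> R q r \<or> R r q"
      by (auto simp: Chains_def relation_of_def)
    show "\<exists>u\<in>A. \<forall>a\<in>C. R a u"
    proof (cases "C = {}")
      case True
      then show ?thesis using p by (auto simp: A_def)
    next
      case False
      define m where "m x = (INF q\<in>C. q x)" for x
      have lb: "- p (- x) \<le> q x" if "q \<in> C" for q x
      proof -
        have "sublinear q" "q (- x) \<le> p (- x)" using that CA by (auto simp: A_def)
        with sublinear_ge[of q x] show ?thesis by linarith
      qed
      have le: "m x \<le> q x" if "q \<in> C" for q x
        unfolding m_def using lb that by (intro cINF_lower bdd_belowI2[of _ "- p (- x)"]) auto
      have ge: "c \<le> m x" if "\<And>q. q \<in> C \<Longrightarrow> c \<le> q x" for c x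
        unfolding m_def using that False by (intro cINF_greatest) auto
      have sub: "sublinear q" if "q \<in> C" for q using that CA by (auto simp: A_def)
      have "sublinear m"
        unfolding sublinear_def
      proof (intro conjI allI impI)
        fix x y
        have "m (x + y) - m x \<le> m y"
        proof (rule ge)
          fix r assume r: "r \<in> C"
          have "m (x + y) - r y \<le> m x"
          proof (rule ge)
            fix q assume q: "q \<in> C"
            obtain s where s: "s \<in> C" "s x \<le> q x" "s y \<le> r y"
              using total[OF q r] q r by (auto simp: R_def)
            have "m (x + y) \<le> s (x + y)" using s by (intro le)
            also have "\<dots> \<le> s x + s y" using sub[OF s(1)] by (auto simp: sublinear_def)
            finally show "m (x + y) - r y \<le> q x" using s by simp
          qed
          then show "m (x + y) - m x \<le> r y" by simp
        qed
        then show "m (x + y) \<le> m x + m y" by simp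
      next
        fix x and c :: real assume c: "c > 0"
        have hom: "q (c *\<^sub>R x) = c * q x" if "q \<in> C" for q
          using sub[OF that] c by (auto simp: sublinear_def)
        have "m (c *\<^sub>R x) / c \<le> m x"
        proof (rule ge)
          fix q assume q: "q \<in> C"
          show "m (c *\<^sub>R x) / c \<le> q x"
            using le[OF q, of "c *\<^sub>R x"] c by (simp add: hom[OF q] field_simps)
        qed
        moreover have "c * m x \<le> m (c *\<^sub>R x)"
        proof (rule ge)
          fix q assume q: "q \<in> C"
          show "c * m x \<le> q (c *\<^sub>R x)"
            using le[OF q, of x] c by (simp add: hom[OF q])
        qed
        ultimately show "m (c *\<^sub>R x) = c * m x" using c by (simp add: field_simps)
      next
        have zero: "q 0 = 0" if "q \<in> C" for q using sub[OF that] by (auto simp: sublinear_def)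
        obtain q where "q \<in> C" using False by blast
        with le[of q 0] zero have "m 0 \<le> 0" by force
        moreover have "0 \<le> m 0" by (rule ge) (metis zero order_refl)
        ultimately show "m 0 = 0" by simp
      qed
      moreover obtain q where "q \<in> C" using False by blast
      with le CA have "m x \<le> p x" for x by (force simp: A_def intro: order_trans)
      ultimately have "m \<in> A" by (auto simp: A_def)
      with le show ?thesis by (auto simp: R_def)
    qed
  qed
  then obtain m where m: "m \<in> A" "\<And>a. a \<in> A \<Longrightarrow> R m a \<Longrightarrow> a = m" by blast
  have "linear m"
  proof (rule minimal_sublinear_imp_linear)
    fix q assume "sublinear q" "\<And>x. q x \<le> m x"
    with m(1) show "q = m" by (intro m(2)) (force simp: A_def R_def intro: order_trans)+
  qed (use m in \<open>auto simp: A_def\<close>)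
  with m(1) show thesis by (intro that) (auto simp: A_def)
qed

lemma norming_functional:
  fixes y :: "'y::real_normed_vector"
  obtains u :: "'y \<Rightarrow> real" where "bounded_linear u" "\<And>x. \<bar>u x\<bar> \<le> norm x" "u y = norm y"
proof -
  have "sublinear (norm :: 'y \<Rightarrow> real)"
    by (auto simp: sublinear_def norm_triangle_ineq)
  then obtain q where q: "sublinear q" "\<And>x. q x \<le> norm x" "q (- y) \<le> - norm y"
    using sublinear_lower by blast
  then obtain u where u: "linear u" "\<And>x. u x \<le> q x" using linear_below_sublinear by blast
  have le: "\<bar>u x\<bar> \<le> norm x" for x
    using u(2)[of x] u(2)[of "- x"] q(2)[of x] q(2)[of "- x"] linear_neg[OF u(1), of x] by simp
  have "u y = norm y"
    using u(2)[of "- y"] q(3) le[of y] linear_neg[OF u(1), of y] by simp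
  with le u(1) show thesis
    by (intro that[of u] bounded_linear_intro[where K = 1]) (auto simp: linear_add linear_scale)
qed


section \<open>Second-order behaviour of polynomials\<close>

text \<open>Functions, unlike their classes, form a type that is a real vector space. What follows is therefore
  stated for a subspace with a seminorm, which is later the one of \<open>L\<^sub>1\<close>-functions.\<close>

locale seminormed_subspace =
  fixes S :: "'v::real_vector set" and N :: "'v \<Rightarrow> real"
  assumes subspace: "subspace S"
    and N_nonneg: "x \<in> S \<Longrightarrow> 0 \<le> N x"
    and N_add: "x \<in> S \<Longrightarrow> y \<in> S \<Longrightarrow> N (x + y) \<le> N x + N y"
    and N_scaleR: "x \<in> S \<Longrightarrow> N (r *\<^sub>R x) = \<bar>r\<bar> * N x"
begin

lemma add_closed: "x \<in> S \<Longrightarrow> y \<in> S \<Longrightarrow> x + y \<in> S"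
  using subspace by (rule subspace_add)

lemma scaleR_closed: "x \<in> S \<Longrightarrow> r *\<^sub>R x \<in> S"
  using subspace by (rule subspace_scale)

lemma N_zero: "N 0 = 0"
  using N_scaleR[of 0 0] subspace_0[OF subspace] by simp

lemma sum_closed: "(\<And>i. i \<in> I \<Longrightarrow> f i \<in> S) \<Longrightarrow> sum f I \<in> S"
  using subspace by (rule subspace_sum)

lemma N_sum: "(\<And>i. i \<in> I \<Longrightarrow> f i \<in> S) \<Longrightarrow> N (sum f I) \<le> (\<Sum>i\<in>I. N (f i))"
proof (induction I rule: infinite_finite_induct)
  case (insert i I)
  then have "N (f i + sum f I) \<le> N (f i) + N (sum f I)"
    by (intro N_add sum_closed) auto
  with insert show ?case by force
qed (auto simp: N_zero)

text \<open>On the unit ball, \<open>P\<close> has a first-order expansion whose error is quadratic, uniformly in the base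
  point.\<close>

definition second_order :: "('v \<Rightarrow> 'b::real_normed_vector) \<Rightarrow> real \<Rightarrow> bool" where
  "second_order P C \<longleftrightarrow> 0 \<le> C \<and> (\<forall>z\<in>S. N z \<le> 1 \<longrightarrow>
     (\<exists>D. (\<forall>u\<in>S. \<forall>v\<in>S. D (u + v) = D u + D v) \<and> (\<forall>r. \<forall>u\<in>S. D (r *\<^sub>R u) = r *\<^sub>R D u) \<and>
          (\<forall>u\<in>S. N u \<le> 1 \<longrightarrow> norm (D u) \<le> C * N u \<and> norm (P (z + u) - P z - D u) \<le> C * (N u)\<^sup>2)))"

lemma second_order_sum:
  assumes "finite I" "\<And>i. i \<in> I \<Longrightarrow> second_order (Q i) (C i)"
  shows "second_order (\<lambda>x. \<Sum>i\<in>I. Q i x) (\<Sum>i\<in>I. C i)"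
  unfolding second_order_def
proof (intro conjI ballI impI)
  show "0 \<le> (\<Sum>i\<in>I. C i)"
    using assms by (intro sum_nonneg) (auto simp: second_order_def)
  fix z assume z: "z \<in> S" "N z \<le> 1"
  have "\<forall>i\<in>I. \<exists>D. (\<forall>u\<in>S. \<forall>v\<in>S. D (u + v) = D u + D v) \<and> (\<forall>r. \<forall>u\<in>S. D (r *\<^sub>R u) = r *\<^sub>R D u) \<and>
          (\<forall>u\<in>S. N u \<le> 1 \<longrightarrow> norm (D u) \<le> C i * N u \<and> norm (Q i (z + u) - Q i z - D u) \<le> C i * (N u)\<^sup>2)"
    using assms(2) z unfolding second_order_def by blast
  then obtain D where D: "\<And>i. i \<in> I \<Longrightarrow> (\<forall>u\<in>S. \<forall>v\<in>S. D i (u + v) = D i u + D i v) \<and> (\<forall>r. \<forall>u\<in>S. D i (r *\<^sub>R u) = r *\<^sub>R D i u) \<and>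
          (\<forall>u\<in>S. N u \<le> 1 \<longrightarrow> norm (D i u) \<le> C i * N u \<and> norm (Q i (z + u) - Q i z - D i u) \<le> C i * (N u)\<^sup>2)"
    by (subst (asm) bchoice_iff) blast
  show "\<exists>D. (\<forall>u\<in>S. \<forall>v\<in>S. D (u + v) = D u + D v) \<and> (\<forall>r. \<forall>u\<in>S. D (r *\<^sub>R u) = r *\<^sub>R D u) \<and>
          (\<forall>u\<in>S. N u \<le> 1 \<longrightarrow> norm (D u) \<le> sum C I * N u \<and>
             norm ((\<Sum>i\<in>I. Q i (z + u)) - (\<Sum>i\<in>I. Q i z) - D u) \<le> sum C I * (N u)\<^sup>2)"
  proof (intro exI[of _ "\<lambda>u. \<Sum>i\<in>I. D i u"] conjI ballI impI allI)
    fix u v assume "u \<in> S" "v \<in> S"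
    then show "(\<Sum>i\<in>I. D i (u + v)) = (\<Sum>i\<in>I. D i u) + (\<Sum>i\<in>I. D i v)"
      using D by (simp flip: sum.distrib)
  next
    fix u r assume "u \<in> S"
    then show "(\<Sum>i\<in>I. D i (r *\<^sub>R u)) = r *\<^sub>R (\<Sum>i\<in>I. D i u)"
      using D by (simp add: scaleR_sum_right)
  next
    fix u assume u: "u \<in> S" "N u \<le> 1"
    show "norm (\<Sum>i\<in>I. D i u) \<le> sum C I * N u"
      unfolding sum_distrib_right using D u by (intro sum_norm_le) auto
    have "norm (\<Sum>i\<in>I. Q i (z + u) - Q i z - D i u) \<le> sum C I * (N u)\<^sup>2"
      unfolding sum_distrib_right using D u by (intro sum_norm_le) auto
    then show "norm ((\<Sum>i\<in>I. Q i (z + u)) - (\<Sum>i\<in>I. Q i z) - (\<Sum>i\<in>I. D i u)) \<le> sum C I * (N u)\<^sup>2"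
      by (simp add: sum_subtractf)
  qed
qed

lemma second_order_lipschitz:
  assumes P: "second_order P C" and z: "z \<in> S" "N z \<le> 1" and u: "u \<in> S" "N u \<le> 1"
  shows "norm (P (z + u) - P z) \<le> 2 * C * N u"
proof -
  obtain D where D: "norm (D u) \<le> C * N u" "norm (P (z + u) - P z - D u) \<le> C * (N u)\<^sup>2"
    using P z u unfolding second_order_def by blast
  have "C * (N u)\<^sup>2 \<le> C * N u"
    using P u N_nonneg[of u] by (intro mult_left_mono) (auto simp: second_order_def power2_eq_square mult_left_le)
  with D norm_triangle_ineq[of "P (z + u) - P z - D u" "D u"] show ?thesis by simp
qed

text \<open>Averaging \<open>P(z + b\<^sub>k)\<close> with the weights \<open>w\<^sub>k\<close> gives \<open>P(z + a)\<close>, where \<open>a\<close> is the mean of the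
  \<open>b\<^sub>k\<close>, up to two errors of size \<open>C d\<^sup>2\<close>, because the linear terms agree. Some \<open>\<parallel>P(z + b\<^sub>k)\<parallel>\<close> is at least
  the norm of the average.\<close>

lemma better_than_mean:
  fixes P :: "'v \<Rightarrow> 'b::real_normed_vector"
  assumes P: "second_order P C" and z: "z \<in> S" "N z \<le> 1"
    and K: "finite K" "\<And>k. k \<in> K \<Longrightarrow> b k \<in> S" "\<And>k. k \<in> K \<Longrightarrow> N (b k) \<le> d" "d \<le> 1"
    and w: "\<And>k. k \<in> K \<Longrightarrow> 0 \<le> w k" "sum w K = 1"
  shows "\<exists>k\<in>K. norm (P (z + (\<Sum>k\<in>K. w k *\<^sub>R b k))) - 2 * C * d\<^sup>2 \<le> norm (P (z + b k))"
proof -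
  define a where "a = (\<Sum>k\<in>K. w k *\<^sub>R b k)"
  obtain D where D: "\<And>u v. u \<in> S \<Longrightarrow> v \<in> S \<Longrightarrow> D (u + v) = D u + D v"
      "\<And>r u. u \<in> S \<Longrightarrow> D (r *\<^sub>R u) = r *\<^sub>R D u"
      "\<And>u. u \<in> S \<Longrightarrow> N u \<le> 1 \<Longrightarrow> norm (P (z + u) - P z - D u) \<le> C * (N u)\<^sup>2"
    using P z unfolding second_order_def by blast
  have C: "C \<ge> 0" using P by (simp add: second_order_def)
  have "K \<noteq> {}" using w by auto
  have D0: "D 0 = 0" using D(2)[of 0 0] subspace_0[OF subspace] by simp
  have Da: "D a = (\<Sum>k\<in>K. w k *\<^sub>R D (b k))"
    unfolding a_def using K(1,2)
  proof (induction K rule: finite_induct)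
    case (insert k K)
    then show ?case by (simp add: D scaleR_closed sum_closed)
  qed (simp add: D0)
  have aS: "a \<in> S" unfolding a_def using K by (intro sum_closed scaleR_closed)
  have quad: "norm (P (z + u) - P z - D u) \<le> C * d\<^sup>2" if "u \<in> S" "N u \<le> d" for u
  proof -
    have "norm (P (z + u) - P z - D u) \<le> C * (N u)\<^sup>2" using that K by (intro D) auto
    also have "\<dots> \<le> C * d\<^sup>2" using that N_nonneg C by (intro mult_left_mono power_mono) auto
    finally show ?thesis .
  qed
  have "N a \<le> (\<Sum>k\<in>K. N (w k *\<^sub>R b k))"
    unfolding a_def using K by (intro N_sum scaleR_closed)
  also have "\<dots> \<le> (\<Sum>k\<in>K. w k * d)"
    using K w by (intro sum_mono) (auto simp: N_scaleR intro: mult_left_mono)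
  also have "\<dots> = d" using w by (simp flip: sum_distrib_right)
  finally have Na: "N a \<le> d" .
  define m where "m = Max ((\<lambda>k. norm (P (z + b k))) ` K)"
  have "m \<in> (\<lambda>k. norm (P (z + b k))) ` K"
    unfolding m_def using K \<open>K \<noteq> {}\<close> by (intro Max_in) auto
  then obtain k where k: "k \<in> K" "m = norm (P (z + b k))" by blast
  have mm: "norm (P (z + b k)) \<le> m" if "k \<in> K" for k
    unfolding m_def using K that by (intro Max_ge) auto
  have Da': "P z + D a = (\<Sum>k\<in>K. w k *\<^sub>R (P z + D (b k)))"
    using w(2) by (simp add: Da scaleR_add_right sum.distrib flip: scaleR_sum_left)
  have "norm (P z + D a) \<le> (\<Sum>k\<in>K. w k * (m + C * d\<^sup>2))"
    unfolding Da'
  proof (rule sum_norm_le)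
    fix k assume k: "k \<in> K"
    have "norm (P z + D (b k)) \<le> norm (P (z + b k)) + norm (P (z + b k) - P z - D (b k))"
      using norm_triangle_ineq4[of "P (z + b k)" "P (z + b k) - P z - D (b k)"] by (simp add: add.commute)
    also have "\<dots> \<le> m + C * d\<^sup>2" using k K mm quad by (intro add_mono) auto
    finally show "norm (w k *\<^sub>R (P z + D (b k))) \<le> w k * (m + C * d\<^sup>2)"
      using w(1)[OF k] by (auto intro: mult_left_mono)
  qed
  also have "\<dots> = m + C * d\<^sup>2" using w(2) by (simp flip: sum_distrib_right)
  finally have "norm (P z + D a) \<le> m + C * d\<^sup>2" .
  moreover have "norm (P (z + a)) \<le> norm (P z + D a) + norm (P (z + a) - P z - D a)"
    using norm_triangle_ineq[of "P z + D a" "P (z + a) - P z - D a"] by simp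
  moreover have "norm (P (z + a) - P z - D a) \<le> C * d\<^sup>2" using aS Na by (rule quad)
  ultimately have "norm (P (z + a)) - 2 * C * d\<^sup>2 \<le> m" by simp
  then show ?thesis using k by (auto simp: a_def)
qed

text \<open>The summands are replaced one at a time. The bound on the sum of the \<open>d\<^sub>i\<close> keeps every intermediate
  point in the unit ball.\<close>

lemma successive_choice:
  fixes P :: "'v \<Rightarrow> 'b::real_normed_vector"
  assumes P: "second_order P C" and I: "finite I"
    and K: "\<And>i. i \<in> I \<Longrightarrow> finite (K i)" "\<And>i k. i \<in> I \<Longrightarrow> k \<in> K i \<Longrightarrow> b i k \<in> S"
      "\<And>i k. i \<in> I \<Longrightarrow> k \<in> K i \<Longrightarrow> N (b i k) \<le> d i"
    and w: "\<And>i k. i \<in> I \<Longrightarrow> k \<in> K i \<Longrightarrow> 0 \<le> w i k" "\<And>i. i \<in> I \<Longrightarrow> sum (w i) (K i) = 1"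
    and z: "z \<in> S" "N z + sum d I \<le> 1"
  shows "\<exists>c. (\<forall>i\<in>I. c i \<in> K i) \<and>
    norm (P (z + (\<Sum>i\<in>I. \<Sum>k\<in>K i. w i k *\<^sub>R b i k))) - 2 * C * (\<Sum>i\<in>I. (d i)\<^sup>2)
      \<le> norm (P (z + (\<Sum>i\<in>I. b i (c i))))"
  using I K w z
proof (induction I arbitrary: z rule: finite_induct)
  case (insert i I)
  define a where "a i = (\<Sum>k\<in>K i. w i k *\<^sub>R b i k)" for i
  have aS: "a j \<in> S" if "j \<in> insert i I" for j
    unfolding a_def using that insert.prems by (intro sum_closed scaleR_closed) auto
  have d0: "0 \<le> d j" if j: "j \<in> insert i I" for j
  proof -
    have "K j \<noteq> {}" using insert.prems(5)[OF j] by auto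
    then obtain k where "k \<in> K j" by blast
    with insert.prems(2,3) j N_nonneg show ?thesis by (meson order_trans)
  qed
  have Na: "N (a j) \<le> d j" if j: "j \<in> insert i I" for j
  proof -
    have "N (a j) \<le> (\<Sum>k\<in>K j. N (w j k *\<^sub>R b j k))"
      unfolding a_def using insert.prems j by (intro N_sum scaleR_closed) auto
    also have "\<dots> \<le> (\<Sum>k\<in>K j. w j k * d j)"
      using insert.prems j by (intro sum_mono) (simp add: N_scaleR mult_left_mono)
    also have "\<dots> = d j" using insert.prems(5)[OF j] by (simp flip: sum_distrib_right)
    finally show ?thesis .
  qed
  have d0I: "0 \<le> sum d I" using d0 by (intro sum_nonneg) auto
  have zI: "z + sum a I \<in> S" using insert.prems aS by (intro add_closed sum_closed) auto
  have "N (z + sum a I) \<le> N z + N (sum a I)" using insert.prems aS by (intro N_add sum_closed) auto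
  also have "N (sum a I) \<le> (\<Sum>j\<in>I. N (a j))" using aS by (intro N_sum) auto
  also have "\<dots> \<le> sum d I" using Na by (intro sum_mono) auto
  finally have NzI: "N (z + sum a I) \<le> N z + sum d I" by simp
  have tot: "N z + d i + sum d I \<le> 1" using insert by simp
  have Nz: "0 \<le> N z" using insert.prems N_nonneg by auto
  have "\<exists>k\<in>K i. norm (P ((z + sum a I) + (\<Sum>k\<in>K i. w i k *\<^sub>R b i k))) - 2 * C * (d i)\<^sup>2
      \<le> norm (P ((z + sum a I) + b i k))"
    using insert.prems zI NzI tot d0I d0[of i] Nz by (intro better_than_mean[OF P]) auto
  then obtain k where k: "k \<in> K i"
      "norm (P ((z + sum a I) + a i)) - 2 * C * (d i)\<^sup>2 \<le> norm (P ((z + sum a I) + b i k))"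
    unfolding a_def by blast
  have bS: "b i k \<in> S" "N (b i k) \<le> d i" using insert.prems k by auto
  have "N (z + b i k) + sum d I \<le> 1"
    using N_add[of z "b i k"] bS insert.prems(6) tot by linarith
  moreover have "z + b i k \<in> S" using bS insert.prems by (intro add_closed)
  ultimately obtain c where c: "\<forall>j\<in>I. c j \<in> K j"
     "norm (P ((z + b i k) + sum a I)) - 2 * C * (\<Sum>i\<in>I. (d i)\<^sup>2)
      \<le> norm (P ((z + b i k) + (\<Sum>j\<in>I. b j (c j))))"
    using insert.IH[of "z + b i k"] insert.prems unfolding a_def by auto
  define c' where "c' = c(i := k)"
  have sumc: "(\<Sum>j\<in>insert i I. b j (c' j)) = b i k + (\<Sum>j\<in>I. b j (c j))"
    using insert.hyps by (simp add: c'_def) (intro sum.cong, auto)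
  show ?case
  proof (intro exI[of _ c'] conjI)
    show "\<forall>j\<in>insert i I. c' j \<in> K j" using c k by (auto simp: c'_def)
    have "sum a (insert i I) = a i + sum a I" using insert.hyps by simp
    with k(2) c(2) have "norm (P (z + sum a (insert i I))) - 2 * C * (\<Sum>i\<in>insert i I. (d i)\<^sup>2)
      \<le> norm (P (z + (b i k + (\<Sum>j\<in>I. b j (c j)))))"
      using insert.hyps by (simp add: algebra_simps)
    then show "norm (P (z + (\<Sum>i\<in>insert i I. \<Sum>k\<in>K i. w i k *\<^sub>R b i k))) - 2 * C * (\<Sum>i\<in>insert i I. (d i)\<^sup>2)
      \<le> norm (P (z + (\<Sum>i\<in>insert i I. b i (c' i))))"
      unfolding sumc a_def .
  qed
qed auto

end

text \<open>Linearity in a slot is stated for lists split at that slot. Since only a seminorm is at hand,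
  continuity is used in the form of a bound on a neighbourhood of the origin.\<close>

locale bounded_multilinear = seminormed_subspace S N for S :: "'v::real_vector set" and N +
  fixes k :: nat and A :: "'v list \<Rightarrow> 'b::real_normed_vector" and d c :: real
  assumes slot_add: "\<lbrakk>length xs + Suc (length ys) = k; set xs \<subseteq> S; set ys \<subseteq> S; u \<in> S; v \<in> S\<rbrakk>
      \<Longrightarrow> A (xs @ (u + v) # ys) = A (xs @ u # ys) + A (xs @ v # ys)"
    and slot_scaleR: "\<lbrakk>length xs + Suc (length ys) = k; set xs \<subseteq> S; set ys \<subseteq> S; u \<in> S\<rbrakk>
      \<Longrightarrow> A (xs @ (r *\<^sub>R u) # ys) = r *\<^sub>R A (xs @ u # ys)"
    and d_pos: "d > 0"
    and small: "\<lbrakk>length vs = k; set vs \<subseteq> S; \<And>v. v \<in> set vs \<Longrightarrow> N v < d\<rbrakk> \<Longrightarrow> norm (A vs) \<le> c"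
begin

lemma scaleR_slots:
  assumes "length xs + length ys = k" "set xs \<subseteq> S" "set ys \<subseteq> S"
  shows "A (xs @ map (\<lambda>v. s v *\<^sub>R v) ys) = (\<Prod>v\<leftarrow>ys. s v) *\<^sub>R A (xs @ ys)"
  using assms
proof (induction ys arbitrary: xs)
  case (Cons y ys)
  have "A (xs @ map (\<lambda>v. s v *\<^sub>R v) (y # ys)) = s y *\<^sub>R A (xs @ y # map (\<lambda>v. s v *\<^sub>R v) ys)"
    using Cons.prems by (simp, intro slot_scaleR) (auto intro: scaleR_closed)
  also have "A (xs @ y # map (\<lambda>v. s v *\<^sub>R v) ys) = (\<Prod>v\<leftarrow>ys. s v) *\<^sub>R A (xs @ y # ys)"
    using Cons.IH[of "xs @ [y]"] Cons.prems by simp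
  finally show ?case by simp
qed simp

definition bound :: real where "bound = c * (2 / d) ^ k"

text \<open>Scaling each argument \<open>v\<close> by \<open>d / (2 (N v + e))\<close> moves it into the neighbourhood of the bound. The
  positive \<open>e\<close>, which tends to zero at the end, allows for arguments of seminorm zero.\<close>

lemma norm_A_le:
  assumes vs: "length vs = k" "set vs \<subseteq> S"
  shows "norm (A vs) \<le> bound * (\<Prod>v\<leftarrow>vs. N v)"
proof -
  have pos: "(\<Prod>v\<leftarrow>vs. N v + e) > 0" if "e > 0" for e
    using vs(2) that by (induction vs) (auto intro!: mult_pos_pos add_nonneg_pos N_nonneg)
  have le: "norm (A vs) \<le> bound * (\<Prod>v\<leftarrow>vs. N v + e)" if e: "e > 0" for e
  proof -
    define s where "s v = d / (2 * (N v + e))" for v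
    have s: "s v > 0" "s v * N v < d" if "v \<in> S" for v
    proof -
      have Nv: "0 \<le> N v" using that by (rule N_nonneg)
      with e d_pos show "s v > 0" by (simp add: s_def)
      have "d * N v < d * (2 * (N v + e))" using Nv e d_pos by (intro mult_strict_left_mono) auto
      then show "s v * N v < d" using Nv e by (simp add: s_def divide_less_eq)
    qed
    have "norm (A (map (\<lambda>v. s v *\<^sub>R v) vs)) \<le> c"
      using vs s by (intro small) (auto simp: scaleR_closed N_scaleR subset_iff less_imp_le)
    moreover have "A (map (\<lambda>v. s v *\<^sub>R v) vs) = (\<Prod>v\<leftarrow>vs. s v) *\<^sub>R A vs"
      using scaleR_slots[of "[]" vs s] vs by simp
    moreover have "(\<Prod>v\<leftarrow>vs. s v) = (d / 2) ^ length vs / (\<Prod>v\<leftarrow>vs. N v + e)"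
      by (induction vs) (auto simp: s_def)
    ultimately have "(d / 2) ^ k / (\<Prod>v\<leftarrow>vs. N v + e) * norm (A vs) \<le> c"
      using pos[OF e] d_pos vs(1) by simp
    then show ?thesis
      using pos[OF e] d_pos by (simp add: bound_def field_simps)
  qed
  have "((\<lambda>e. bound * (\<Prod>v\<leftarrow>vs. N v + e)) \<longlongrightarrow> bound * (\<Prod>v\<leftarrow>vs. N v + 0)) (at_right 0)"
  proof (intro tendsto_mult tendsto_const)
    show "((\<lambda>e. \<Prod>v\<leftarrow>vs. N v + e) \<longlongrightarrow> (\<Prod>v\<leftarrow>vs. N v + 0)) (at_right 0)"
    proof (induction vs)
      case (Cons v vs)
      have "((\<lambda>e. (N v + e) * (\<Prod>v\<leftarrow>vs. N v + e)) \<longlongrightarrow> (N v + 0) * (\<Prod>v\<leftarrow>vs. N v + 0)) (at_right 0)"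
        by (intro tendsto_mult Cons.IH tendsto_add tendsto_const tendsto_ident_at)
      then show ?case by simp
    qed simp
  qed
  then have "norm (A vs) \<le> bound * (\<Prod>v\<leftarrow>vs. N v + 0)"
    by (rule tendsto_lowerbound) (auto simp: eventually_at_right_field le intro!: exI[of _ 1])
  then show ?thesis by simp
qed

text \<open>The copies of \<open>z + u\<close> are expanded one after the other, from the right.\<close>

lemma telescope:
  assumes "j + length ws = k" "set ws \<subseteq> S" "z \<in> S" "u \<in> S"
  shows "A (replicate j (z + u) @ ws) - A (replicate j z @ ws)
    = (\<Sum>i<j. A (replicate i (z + u) @ u # replicate (j - Suc i) z @ ws))"
  using assms
proof (induction j arbitrary: ws)
  case (Suc j)
  have zu: "z + u \<in> S" using Suc.prems by (intro add_closed)
  have "A (replicate (Suc j) (z + u) @ ws) = A (replicate j (z + u) @ (z + u) # ws)"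
    by (simp add: replicate_app_Cons_same)
  also have "\<dots> = A (replicate j (z + u) @ z # ws) + A (replicate j (z + u) @ u # ws)"
    using Suc.prems zu by (intro slot_add) (auto simp: set_replicate_conv_if)
  finally have "A (replicate (Suc j) (z + u) @ ws) - A (replicate (Suc j) z @ ws)
      = (A (replicate j (z + u) @ z # ws) - A (replicate j z @ z # ws)) + A (replicate j (z + u) @ u # ws)"
    by (simp add: replicate_app_Cons_same)
  also have "A (replicate j (z + u) @ z # ws) - A (replicate j z @ z # ws)
      = (\<Sum>i<j. A (replicate i (z + u) @ u # replicate (j - Suc i) z @ z # ws))"
    using Suc.prems by (intro Suc.IH) auto
  also have "\<dots> = (\<Sum>i<j. A (replicate i (z + u) @ u # replicate (Suc j - Suc i) z @ ws))"
    by (intro sum.cong refl) (simp add: replicate_app_Cons_same flip: Suc_diff_Suc)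
  finally show ?case by simp
qed simp

text \<open>The differential at \<open>z\<close> is the sum over the slots of the form with \<open>u\<close> in that slot and \<open>z\<close> in
  the others. Telescoping twice writes the remainder as a sum of at most \<open>k\<^sup>2\<close> values of the form
  with \<open>u\<close> in two slots.\<close>

lemma second_order_diagonal:
  "\<exists>C. second_order (\<lambda>x. A (replicate k x)) C"
proof -
  define B where "B = \<bar>bound\<bar>"
  define C where "C = B * 2 ^ k * real (k * k)"
  have B: "norm (A vs) \<le> B * (\<Prod>v\<leftarrow>vs. N v)" if "length vs = k" "set vs \<subseteq> S" for vs
  proof -
    have "0 \<le> (\<Prod>v\<leftarrow>vs. N v)" using that(2) by (induction vs) (auto intro!: mult_nonneg_nonneg N_nonneg)
    then show ?thesis using norm_A_le[OF that] unfolding B_def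
      by (meson abs_ge_self mult_right_mono order_trans)
  qed
  have "second_order (\<lambda>x. A (replicate k x)) C"
    unfolding second_order_def
  proof (intro conjI ballI impI)
    show "0 \<le> C" by (simp add: C_def B_def)
    fix z assume z: "z \<in> S" "N z \<le> 1"
    define D where "D u = (\<Sum>j<k. A (replicate j z @ u # replicate (k - Suc j) z))" for u
    have Nz: "0 \<le> N z" "N z ^ n \<le> 1" for n using z N_nonneg by (auto simp: power_le_one)
    have rest: "norm (A (replicate k (z + u)) - A (replicate k z) - D u) \<le> C * (N u)\<^sup>2"
      and lin: "norm (D u) \<le> C * N u" if u: "u \<in> S" "N u \<le> 1" for u
    proof -
      have zu: "z + u \<in> S" using z u by (intro add_closed)
      have Nu: "0 \<le> N u" using u N_nonneg by blast
      have Nzu: "0 \<le> N (z + u)" "N (z + u) \<le> 2"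
        using zu N_nonneg N_add[of z u] z u by auto
      have Nzu_pow: "N (z + u) ^ i \<le> 2 ^ k" if "i \<le> k" for i
      proof -
        have "N (z + u) ^ i \<le> 2 ^ i" using Nzu by (intro power_mono) auto
        also have "\<dots> \<le> 2 ^ k" using that by (intro power_increasing) auto
        finally show ?thesis .
      qed
      have "A (replicate k (z + u)) - A (replicate k z)
          = (\<Sum>j<k. A (replicate j (z + u) @ u # replicate (k - Suc j) z))"
        using telescope[of k "[]" z u] z u by simp
      then have "A (replicate k (z + u)) - A (replicate k z) - D u
          = (\<Sum>j<k. A (replicate j (z + u) @ u # replicate (k - Suc j) z) - A (replicate j z @ u # replicate (k - Suc j) z))"
        by (simp add: D_def sum_subtractf)
      also have "\<dots> = (\<Sum>j<k. \<Sum>i<j. A (replicate i (z + u) @ u # replicate (j - Suc i) z @ u # replicate (k - Suc j) z))"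
        using z u by (intro sum.cong refl telescope) (auto simp: set_replicate_conv_if)
      finally have eq: "A (replicate k (z + u)) - A (replicate k z) - D u = \<dots>" .
      have term_le: "norm (A (replicate i (z + u) @ u # replicate (j - Suc i) z @ u # replicate (k - Suc j) z))
          \<le> B * 2 ^ k * (N u)\<^sup>2" if "j < k" "i < j" for i j
      proof -
        have "norm (A (replicate i (z + u) @ u # replicate (j - Suc i) z @ u # replicate (k - Suc j) z))
          \<le> B * (\<Prod>v\<leftarrow>replicate i (z + u) @ u # replicate (j - Suc i) z @ u # replicate (k - Suc j) z. N v)"
          using that z u zu by (intro B) (auto simp: set_replicate_conv_if)
        also have "(\<Prod>v\<leftarrow>replicate i (z + u) @ u # replicate (j - Suc i) z @ u # replicate (k - Suc j) z. N v)
          = N (z + u) ^ i * (N z ^ (j - Suc i) * N z ^ (k - Suc j)) * (N u)\<^sup>2"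
          by (simp add: prod_list_replicate power2_eq_square)
        also have "B * \<dots> \<le> B * (2 ^ k * (1 * 1) * (N u)\<^sup>2)"
          using Nz Nzu Nzu_pow[of i] that
          by (intro mult_left_mono mult_mono mult_right_mono) (auto simp: B_def)
        finally show ?thesis by simp
      qed
      have "norm (A (replicate k (z + u)) - A (replicate k z) - D u) \<le> (\<Sum>j<k. \<Sum>i<k. B * 2 ^ k * (N u)\<^sup>2)"
        unfolding eq
      proof (rule sum_norm_le)
        fix j assume "j \<in> {..<k}"
        then have j: "j < k" by simp
        have "norm (\<Sum>i<j. A (replicate i (z + u) @ u # replicate (j - Suc i) z @ u # replicate (k - Suc j) z))
            \<le> (\<Sum>i<j. B * 2 ^ k * (N u)\<^sup>2)"
          using term_le[OF j] by (intro sum_norm_le) auto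
        also have "\<dots> \<le> (\<Sum>i<k. B * 2 ^ k * (N u)\<^sup>2)"
          using j by (intro sum_mono2) (auto simp: B_def)
        finally show "norm (\<Sum>i<j. A (replicate i (z + u) @ u # replicate (j - Suc i) z @ u # replicate (k - Suc j) z))
            \<le> (\<Sum>i<k. B * 2 ^ k * (N u)\<^sup>2)" .
      qed
      then show "norm (A (replicate k (z + u)) - A (replicate k z) - D u) \<le> C * (N u)\<^sup>2"
        by (simp add: C_def algebra_simps)
      have "norm (D u) \<le> (\<Sum>j<k. B * N u)"
        unfolding D_def
      proof (rule sum_norm_le)
        fix j assume "j \<in> {..<k}"
        then have "norm (A (replicate j z @ u # replicate (k - Suc j) z))
            \<le> B * (\<Prod>v\<leftarrow>replicate j z @ u # replicate (k - Suc j) z. N v)"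
          using z u by (intro B) (auto simp: set_replicate_conv_if)
        also have "\<dots> = B * (N z ^ j * N z ^ (k - Suc j) * N u)"
          by (simp add: prod_list_replicate)
        also have "\<dots> \<le> B * (1 * 1 * N u)"
          using Nz Nu by (intro mult_left_mono mult_mono mult_right_mono) (auto simp: B_def)
        finally show "norm (A (replicate j z @ u # replicate (k - Suc j) z)) \<le> B * N u" by simp
      qed
      also have "\<dots> = B * 1 * real k * N u" by simp
      also have "\<dots> \<le> B * 2 ^ k * real (k * k) * N u"
        using Nu by (intro mult_right_mono mult_mono) (auto simp: B_def simp del: of_nat_mult)
      finally show "norm (D u) \<le> C * N u" by (simp add: C_def)
    qed
    have slotD: "D (u + v) = D u + D v" if "u \<in> S" "v \<in> S" for u v
      unfolding D_def sum.distrib[symmetric] using that z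
      by (intro sum.cong refl slot_add) (auto simp: set_replicate_conv_if)
    have slotS: "D (r *\<^sub>R u) = r *\<^sub>R D u" if "u \<in> S" for r u
      unfolding D_def scaleR_sum_right using that z
      by (intro sum.cong refl slot_scaleR) (auto simp: set_replicate_conv_if)
    show "\<exists>D. (\<forall>u\<in>S. \<forall>v\<in>S. D (u + v) = D u + D v) \<and> (\<forall>r. \<forall>u\<in>S. D (r *\<^sub>R u) = r *\<^sub>R D u) \<and>
          (\<forall>u\<in>S. N u \<le> 1 \<longrightarrow> norm (D u) \<le> C * N u \<and>
            norm (A (replicate k (z + u)) - A (replicate k z) - D u) \<le> C * (N u)\<^sup>2)"
      using slotD slotS rest lin by (intro exI[of _ D]) blast
  qed
  then show ?thesis by blast
qed

end


section \<open>Atomless measures\<close>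

text \<open>Split the set properly and keep the smaller part; repeat.\<close>

lemma atomless_small_subset:
  assumes M: "atomless M" and A: "A \<in> fmeasurable M" "0 < measure M A" and e: "0 < e"
  shows "\<exists>B\<in>fmeasurable M. B \<subseteq> A \<and> 0 < measure M B \<and> measure M B < e"
proof -
  have halve: "\<exists>B\<in>fmeasurable M. B \<subseteq> A \<and> 0 < measure M B \<and> measure M B \<le> measure M A / 2 ^ n" for n
  proof (induction n)
    case (Suc n)
    then obtain B where B: "B \<in> fmeasurable M" "B \<subseteq> A" "0 < measure M B" "measure M B \<le> measure M A / 2 ^ n"
      by blast
    then have "B \<in> sets M" "emeasure M B > 0" by (auto simp: emeasure_eq_measure2 fmeasurableD)
    then obtain C where C: "C \<in> sets M" "C \<subseteq> B" "0 < emeasure M C" "emeasure M C < emeasure M B"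
      using M unfolding atomless_def by blast
    have Cf: "C \<in> fmeasurable M" using B(1) C by (meson fmeasurableI2)
    have mC: "0 < measure M C" "measure M C < measure M B"
      using C Cf B by (auto simp: emeasure_eq_measure2 ennreal_less_iff)
    have mBC: "measure M (B - C) = measure M B - measure M C"
      using B Cf C by (intro measure_Diff) (auto simp: fmeasurable_def)
    define G where "G = (if 2 * measure M C \<le> measure M B then C else B - C)"
    have "G \<in> fmeasurable M" "G \<subseteq> A" "0 < measure M G" "2 * measure M G \<le> measure M B"
      using B C Cf mC mBC by (auto simp: G_def)
    with B(4) show ?case by (intro bexI[of _ G]) auto
  qed (use A in auto)
  obtain n where n: "measure M A / e < 2 ^ n" using real_arch_pow[of 2 "measure M A / e"] by auto
  obtain B where B: "B\<in>fmeasurable M" "B \<subseteq> A" "0 < measure M B" "measure M B \<le> measure M A / 2 ^ n"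
    using halve by blast
  have "measure M A / 2 ^ n < e" using n e by (simp add: field_simps)
  with B show ?thesis by (meson le_less_trans)
qed

text \<open>The unions of finitely many small subsets of \<open>A\<close> are closed under finite unions. Along a sequence of
  them whose measure tends to the supremum, the union exhausts \<open>A\<close> up to a null set, for otherwise a small
  subset of positive measure could be added. So one of them already misses less than \<open>e\<close>.\<close>

lemma atomless_finite_cover:
  assumes M: "atomless M" and A: "A \<in> fmeasurable M" and e: "0 < e"
  obtains P where "finite P" "P \<subseteq> fmeasurable M" "\<Union>P = A" "\<And>B. B \<in> P \<Longrightarrow> measure M B < e"
proof -
  define G where "G = {\<Union>P | P. finite P \<and> P \<subseteq> fmeasurable M \<and> \<Union>P \<subseteq> A \<and> (\<forall>B\<in>P. measure M B < e)}"
  have Gf: "B \<in> fmeasurable M" "B \<subseteq> A" if "B \<in> G" for B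
    using that by (auto simp: G_def intro!: fmeasurable.finite_Union)
  have single: "B \<in> G" if "B \<in> fmeasurable M" "B \<subseteq> A" "measure M B < e" for B
    unfolding G_def using that by (intro CollectI exI[of _ "{B}"]) auto
  have union: "B \<union> C \<in> G" if BC: "B \<in> G" "C \<in> G" for B C
  proof -
    obtain P where "B = \<Union>P \<and> finite P \<and> P \<subseteq> fmeasurable M \<and> \<Union>P \<subseteq> A \<and> (\<forall>B\<in>P. measure M B < e)"
      using BC(1) unfolding G_def mem_Collect_eq by (elim exE)
    moreover obtain Q where "C = \<Union>Q \<and> finite Q \<and> Q \<subseteq> fmeasurable M \<and> \<Union>Q \<subseteq> A \<and> (\<forall>B\<in>Q. measure M B < e)"
      using BC(2) unfolding G_def mem_Collect_eq by (elim exE)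
    ultimately show ?thesis unfolding G_def by (intro CollectI exI[of _ "P \<union> Q"]) (simp add: ball_Un)
  qed
  have empty: "{} \<in> G" using e by (intro single) auto
  define s where "s = (SUP B\<in>G. measure M B)"
  have bdd: "bdd_above (measure M ` G)"
    using Gf A by (intro bdd_aboveI2[of _ _ "measure M A"] measure_mono_fmeasurable) (auto simp: fmeasurableD)
  have le_s: "measure M B \<le> s" if "B \<in> G" for B
    unfolding s_def using bdd that by (intro cSUP_upper)
  have "\<exists>B\<in>G. s - 1 / real (Suc n) < measure M B" for n
    using less_cSUP_iff[of G "measure M" "s - 1 / real (Suc n)"] bdd empty
    by (auto simp: s_def)
  then obtain B where B: "\<And>n. B n \<in> G" "\<And>n. s - 1 / real (Suc n) < measure M (B n)"
    by metis
  define U where "U = (\<Union>n. B n)"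
  have U: "U \<in> fmeasurable M" "U \<subseteq> A"
  proof -
    show "U \<subseteq> A" using Gf(2)[OF B(1)] by (auto simp: U_def)
    then show "U \<in> fmeasurable M"
      unfolding U_def using A Gf(1)[OF B(1)] by (intro fmeasurableI2[OF A]) (auto simp: fmeasurableD)
  qed
  have "measure M (A - U) = 0"
  proof (rule ccontr)
    assume "measure M (A - U) \<noteq> 0"
    then have pos: "0 < measure M (A - U)" by (simp add: less_le)
    have "A - U \<in> fmeasurable M" using A U by (intro fmeasurable_Diff) (auto simp: fmeasurableD)
    then obtain C where C: "C \<in> fmeasurable M" "C \<subseteq> A - U" "0 < measure M C" "measure M C < e"
      using atomless_small_subset[OF M _ pos e] by blast
    obtain n where n: "1 / real (Suc n) < measure M C" using C(3) nat_approx_posE by blast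
    have "measure M (B n \<union> C) = measure M (B n) + measure M C"
      using Gf(1)[OF B(1)] C by (intro measure_Un_AE AE_I2) (auto simp: U_def)
    moreover have "measure M (B n \<union> C) \<le> s"
      using C by (intro le_s union B(1) single) auto
    ultimately show False using B(2)[of n] n by simp
  qed
  then have mU: "measure M U = measure M A"
    using measure_Diff[of M A U] A U by (auto simp: fmeasurable_def)
  define V where "V n = (\<Union>i<n. B i)" for n
  have VG: "V n \<in> G" for n
  proof (induction n)
    case (Suc n)
    have "V (Suc n) = V n \<union> B n" by (auto simp: V_def lessThan_Suc)
    with Suc union B(1) show ?case by simp
  qed (simp add: V_def empty)
  have "incseq V" unfolding incseq_def V_def by (intro allI impI UN_mono) auto
  have "(\<Union>n. V n) = U" by (auto simp: U_def V_def)
  have "(\<lambda>n. measure M (V n)) \<longlonglongrightarrow> measure M (\<Union>n. V n)"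
    using Gf(1)[OF VG] U \<open>(\<Union>n. V n) = U\<close> \<open>incseq V\<close>
    by (intro Lim_measure_incseq) (auto simp: fmeasurable_def)
  then have "(\<lambda>n. measure M (V n)) \<longlonglongrightarrow> measure M A"
    by (simp add: \<open>(\<Union>n. V n) = U\<close> mU)
  then have "\<forall>\<^sub>F n in sequentially. measure M (V n) > measure M A - e"
    using e by (intro order_tendstoD) auto
  then obtain n where n: "measure M (V n) > measure M A - e"
    by (auto simp: eventually_sequentially)
  have "measure M (A - V n) = measure M A - measure M (V n)"
    using Gf[OF VG] A by (intro measure_Diff) (auto simp: fmeasurable_def)
  then have "A - V n \<in> G"
    using n A Gf(1)[OF VG] by (intro single) (auto simp: fmeasurableD)
  with union VG have "V n \<union> (A - V n) \<in> G" by blast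
  moreover have "V n \<union> (A - V n) = A" using Gf(2)[OF VG] by blast
  ultimately show thesis using that by (auto simp: G_def)
qed

lemma atomless_finite_partition:
  assumes M: "atomless M" and A: "A \<in> fmeasurable M" and e: "0 < e"
  obtains P where "finite P" "disjoint P" "P \<subseteq> fmeasurable M" "\<Union>P = A" "\<And>B. B \<in> P \<Longrightarrow> measure M B < e"
proof -
  obtain Q where Q: "finite Q" "Q \<subseteq> fmeasurable M" "\<Union>Q = A" "\<And>B. B \<in> Q \<Longrightarrow> measure M B < e"
    using atomless_finite_cover[OF assms] by blast
  then obtain f and n :: nat where f: "Q = f ` {0..<n}"
    by (metis atLeast0LessThan finite_imp_nat_seg_image_inj_on lessThan_def[symmetric])
  define F where "F i = (if i < n then f i else {})" for i
  have F: "F i \<in> fmeasurable M" "measure M (F i) < e" for i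
    using Q f e by (auto simp: F_def)
  have fd: "disjointed F i \<in> fmeasurable M" for i
  proof (rule fmeasurableI2[OF F(1)[of i] disjointed_subset[of F i]])
    have "range F \<subseteq> sets M" using F(1) by (auto intro: fmeasurableD)
    then have "range (disjointed F) \<subseteq> sets M" by (rule sets.range_disjointed_sets)
    then show "disjointed F i \<in> sets M" by blast
  qed
  show thesis
  proof (rule that[of "disjointed F ` {0..<n}"])
    show "disjoint (disjointed F ` {0..<n})"
      by (intro disjoint_family_on_disjoint_image disjoint_family_on_mono[OF _ disjoint_family_disjointed]) auto
    show "\<Union>(disjointed F ` {0..<n}) = A"
      using Q(3) f by (simp add: finite_UN_disjointed_eq F_def)
    fix B assume "B \<in> disjointed F ` {0..<n}"
    then obtain i where i: "B = disjointed F i" by blast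
    have "measure M B \<le> measure M (F i)"
      unfolding i by (intro measure_mono_fmeasurable disjointed_subset F fmeasurableD[OF fd])
    with F(2)[of i] show "measure M B < e" by simp
  qed (use fd in auto)
qed

text \<open>The pairs in \<open>K\<close> stand for the functions \<open>c 1\<^sub>B\<close>; each has the same integral as the indicator of \<open>A\<close>,
  and that indicator is their mean up to a null set. The null pieces of the partition are left out, since
  their indicators cannot be scaled to the right integral.\<close>

lemma concentrate_indicator:
  assumes M: "atomless M" and A: "A \<in> fmeasurable M" and e: "0 < e"
  obtains A' K w where "A' \<in> fmeasurable M" "A' \<subseteq> A" "measure M (A - A') = 0"
    "finite K" "\<And>B c. (B, c) \<in> K \<Longrightarrow> B \<in> fmeasurable M \<and> B \<subseteq> A \<and> measure M B < e \<and> 0 \<le> c \<and> c * measure M B = measure M A"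
    "\<And>k. k \<in> K \<Longrightarrow> 0 \<le> w k" "sum w K = 1"
    "\<And>x. (\<Sum>k\<in>K. w k * (snd k * indicator (fst k) x)) = (indicator A' x :: real)"
proof (cases "measure M A = 0")
  case True
  show thesis
    by (rule that[of "{}" "{({}, 0)}" "\<lambda>_. 1"]) (use True e in auto)
next
  case False
  define a where "a = measure M A"
  have a: "a > 0" using False by (simp add: a_def less_le)
  obtain P where P: "finite P" "disjoint P" "P \<subseteq> fmeasurable M" "\<Union>P = A" "\<And>B. B \<in> P \<Longrightarrow> measure M B < e"
    using atomless_finite_partition[OF assms] by blast
  define Q where "Q = {B \<in> P. measure M B > 0}"
  have Q: "finite Q" "Q \<subseteq> P" "disjoint Q" using P by (auto simp: Q_def pairwise_def)
  have "measure M (\<Union>P) = (\<Sum>B\<in>P. measure M B)"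
    using P by (intro measure_Union') (auto simp: pairwise_def)
  also have "\<dots> = (\<Sum>B\<in>Q. measure M B)"
    using P by (intro sum.mono_neutral_right) (auto simp: Q_def less_le)
  finally have mP: "a = (\<Sum>B\<in>Q. measure M B)" by (simp add: a_def P)
  have mQ: "measure M (\<Union>Q) = (\<Sum>B\<in>Q. measure M B)"
    using P Q by (intro measure_Union') (auto simp: pairwise_def)
  have Qf: "\<Union>Q \<in> fmeasurable M" "\<Union>Q \<subseteq> A" using P Q by (auto intro!: fmeasurable.finite_Union)
  define K where "K = (\<lambda>B. (B, a / measure M B)) ` Q"
  have inj: "inj_on (\<lambda>B. (B, a / measure M B)) Q" by (auto simp: inj_on_def)
  show thesis
  proof (rule that[of "\<Union>Q" K "\<lambda>k. measure M (fst k) / a"])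
    show "measure M (A - \<Union>Q) = 0"
      using measure_Diff[of M A "\<Union>Q"] A Qf mP mQ by (auto simp: fmeasurable_def a_def)
    show "(\<Sum>k\<in>K. measure M (fst k) / a) = 1"
      unfolding K_def sum.reindex[OF inj] using mP a by (simp flip: sum_divide_distrib)
    fix x
    have "(\<Sum>k\<in>K. measure M (fst k) / a * (snd k * indicator (fst k) x)) = (\<Sum>B\<in>Q. indicator B x :: real)"
      unfolding K_def sum.reindex[OF inj] using a by (intro sum.cong) (auto simp: Q_def)
    also have "\<dots> = indicator (\<Union>Q) x"
    proof (cases "x \<in> \<Union>Q")
      case True
      then obtain B where B: "B \<in> Q" "x \<in> B" by blast
      then have "indicator B' x = (if B' = B then 1 else 0 :: real)" if "B' \<in> Q" for B'
        using Q(3) that by (auto simp: disjoint_def indicator_def)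
      then have "(\<Sum>B\<in>Q. indicator B x :: real) = (\<Sum>B'\<in>Q. if B' = B then 1 else 0)"
        by (intro sum.cong) auto
      also have "\<dots> = 1" using B Q(1) by simp
      finally show ?thesis using True by simp
    qed (auto simp: indicator_def intro!: sum.neutral)
    finally show "(\<Sum>k\<in>K. measure M (fst k) / a * (snd k * indicator (fst k) x)) = (indicator (\<Union>Q) x :: real)" .
  qed (use P Q Qf a in \<open>auto simp: K_def Q_def a_def\<close>)
qed

text \<open>Absolute continuity of the integral: truncate \<open>F\<close> at a height above which it has small integral.\<close>

lemma integral_small_on_small_sets:
  fixes F :: "'a \<Rightarrow> real"
  assumes F: "integrable M F" "\<And>x. 0 \<le> F x" and e: "0 < e"
  obtains \<eta> where "0 < \<eta>" "\<And>B. B \<in> fmeasurable M \<Longrightarrow> measure M B < \<eta> \<Longrightarrow> (\<integral>x. indicator B x * F x \<partial>M) < e"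
proof -
  have meas: "F \<in> borel_measurable M" using F by auto
  define G where "G n x = indicator {x\<in>space M. F x > real n} x * F x" for n x
  have Gint: "integrable M (G n)" for n
    unfolding G_def by (rule Bochner_Integration.integrable_bound[OF F(1)]) (use meas in \<open>auto simp: indicator_def\<close>)
  have "(\<lambda>n. integral\<^sup>L M (G n)) \<longlonglongrightarrow> integral\<^sup>L M (\<lambda>_. 0)"
  proof (rule integral_dominated_convergence[where w = F])
    show "AE x in M. (\<lambda>n. G n x) \<longlonglongrightarrow> 0"
    proof (intro AE_I2 tendsto_eventually)
      fix x
      obtain m where "F x \<le> real m" using real_arch_simple by blast
      then have "G n x = 0" if "n \<ge> m" for n using that by (auto simp: G_def)
      then show "\<forall>\<^sub>F n in sequentially. G n x = 0" by (auto simp: eventually_sequentially)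
    qed
    show "AE x in M. norm (G n x) \<le> F x" for n using F(2) by (auto simp: G_def indicator_def)
  qed (use F Gint in auto)
  then have "\<forall>\<^sub>F n in sequentially. integral\<^sup>L M (G n) < e / 2"
    using e by (intro order_tendstoD) auto
  then obtain n where n: "integral\<^sup>L M (G n) < e / 2" by (auto simp: eventually_sequentially)
  define \<eta> where "\<eta> = e / (2 * (real n + 1))"
  show thesis
  proof (rule that[of \<eta>])
    show "0 < \<eta>" using e by (simp add: \<eta>_def)
    fix B assume B: "B \<in> fmeasurable M" "measure M B < \<eta>"
    have iB: "integrable M (\<lambda>x. real n * indicator B x)"
      using B by (auto simp: fmeasurable_def)
    have "(\<integral>x. indicator B x * F x \<partial>M) \<le> (\<integral>x. real n * indicator B x + G n x \<partial>M)"
    proof (rule integral_mono)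
      show "integrable M (\<lambda>x. indicator B x * F x)"
        by (rule Bochner_Integration.integrable_bound[OF F(1)]) (use meas B in \<open>auto simp: indicator_def fmeasurableD\<close>)
      show "integrable M (\<lambda>x. real n * indicator B x + G n x)" using iB Gint by auto
    qed (use F(2) in \<open>auto simp: G_def indicator_def\<close>)
    also have "\<dots> = real n * measure M B + integral\<^sup>L M (G n)"
      using iB Gint fmeasurableD[OF B(1)] by simp
    also have "real n * measure M B \<le> (real n + 1) * \<eta>"
      using B by (intro mult_mono) (auto simp: less_imp_le)
    also have "(real n + 1) * \<eta> = e / 2" by (auto simp: \<eta>_def divide_simps algebra_simps)
    finally show "(\<integral>x. indicator B x * F x \<partial>M) < e" using n by simp
  qed
qed


section \<open>Representatives of classes of Bochner integrable functions\<close>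

instantiation "fun" :: (type, real_vector) real_vector
begin
definition scaleR_fun :: "real \<Rightarrow> ('a \<Rightarrow> 'b) \<Rightarrow> 'a \<Rightarrow> 'b" where
  "scaleR_fun r f = (\<lambda>x. r *\<^sub>R f x)"
instance
  by standard (auto simp: scaleR_fun_def fun_eq_iff algebra_simps)
end

lemma scaleR_fun_apply [simp]: "(r *\<^sub>R f) x = r *\<^sub>R f x"
  by (simp add: scaleR_fun_def)

lemma sum_fun_apply: "(\<Sum>i\<in>I. f i) x = (\<Sum>i\<in>I. f i x)"
  by (induction I rule: infinite_finite_induct) auto

text \<open>Everywhere limits of simple functions. Unlike Borel functions with values in a nonseparable space,
  they are closed under addition.\<close>

definition simple_limit :: "'a measure \<Rightarrow> ('a \<Rightarrow> 'y::metric_space) \<Rightarrow> bool" where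
  "simple_limit M f \<longleftrightarrow> (\<exists>s. (\<forall>n. simple_function M (s n)) \<and> (\<forall>x\<in>space M. (\<lambda>n. s n x) \<longlonglongrightarrow> f x))"

lemma simple_limitE:
  assumes "simple_limit M f"
  obtains s where "\<And>n. simple_function M (s n)" "\<And>x. x \<in> space M \<Longrightarrow> (\<lambda>n. s n x) \<longlonglongrightarrow> f x"
  using assms unfolding simple_limit_def by meson

lemma simple_limit_measurable: "simple_limit M f \<Longrightarrow> f \<in> borel_measurable M"
  by (elim simple_limitE, rule borel_measurable_LIMSEQ_metric[OF borel_measurable_simple_function])

lemma simple_limit_simple: "simple_function M f \<Longrightarrow> simple_limit M f"
  unfolding simple_limit_def by (intro exI[of _ "\<lambda>_. f"]) auto

lemma simple_limit_compose2:
  assumes f: "simple_limit M f" and g: "simple_limit M g"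
    and h: "\<And>s t x. x \<in> space M \<Longrightarrow> s \<longlonglongrightarrow> f x \<Longrightarrow> t \<longlonglongrightarrow> g x \<Longrightarrow> (\<lambda>n. h (s n) (t n)) \<longlonglongrightarrow> h (f x) (g x)"
  shows "simple_limit M (\<lambda>x. h (f x) (g x))"
proof -
  obtain s where s: "(\<forall>n. simple_function M (s n)) \<and> (\<forall>x\<in>space M. (\<lambda>n. s n x) \<longlonglongrightarrow> f x)"
    using f unfolding simple_limit_def by (elim exE)
  obtain t where t: "(\<forall>n. simple_function M (t n)) \<and> (\<forall>x\<in>space M. (\<lambda>n. t n x) \<longlonglongrightarrow> g x)"
    using g unfolding simple_limit_def by (elim exE)
  show ?thesis
    unfolding simple_limit_def
  proof (intro exI[of _ "\<lambda>n x. h (s n x) (t n x)"] conjI allI ballI)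
    show "simple_function M (\<lambda>x. h (s n x) (t n x))" for n
      using s t by (intro simple_function_compose2[of M "s n" "t n" h]) simp_all
    show "(\<lambda>n. h (s n x) (t n x)) \<longlonglongrightarrow> h (f x) (g x)" if "x \<in> space M" for x
      using that s t by (intro h) simp_all
  qed
qed

definition L1_functions :: "'a measure \<Rightarrow> ('a \<Rightarrow> 'y::banach) set" where
  "L1_functions M = {f. simple_limit M f \<and> integrable M (\<lambda>x. norm (f x))}"

definition L1_norm :: "'a measure \<Rightarrow> ('a \<Rightarrow> 'y::banach) \<Rightarrow> real" where
  "L1_norm M f = (\<integral>x. norm (f x) \<partial>M)"

lemma L1_functionsD:
  assumes "f \<in> L1_functions M"
  shows "simple_limit M f" "integrable M (\<lambda>x. norm (f x))" "f \<in> borel_measurable M"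
  using assms by (auto simp: L1_functions_def simple_limit_measurable)

lemma L1_functionsI:
  assumes "simple_limit M f" "integrable M g" "\<And>x. x \<in> space M \<Longrightarrow> norm (f x) \<le> g x"
  shows "f \<in> L1_functions M"
  unfolding L1_functions_def
proof (intro CollectI conjI assms(1))
  have "(\<lambda>x. norm (f x)) \<in> borel_measurable M"
    using simple_limit_measurable[OF assms(1)] by measurable
  then show "integrable M (\<lambda>x. norm (f x))"
    using assms(3) by (intro Bochner_Integration.integrable_bound[OF assms(2)]) force+
qed

lemma L1_functions_add:
  assumes "f \<in> L1_functions M" "g \<in> L1_functions M"
  shows "f + g \<in> L1_functions M"
proof (rule L1_functionsI)
  show "simple_limit M (f + g)"
    unfolding plus_fun_def using assms
    by (intro simple_limit_compose2[where h = "(+)" and f = f and g = g] tendsto_add L1_functionsD)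
  show "integrable M (\<lambda>x. norm (f x) + norm (g x))"
    using assms by (auto simp: L1_functionsD)
qed (auto intro: norm_triangle_ineq)

lemma L1_functions_bounded_linear:
  assumes "f \<in> L1_functions M" "bounded_linear L"
  shows "(\<lambda>x. L (f x)) \<in> L1_functions M"
proof -
  obtain K where K: "\<And>y. norm (L y) \<le> norm y * K" using bounded_linear.bounded[OF assms(2)] by blast
  show ?thesis
  proof (rule L1_functionsI)
    show "simple_limit M (\<lambda>x. L (f x))"
      using assms(1) by (intro simple_limit_compose2[where h = "\<lambda>a b. L a" and f = f and g = f]
          bounded_linear.tendsto[OF assms(2)] L1_functionsD)
    show "integrable M (\<lambda>x. norm (f x) * K)" using assms(1) by (auto simp: L1_functionsD)
  qed (rule K)
qed

lemma L1_functions_scaleR: "f \<in> L1_functions M \<Longrightarrow> r *\<^sub>R f \<in> L1_functions M"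
  unfolding scaleR_fun_def by (rule L1_functions_bounded_linear[where L = "scaleR r", OF _ bounded_linear_scaleR_right])

lemma L1_functions_uminus: "f \<in> L1_functions M \<Longrightarrow> - f \<in> L1_functions M"
  using L1_functions_scaleR[of f M "- 1"] by simp

lemma L1_functions_diff: "f \<in> L1_functions M \<Longrightarrow> g \<in> L1_functions M \<Longrightarrow> f - g \<in> L1_functions M"
  using L1_functions_add[of f M "- g"] L1_functions_uminus[of g M] by simp

lemma L1_functions_zero: "0 \<in> L1_functions M"
  by (rule L1_functionsI[where g = "\<lambda>_. 0"]) (auto intro: simple_limit_simple simp: zero_fun_def)

lemma L1_functions_restrict:
  assumes "f \<in> L1_functions M" "B \<in> sets M"
  shows "(\<lambda>x. indicator B x *\<^sub>R f x) \<in> L1_functions M"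
proof (rule L1_functionsI)
  show "simple_limit M (\<lambda>x. indicator B x *\<^sub>R f x)"
    using assms by (intro simple_limit_compose2[where h = scaleR and f = "indicator B" and g = f]
        tendsto_scaleR L1_functionsD simple_limit_simple simple_function_indicator)
  show "integrable M (\<lambda>x. norm (f x))" using assms by (auto simp: L1_functionsD)
qed (auto simp: indicator_def)

definition block :: "'a set \<Rightarrow> 'y::real_vector \<Rightarrow> 'a \<Rightarrow> 'y" where
  "block B y = (\<lambda>x. indicator B x *\<^sub>R y)"

lemma block_in_L1:
  assumes "B \<in> fmeasurable M" shows "block B y \<in> L1_functions M"
proof (rule L1_functionsI)
  have "simple_function M (\<lambda>x. (indicator B x :: real) *\<^sub>R y)"
    using assms by (intro simple_function_compose1[where g = "\<lambda>r. r *\<^sub>R y"]) (auto simp: fmeasurableD)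
  then show "simple_limit M (block B y)" unfolding block_def by (rule simple_limit_simple)
  show "integrable M (\<lambda>x. indicator B x * norm y)"
    using assms by (auto simp: fmeasurable_def)
qed (auto simp: block_def)

lemma L1_norm_block: "B \<in> fmeasurable M \<Longrightarrow> L1_norm M (block B y) = measure M B * norm y"
  by (simp add: L1_norm_def block_def fmeasurable_def)

lemma seminormed_L1: "seminormed_subspace (L1_functions M) (L1_norm M)"
proof
  show "subspace (L1_functions M)"
    unfolding subspace_def by (auto intro: L1_functions_zero L1_functions_add L1_functions_scaleR)
next
  fix f g :: "'a \<Rightarrow> 'b" assume fg: "f \<in> L1_functions M" "g \<in> L1_functions M"
  have "L1_norm M (f + g) \<le> (\<integral>x. norm (f x) + norm (g x) \<partial>M)"
    unfolding L1_norm_def using fg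
    by (intro integral_mono L1_functionsD(2)[OF L1_functions_add[OF fg]])
       (auto simp: L1_functionsD intro: norm_triangle_ineq)
  also have "\<dots> = L1_norm M f + L1_norm M g"
    unfolding L1_norm_def using fg by (auto simp: L1_functionsD)
  finally show "L1_norm M (f + g) \<le> L1_norm M f + L1_norm M g" .
qed (auto simp: L1_norm_def)

lemma L1_norm_AE_cong:
  assumes "f \<in> L1_functions M" "g \<in> L1_functions M" "AE x in M. f x = g x"
  shows "L1_norm M f = L1_norm M g"
  unfolding L1_norm_def
proof (rule integral_cong_AE)
  show "AE x in M. norm (f x) = norm (g x)" using assms(3) by eventually_elim simp
qed (use assms in \<open>auto intro: borel_measurable_integrable L1_functionsD(2)\<close>)

lemma L1_norm_AE_zero:
  assumes "AE x in M. f x = 0"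
  shows "L1_norm M f = 0"
proof -
  have "AE x in M. norm (f x) = 0" using assms by auto
  then show ?thesis unfolding L1_norm_def by (rule integral_eq_zero_AE)
qed

lemma nn_integral_norm_L1: "f \<in> L1_functions M \<Longrightarrow> (\<integral>\<^sup>+x. ennreal (norm (f x)) \<partial>M) = ennreal (L1_norm M f)"
  unfolding L1_norm_def by (intro nn_integral_eq_integral) (auto simp: L1_functionsD)

lemma simple_in_L1:
  fixes t :: "'a \<Rightarrow> 'y::banach"
  assumes "Bochner_Integration.simple_bochner_integrable M t"
  shows "t \<in> L1_functions M"
proof (rule L1_functionsI)
  have t: "simple_function M t" "emeasure M {y \<in> space M. t y \<noteq> 0} \<noteq> \<infinity>"
    using assms by (auto elim: simple_bochner_integrable.cases)
  then show "simple_limit M t" by (intro simple_limit_simple)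
  have "Bochner_Integration.simple_bochner_integrable M (\<lambda>x. norm (t x))"
    using t by (intro simple_bochner_integrable.intros) (auto intro: simple_function_compose1)
  then show "integrable M (\<lambda>x. norm (t x))"
    by (rule integrable.intros[OF has_bochner_integral_simple_bochner_integrable])
qed auto

text \<open>Truncating the approximating simple functions where they exceed \<open>2 \<parallel>f\<parallel>\<close> makes dominated
  convergence applicable.\<close>

lemma simple_approximation:
  fixes f :: "'a \<Rightarrow> 'y::banach"
  assumes f: "f \<in> L1_functions M"
  obtains t where "\<And>n. Bochner_Integration.simple_bochner_integrable M (t n)"
    "(\<lambda>n. L1_norm M (f - t n)) \<longlonglongrightarrow> 0"
proof -
  obtain s where "(\<forall>n. simple_function M (s n)) \<and> (\<forall>x\<in>space M. (\<lambda>n. s n x) \<longlonglongrightarrow> f x)"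
    using L1_functionsD(1)[OF f] unfolding simple_limit_def by (elim exE)
  then have s: "\<And>n. simple_function M (s n)" "\<And>x. x \<in> space M \<Longrightarrow> (\<lambda>n. s n x) \<longlonglongrightarrow> f x"
    by simp_all
  have [measurable]: "f \<in> borel_measurable M" "s n \<in> borel_measurable M" for n
    using f s by (auto simp: L1_functionsD intro: borel_measurable_simple_function)
  define t where "t n x = (if norm (s n x) \<le> 2 * norm (f x) then s n x else 0)" for n x
  have tsf: "simple_function M (t n)" for n
    unfolding t_def by (intro simple_function_If s simple_function_const) measurable
  have tle: "norm (t n x) \<le> 2 * norm (f x)" for n x by (simp add: t_def)
  have tlim: "(\<lambda>n. t n x) \<longlonglongrightarrow> f x" if x: "x \<in> space M" for x
  proof (cases "f x = 0")
    case True
    then have "t n x = 0" for n by (simp add: t_def)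
    with True show ?thesis by simp
  next
    case False
    have "(\<lambda>n. norm (s n x)) \<longlonglongrightarrow> norm (f x)" using s(2)[OF x] by (rule tendsto_norm)
    then have "\<forall>\<^sub>F n in sequentially. norm (s n x) < 2 * norm (f x)"
      using False by (intro order_tendstoD) auto
    then have "\<forall>\<^sub>F n in sequentially. s n x = t n x"
      by eventually_elim (simp add: t_def)
    with s(2)[OF x] show ?thesis using tendsto_cong by fast
  qed
  have tL1: "t n \<in> L1_functions M" for n
    using f by (intro L1_functionsI[where g = "\<lambda>x. 2 * norm (f x)"] simple_limit_simple tsf tle)
      (auto simp: L1_functionsD)
  show thesis
  proof
    fix n
    show "Bochner_Integration.simple_bochner_integrable M (t n)"
      using nn_integral_norm_L1[OF tL1[of n]]
      by (intro simple_bochner_integrableI_bounded tsf) simp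
  next
    have "(\<lambda>n. \<integral>x. norm ((f - t n) x) \<partial>M) \<longlonglongrightarrow> (\<integral>x. 0 \<partial>M)"
    proof (rule integral_dominated_convergence[where w = "\<lambda>x. 3 * norm (f x)"])
      fix n
      show "(\<lambda>x. norm ((f - t n) x)) \<in> borel_measurable M"
        using L1_functionsD(2)[OF L1_functions_diff[OF f tL1[of n]]] by auto
      show "AE x in M. norm (norm ((f - t n) x)) \<le> 3 * norm (f x)"
      proof (rule AE_I2)
        fix x
        show "norm (norm ((f - t n) x)) \<le> 3 * norm (f x)"
          using norm_triangle_ineq4[of "f x" "t n x"] tle[of n x] by simp
      qed
    next
      show "AE x in M. (\<lambda>n. norm ((f - t n) x)) \<longlonglongrightarrow> 0"
      proof (intro AE_I2)
        fix x assume "x \<in> space M"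
        from tendsto_diff[OF tendsto_const[of "f x"] tlim[OF this]]
        have "(\<lambda>n. norm (f x - t n x)) \<longlonglongrightarrow> norm (f x - f x)" by (rule tendsto_norm)
        then show "(\<lambda>n. norm ((f - t n) x)) \<longlonglongrightarrow> 0" by simp
      qed
    qed (use f in \<open>auto simp: L1_functionsD\<close>)
    then show "(\<lambda>n. L1_norm M (f - t n)) \<longlonglongrightarrow> 0" by (simp add: L1_norm_def)
  qed
qed

text \<open>Changing \<open>f\<close> to zero on the null set where the simple functions fail to converge turns an almost
  everywhere limit into an everywhere limit.\<close>

lemma bochner_integrable_iff:
  fixes f :: "'a \<Rightarrow> 'y::banach"
  shows "bochner_integrable M f \<longleftrightarrow> (\<exists>g\<in>L1_functions M. AE x in M. f x = g x)"
proof
  assume "bochner_integrable M f"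
  then have "strongly_measurable M f"
      and "\<exists>t. (\<forall>n. Bochner_Integration.simple_bochner_integrable M (t n)) \<and>
        (\<lambda>n. \<integral>\<^sup>+x. ennreal (norm (f x - t n x)) \<partial>M) \<longlonglongrightarrow> 0"
    unfolding bochner_integrable_def by auto
  then obtain s t where "(\<forall>n. simple_function M (s n)) \<and> (AE x in M. (\<lambda>n. s n x) \<longlonglongrightarrow> f x)"
    and "(\<forall>n. Bochner_Integration.simple_bochner_integrable M (t n)) \<and>
      (\<lambda>n. \<integral>\<^sup>+x. ennreal (norm (f x - t n x)) \<partial>M) \<longlonglongrightarrow> 0"
    unfolding strongly_measurable_def by (elim exE)
  then have s: "\<And>n. simple_function M (s n)" "AE x in M. (\<lambda>n. s n x) \<longlonglongrightarrow> f x"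
    and t: "\<And>n. Bochner_Integration.simple_bochner_integrable M (t n)"
      "(\<lambda>n. \<integral>\<^sup>+x. ennreal (norm (f x - t n x)) \<partial>M) \<longlonglongrightarrow> 0"
    by simp_all
  obtain Z where Z: "{x\<in>space M. \<not> (\<lambda>n. s n x) \<longlonglongrightarrow> f x} \<subseteq> Z" "Z \<in> sets M" "emeasure M Z = 0"
    using s(2) by (auto elim: AE_E)
  define g where "g x = (if x \<in> Z then 0 else f x)" for x
  have fg: "AE x in M. f x = g x"
  proof (rule AE_I')
    show "Z \<in> null_sets M" using Z by auto
  qed (auto simp: g_def)
  have lim: "simple_limit M g"
    unfolding simple_limit_def
  proof (intro exI[of _ "\<lambda>n x. if x \<in> Z then 0 else s n x"] conjI allI ballI)
    show "simple_function M (\<lambda>x. if x \<in> Z then 0 else s n x)" for n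
      using Z s by (intro simple_function_If_set) auto
    show "(\<lambda>n. if x \<in> Z then 0 else s n x) \<longlonglongrightarrow> g x" if "x \<in> space M" for x
      using Z that by (auto simp: g_def)
  qed
  have "\<forall>\<^sub>F n in sequentially. (\<integral>\<^sup>+x. ennreal (norm (f x - t n x)) \<partial>M) < 1"
    using t(2) by (rule order_tendstoD) simp
  then obtain n where n: "(\<integral>\<^sup>+x. ennreal (norm (f x - t n x)) \<partial>M) < 1"
    by (auto simp: eventually_sequentially)
  have tn: "t n \<in> L1_functions M" using t(1) by (rule simple_in_L1)
  have "simple_limit M (\<lambda>x. g x - t n x)"
    by (intro simple_limit_compose2[where h = "(-)" and f = g and g = "t n"] lim L1_functionsD tn tendsto_diff)
  then have meas: "(\<lambda>x. norm (g x - t n x)) \<in> borel_measurable M"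
    using simple_limit_measurable by measurable
  have gm: "g \<in> borel_measurable M" using lim by (rule simple_limit_measurable)
  have "(\<integral>\<^sup>+x. ennreal (norm (g x)) \<partial>M) \<le> (\<integral>\<^sup>+x. ennreal (norm (g x - t n x)) + ennreal (norm (t n x)) \<partial>M)"
    using norm_triangle_ineq[of "g x - t n x" "t n x" for x]
    by (intro nn_integral_mono) (simp flip: ennreal_plus)
  also have "\<dots> = (\<integral>\<^sup>+x. ennreal (norm (g x - t n x)) \<partial>M) + (\<integral>\<^sup>+x. ennreal (norm (t n x)) \<partial>M)"
    using meas L1_functionsD(3)[OF tn] by (intro nn_integral_add) auto
  also have "(\<integral>\<^sup>+x. ennreal (norm (g x - t n x)) \<partial>M) = (\<integral>\<^sup>+x. ennreal (norm (f x - t n x)) \<partial>M)"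
    using fg by (intro nn_integral_cong_AE) (auto elim: eventually_mono)
  also have "\<dots> + (\<integral>\<^sup>+x. ennreal (norm (t n x)) \<partial>M) < \<infinity>"
    using n nn_integral_norm_L1[OF tn] by (simp add: less_top[symmetric]) (metis less_top order_less_imp_not_less ennreal_one_neq_top top.not_eq_extremum)
  finally have "integrable M (\<lambda>x. norm (g x))"
    using gm by (intro integrableI_bounded) auto
  with lim fg show "\<exists>g\<in>L1_functions M. AE x in M. f x = g x"
    by (auto simp: L1_functions_def)
next
  assume "\<exists>g\<in>L1_functions M. AE x in M. f x = g x"
  then obtain g where g: "g \<in> L1_functions M" and fg: "AE x in M. f x = g x" by blast
  obtain s where "(\<forall>n. simple_function M (s n)) \<and> (\<forall>x\<in>space M. (\<lambda>n. s n x) \<longlonglongrightarrow> g x)"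
    using L1_functionsD(1)[OF g] unfolding simple_limit_def by (elim exE)
  then have s: "\<And>n. simple_function M (s n)" "\<And>x. x \<in> space M \<Longrightarrow> (\<lambda>n. s n x) \<longlonglongrightarrow> g x"
    by simp_all
  have "AE x in M. (\<lambda>n. s n x) \<longlonglongrightarrow> f x"
    using fg AE_space by eventually_elim (use s in auto)
  then have sm: "strongly_measurable M f" unfolding strongly_measurable_def using s by blast
  obtain t where t: "\<And>n. Bochner_Integration.simple_bochner_integrable M (t n)"
    "(\<lambda>n. L1_norm M (g - t n)) \<longlonglongrightarrow> 0"
    using simple_approximation[OF g] by blast
  have "(\<integral>\<^sup>+x. ennreal (norm (f x - t n x)) \<partial>M) = ennreal (L1_norm M (g - t n))" for n
  proof -
    have "(\<integral>\<^sup>+x. ennreal (norm (f x - t n x)) \<partial>M) = (\<integral>\<^sup>+x. ennreal (norm ((g - t n) x)) \<partial>M)"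
      using fg by (intro nn_integral_cong_AE) (auto elim: eventually_mono)
    then show ?thesis using nn_integral_norm_L1[OF L1_functions_diff[OF g simple_in_L1[OF t(1)]]] by simp
  qed
  moreover have "(\<lambda>n. ennreal (L1_norm M (g - t n))) \<longlonglongrightarrow> ennreal 0"
    using t(2) by (intro tendsto_ennrealI)
  ultimately have "(\<lambda>n. \<integral>\<^sup>+x. ennreal (norm (f x - t n x)) \<partial>M) \<longlonglongrightarrow> 0" by simp
  with sm t(1) show "bochner_integrable M f" unfolding bochner_integrable_def by blast
qed

locale L1_over = banach_over smul for smul :: "'k::rc_field \<Rightarrow> 'y::banach \<Rightarrow> 'y" +
  fixes M :: "'a measure"
begin

abbreviation "X \<equiv> L1_space M smul"
abbreviation "S \<equiv> L1_functions M :: ('a \<Rightarrow> 'y) set"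
abbreviation "N \<equiv> L1_norm M :: ('a \<Rightarrow> 'y) \<Rightarrow> real"
abbreviation "cls \<equiv> L1_class M :: ('a \<Rightarrow> 'y) \<Rightarrow> ('a \<Rightarrow> 'y) set"

sublocale seminormed_subspace S N by (rule seminormed_L1)

lemma bounded_linear_smul: "bounded_linear (smul a)"
proof (rule bounded_linear_intro[where K = "norm a"])
  show "smul a (r *\<^sub>R y) = r *\<^sub>R smul a y" for r y
    by (simp add: mult.commute flip: scale_of_real)
qed (auto simp: scale_right_distrib norm_scale)

lemma smul_closed: "f \<in> S \<Longrightarrow> (\<lambda>x. smul a (f x)) \<in> S"
  by (rule L1_functions_bounded_linear[where L = "smul a", OF _ bounded_linear_smul])

lemma N_smul: "N (\<lambda>x. smul a (f x)) = norm a * N f"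
  by (simp add: L1_norm_def norm_scale)

lemma cls_cong:
  assumes "AE x in M. f x = g x" shows "cls f = cls g"
proof -
  have "(AE x in M. h x = f x) \<longleftrightarrow> (AE x in M. h x = g x)" for h
    using assms by (auto elim!: eventually_mono[OF eventually_conj])
  then show ?thesis by (simp add: L1_class_def)
qed

text \<open>The arbitrary representative in the definition of the operations agrees almost everywhere with any
  given one; so the operations can be computed on functions.\<close>

lemma rep_cls:
  assumes "f \<in> S" shows "AE x in M. L1_rep (cls f) x = f x"
proof -
  have "f \<in> cls f" using assms by (auto simp: L1_class_def bochner_integrable_iff)
  then have "L1_rep (cls f) \<in> cls f" unfolding L1_rep_def by (rule someI[of "\<lambda>h. h \<in> cls f" f])
  then show ?thesis by (simp add: L1_class_def)
qed

lemma points_eq: "points X = cls ` S"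
proof -
  have "cls ` {f. bochner_integrable M f} = cls ` S"
  proof safe
    fix f :: "'a \<Rightarrow> 'y" assume "bochner_integrable M f"
    then obtain g where "g \<in> S" "AE x in M. f x = g x" unfolding bochner_integrable_iff by blast
    then show "cls f \<in> cls ` S" using cls_cong by blast
  next
    fix f :: "'a \<Rightarrow> 'y" assume "f \<in> S"
    then show "cls f \<in> cls ` {f. bochner_integrable M f}" by (auto simp: bochner_integrable_iff)
  qed
  then show ?thesis by (simp add: L1_space_def)
qed

lemma nadd_cls: "f \<in> S \<Longrightarrow> g \<in> S \<Longrightarrow> nadd X (cls f) (cls g) = cls (f + g)"
  using rep_cls[of f] rep_cls[of g]
  by (auto simp: L1_space_def intro!: cls_cong)

lemma nscale_cls: "f \<in> S \<Longrightarrow> nscale X a (cls f) = cls (\<lambda>x. smul a (f x))"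
  using rep_cls[of f] by (auto simp: L1_space_def intro!: cls_cong)

lemma nnorm_cls:
  assumes "f \<in> S" shows "nnorm X (cls f) = N f"
proof -
  have "(\<integral>\<^sup>+x. ennreal (norm (L1_rep (cls f) x)) \<partial>M) = (\<integral>\<^sup>+x. ennreal (norm (f x)) \<partial>M)"
    using rep_cls[OF assms] by (intro nn_integral_cong_AE) (auto elim: eventually_mono)
  then show ?thesis
    using nn_integral_norm_L1[OF assms] N_nonneg[OF assms] by (simp add: L1_space_def)
qed

lemma nscale_real_cls: "f \<in> S \<Longrightarrow> nscale X (of_real r) (cls f) = cls (r *\<^sub>R f)"
  by (simp add: nscale_cls scale_of_real scaleR_fun_def)

lemma ndiff_cls: "f \<in> S \<Longrightarrow> g \<in> S \<Longrightarrow> ndiff X (cls f) (cls g) = cls (f - g)"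
  using nscale_real_cls[of g "- 1"] by (simp add: ndiff_def nadd_cls L1_functions_uminus)

lemma cls_in_unit_ball: "f \<in> S \<Longrightarrow> cls f \<in> unit_ball X \<longleftrightarrow> N f \<le> 1"
  by (auto simp: unit_ball_def points_eq nnorm_cls)

lemma unit_ball_eq: "unit_ball X = cls ` {f\<in>S. N f \<le> 1}"
  by (auto simp: unit_ball_def points_eq nnorm_cls)

text \<open>The multilinear form of the polynomial is pulled back along the passage from functions to classes.\<close>

lemma second_order_homogeneous:
  assumes Q: "homogeneous_polynomial X k Q"
  shows "\<exists>C. second_order (\<lambda>f. Q (cls f)) C"
proof -
  obtain A where A: "multilinear_form X k A" "continuous_form X k A" "\<And>x. x \<in> points X \<Longrightarrow> Q x = A (replicate k x)"
    using Q unfolding homogeneous_polynomial_def by blast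
  have pp: "map cls fs \<in> power_points X k" if "length fs = k" "set fs \<subseteq> S" for fs
    using that by (auto simp: power_points_def points_eq)
  define z where "z = replicate k (cls 0)"
  have z: "z \<in> power_points X k"
    by (auto simp: z_def power_points_def points_eq set_replicate_conv_if L1_functions_zero)
  then obtain d where d: "d > 0" "\<And>vs. vs \<in> power_points X k \<Longrightarrow>
      (\<forall>i<k. nnorm X (ndiff X (vs ! i) (z ! i)) < d) \<Longrightarrow> dist (A vs) (A z) < 1"
    using A(2) unfolding continuous_form_def by (meson zero_less_one)
  interpret bounded_multilinear S N k "\<lambda>fs. A (map cls fs)" d "norm (A z) + 1"
  proof
    fix xs ys and u v :: "'a \<Rightarrow> 'y"
    assume h: "length xs + Suc (length ys) = k" "set xs \<subseteq> S" "set ys \<subseteq> S" "u \<in> S" "v \<in> S"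
    have us: "map cls (xs @ u # ys) \<in> power_points X k" using h by (intro pp) auto
    have "A ((map cls (xs @ u # ys))[length xs := nadd X (cls u) (cls v)])
        = A ((map cls (xs @ u # ys))[length xs := cls u]) + A ((map cls (xs @ u # ys))[length xs := cls v])"
      using A(1) us h unfolding multilinear_form_def by (auto simp: points_eq)
    then show "A (map cls (xs @ (u + v) # ys)) = A (map cls (xs @ u # ys)) + A (map cls (xs @ v # ys))"
      using h by (simp add: nadd_cls list_update_append)
  next
    fix xs ys and u :: "'a \<Rightarrow> 'y" and r
    assume h: "length xs + Suc (length ys) = k" "set xs \<subseteq> S" "set ys \<subseteq> S" "u \<in> S"
    have us: "map cls (xs @ u # ys) \<in> power_points X k" using h by (intro pp) auto
    have "A ((map cls (xs @ u # ys))[length xs := nscale X (of_real r) (cls u)])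
        = of_real r * A ((map cls (xs @ u # ys))[length xs := cls u])"
      using A(1) us h unfolding multilinear_form_def by (auto simp: points_eq)
    then show "A (map cls (xs @ (r *\<^sub>R u) # ys)) = r *\<^sub>R A (map cls (xs @ u # ys))"
      using h by (simp add: nscale_real_cls list_update_append scaleR_conv_of_real)
  next
    fix vs :: "('a \<Rightarrow> 'y) list"
    assume vs: "length vs = k" "set vs \<subseteq> S" "\<And>v. v \<in> set vs \<Longrightarrow> N v < d"
    have "dist (A (map cls vs)) (A z) < 1"
    proof (rule d(2)[OF pp[OF vs(1,2)]], intro allI impI)
      fix i assume i: "i < k"
      with vs have "vs ! i \<in> S" "N (vs ! i) < d" by auto
      with i vs(1) show "nnorm X (ndiff X (map cls vs ! i) (z ! i)) < d"
        by (simp add: z_def ndiff_cls L1_functions_zero nnorm_cls)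
    qed
    then show "norm (A (map cls vs)) \<le> norm (A z) + 1"
      using norm_triangle_ineq2[of "A (map cls vs)" "A z"] by (simp add: dist_norm)
  qed (rule d(1))
  obtain C where C: "second_order (\<lambda>f. A (map cls (replicate k f))) C"
    using second_order_diagonal by blast
  have eq: "Q (cls f) = A (map cls (replicate k f))" if "f \<in> S" for f
    using A(3)[of "cls f"] that by (simp add: points_eq)
  have "second_order (\<lambda>f. Q (cls f)) C"
    using C unfolding second_order_def by (simp add: eq add_closed)
  then show ?thesis by blast
qed

lemma second_order_polynomial:
  assumes P: "continuous_polynomial X P"
  shows "\<exists>C. second_order (\<lambda>f. P (cls f)) C"
proof -
  obtain m Q where Q: "\<And>k. k \<le> m \<Longrightarrow> homogeneous_polynomial X k (Q k)"
      "\<And>x. x \<in> points X \<Longrightarrow> P x = (\<Sum>k\<le>m. Q k x)"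
    using P unfolding continuous_polynomial_def by blast
  have "\<forall>k\<in>{..m}. \<exists>C. second_order (\<lambda>f. Q k (cls f)) C"
    using second_order_homogeneous[OF Q(1)] by blast
  then obtain C where "\<And>k. k \<in> {..m} \<Longrightarrow> second_order (\<lambda>f. Q k (cls f)) (C k)"
    by (subst (asm) bchoice_iff) blast
  then have C: "second_order (\<lambda>f. \<Sum>k\<le>m. Q k (cls f)) (\<Sum>k\<le>m. C k)"
    by (intro second_order_sum) auto
  have eq: "P (cls f) = (\<Sum>k\<le>m. Q k (cls f))" if "f \<in> S" for f
    using Q(2) that by (simp add: points_eq)
  have "second_order (\<lambda>f. P (cls f)) (\<Sum>k\<le>m. C k)"
    using C unfolding second_order_def by (simp add: eq add_closed)
  then show ?thesis by blast
qed

end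


section \<open>The operator attached to a concentrated function\<close>

lemma sum_blocks_apply:
  assumes "finite I" "disjoint_family_on B I" "i \<in> I" "x \<in> B i"
  shows "(\<Sum>i\<in>I. block (B i) (v i)) x = v i"
proof -
  have "indicator (B j) x *\<^sub>R v j = (if j = i then v i else 0)" if "j \<in> I" for j
    using assms that by (auto simp: disjoint_family_on_def indicator_def)
  then have "(\<Sum>i\<in>I. block (B i) (v i)) x = (\<Sum>j\<in>I. if j = i then v i else 0)"
    unfolding sum_fun_apply block_def by (rule sum.cong[OF refl])
  then show ?thesis using assms by simp
qed

lemma sum_blocks_outside:
  assumes "\<And>i. i \<in> I \<Longrightarrow> x \<notin> B i"
  shows "(\<Sum>i\<in>I. block (B i) (v i)) x = 0"
  using assms by (simp add: sum_fun_apply block_def)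

lemma L1_norm_sum_blocks:
  assumes I: "finite I" "disjoint_family_on B I" "\<And>i. i \<in> I \<Longrightarrow> B i \<in> fmeasurable M"
  shows "L1_norm M (\<Sum>i\<in>I. block (B i) (v i)) = (\<Sum>i\<in>I. measure M (B i) * norm (v i))"
proof -
  have "norm ((\<Sum>i\<in>I. block (B i) (v i)) x) = (\<Sum>i\<in>I. indicator (B i) x * norm (v i))" for x
  proof (cases "\<exists>i\<in>I. x \<in> B i")
    case True
    then obtain i where i: "i \<in> I" "x \<in> B i" by blast
    have "indicator (B j) x * norm (v j) = (if j = i then norm (v i) else 0)" if "j \<in> I" for j
      using assms i that by (auto simp: disjoint_family_on_def indicator_def)
    then have "(\<Sum>i\<in>I. indicator (B i) x * norm (v i)) = (\<Sum>j\<in>I. if j = i then norm (v i) else 0)"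
      by (rule sum.cong[OF refl])
    then show ?thesis using I i sum_blocks_apply[OF I(1,2) i, of v] by simp
  next
    case False
    then show ?thesis using sum_blocks_outside[of I x B v] by simp
  qed
  moreover have "integrable M (\<lambda>x. indicator (B i) x * norm (v i))" if "i \<in> I" for i
    using I(3)[OF that] by (auto simp: fmeasurable_def)
  ultimately show ?thesis
    using I(3) by (simp add: L1_norm_def fmeasurable_def)
qed

context L1_over
begin

text \<open>In the complex case \<open>\<phi>(f) = U(f) - U(i f) i\<close>, and rotating \<open>f\<close> so that \<open>\<phi>(f)\<close> is its norm gives the
  bound. Then \<open>\<phi>(h)\<close> has real part \<open>1\<close>; dividing by it, which does not increase the norm, makes the value
  at \<open>h\<close> equal to \<open>1\<close>.\<close>

lemma scalar_linear_functional:
  fixes U :: "('a \<Rightarrow> 'y) \<Rightarrow> real"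
  assumes add: "\<And>f g. f \<in> S \<Longrightarrow> g \<in> S \<Longrightarrow> U (f + g) = U f + U g"
    and scale: "\<And>f r. f \<in> S \<Longrightarrow> U (r *\<^sub>R f) = r * U f"
    and bound: "\<And>f. f \<in> S \<Longrightarrow> \<bar>U f\<bar> \<le> q f"
    and q: "\<And>f a. f \<in> S \<Longrightarrow> q (\<lambda>x. smul a (f x)) = norm a * q f"
    and h: "h \<in> S" "U h = 1"
  obtains \<phi> where "\<And>f g. f \<in> S \<Longrightarrow> g \<in> S \<Longrightarrow> \<phi> (f + g) = \<phi> f + \<phi> g"
    "\<And>f a. f \<in> S \<Longrightarrow> \<phi> (\<lambda>x. smul a (f x)) = a * \<phi> f"
    "\<And>f. f \<in> S \<Longrightarrow> norm (\<phi> f) \<le> q f"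
    "\<phi> h = 1"
proof -
  have "\<exists>\<phi>. (\<forall>f\<in>S. \<forall>g\<in>S. \<phi> (f + g) = \<phi> f + \<phi> g) \<and> (\<forall>f\<in>S. \<forall>a. \<phi> (\<lambda>x. smul a (f x)) = a * \<phi> f) \<and>
      (\<forall>f\<in>S. norm (\<phi> f) \<le> q f) \<and> 1 \<le> norm (\<phi> h)"
  proof (cases rule: real_normed_field_cases[where 'k = 'k])
    case real
    show ?thesis
    proof (intro exI[of _ "\<lambda>f. of_real (U f)"] conjI ballI allI)
      fix f and a :: 'k assume f: "f \<in> S"
      obtain r where r: "a = of_real r" using real by blast
      have "(\<lambda>x. smul a (f x)) = r *\<^sub>R f" by (simp add: r scale_of_real fun_eq_iff)
      with scale[OF f] r show "of_real (U (\<lambda>x. smul a (f x))) = a * of_real (U f)" by simp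
    qed (use add bound h in auto)
  next
    case (complex i)
    define J where "J f = (\<lambda>x. smul i (f x))" for f :: "'a \<Rightarrow> 'y"
    define \<phi> where "\<phi> f = of_real (U f) - of_real (U (J f)) * i" for f
    have JS: "J f \<in> S" if "f \<in> S" for f unfolding J_def using that by (rule smul_closed)
    have Jadd: "J (f + g) = J f + J g" for f g by (simp add: J_def fun_eq_iff scale_right_distrib)
    have norm_\<phi>: "(norm (\<phi> f))\<^sup>2 = (U f)\<^sup>2 + (U (J f))\<^sup>2" for f
      using norm_real_plus_imaginary[OF complex(1), of "U f" "- U (J f)"] by (simp add: \<phi>_def)
    have \<phi>add: "\<phi> (f + g) = \<phi> f + \<phi> g" if "f \<in> S" "g \<in> S" for f g
      using that by (simp add: \<phi>_def Jadd add JS algebra_simps)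
    have \<phi>smul: "\<phi> (\<lambda>x. smul a (f x)) = a * \<phi> f" if f: "f \<in> S" for f a
    proof -
      obtain c d where a: "a = of_real c + of_real d * i" using complex(2) by blast
      have af: "(\<lambda>x. smul a (f x)) = c *\<^sub>R f + d *\<^sub>R J f"
        by (simp add: a J_def fun_eq_iff scale_left_distrib scale_of_real flip: scale_scale)
      have "J (c *\<^sub>R f + d *\<^sub>R J f) = c *\<^sub>R J f + (- d) *\<^sub>R f"
      proof
        fix x
        have "smul i (smul i (f x)) = - f x"
          using complex(1) by (simp add: scale_minus_left flip: power2_eq_square)
        then show "J (c *\<^sub>R f + d *\<^sub>R J f) x = (c *\<^sub>R J f + (- d) *\<^sub>R f) x"
          using bounded_linear.linear[OF bounded_linear_smul[of i]]
          by (simp add: J_def linear_add linear_scale scale_right_distrib)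
      qed
      then have "\<phi> (\<lambda>x. smul a (f x)) = of_real (c * U f + d * U (J f)) - of_real (c * U (J f) - d * U f) * i"
        unfolding af \<phi>_def using f JS[OF f] by (simp add: add scale scaleR_closed del: scaleR_minus_left)
      moreover have "a * \<phi> f = of_real (c * U f) - of_real (c * U (J f) - d * U f) * i - of_real (d * U (J f)) * i\<^sup>2"
        by (simp add: a \<phi>_def algebra_simps power2_eq_square)
      ultimately show ?thesis by (simp add: complex(1))
    qed
    have \<phi>bound: "norm (\<phi> f) \<le> q f" if f: "f \<in> S" for f
    proof (cases "\<phi> f = 0")
      case True
      then show ?thesis using bound[OF f] by simp
    next
      case False
      \<comment> \<open>Multiplication by \<open>\<theta>\<close> makes the value of \<open>\<phi>\<close> real and nonnegative, so that it is a value of \<open>U\<close>.\<close>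
      define \<theta> where "\<theta> = of_real (norm (\<phi> f)) / \<phi> f"
      have \<theta>: "norm \<theta> = 1" using False by (simp add: \<theta>_def norm_divide)
      define g where "g = (\<lambda>x. smul \<theta> (f x))"
      have g: "g \<in> S" "q g = q f" unfolding g_def using f by (auto simp: smul_closed q \<theta>)
      have "\<phi> g = of_real (norm (\<phi> f))" using False \<phi>smul[OF f, of \<theta>] by (simp add: g_def \<theta>_def)
      moreover have "of_real (U g - norm (\<phi> f)) + of_real (- U (J g)) * i = \<phi> g - of_real (norm (\<phi> f))"
        by (simp add: \<phi>_def[of g])
      ultimately have "of_real (U g - norm (\<phi> f)) + of_real (- U (J g)) * i = 0"
        by simp
      then have "(U g - norm (\<phi> f))\<^sup>2 + (- U (J g))\<^sup>2 = 0"
        using norm_real_plus_imaginary[OF complex(1)] by (metis norm_zero zero_power2)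
      then have "U g = norm (\<phi> f)" by (simp add: sum_power2_eq_zero_iff)
      with bound[OF g(1)] g(2) show ?thesis by simp
    qed
    have "1 \<le> (norm (\<phi> h))\<^sup>2" using h norm_\<phi>[of h] by simp
    then have "1 \<le> norm (\<phi> h)" by (simp add: power2_nonneg_ge_1_iff)
    with \<phi>add \<phi>smul \<phi>bound show ?thesis by blast
  qed
  then obtain \<psi> where \<psi>: "\<And>f g. f \<in> S \<Longrightarrow> g \<in> S \<Longrightarrow> \<psi> (f + g) = \<psi> f + \<psi> g"
    "\<And>f a. f \<in> S \<Longrightarrow> \<psi> (\<lambda>x. smul a (f x)) = a * \<psi> f"
    "\<And>f. f \<in> S \<Longrightarrow> norm (\<psi> f) \<le> q f" "1 \<le> norm (\<psi> h)" by blast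
  show thesis
  proof (rule that[of "\<lambda>f. \<psi> f / \<psi> h"])
    fix f assume f: "f \<in> S"
    have "norm (\<psi> f) / norm (\<psi> h) \<le> norm (\<psi> f) / 1" using \<psi>(4) by (intro divide_left_mono) auto
    with \<psi>(3)[OF f] show "norm (\<psi> f / \<psi> h) \<le> q f" by (simp add: norm_divide)
  qed (use \<psi> in \<open>auto simp: add_divide_distrib\<close>)
qed

definition mass_on :: "'a set \<Rightarrow> ('a \<Rightarrow> 'y) \<Rightarrow> real" where
  "mass_on B f = (\<integral>x. indicator B x * norm (f x) \<partial>M)"

lemma mass_on_integrable:
  assumes "f \<in> S" "B \<in> sets M"
  shows "integrable M (\<lambda>x. indicator B x * norm (f x))"
  using integrable_real_mult_indicator[OF assms(2) L1_functionsD(2)[OF assms(1)]] by (simp add: mult.commute)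

lemma mass_on_eq: "mass_on B f = N (\<lambda>x. indicator B x *\<^sub>R f x)"
  by (simp add: mass_on_def L1_norm_def)

text \<open>On each \<open>B\<^sub>i\<close> a functional norming \<open>v\<^sub>i\<close> is applied pointwise and the result is integrated.\<close>

lemma norming_functional_of_blocks:
  fixes B :: "'i \<Rightarrow> 'a set" and v :: "'i \<Rightarrow> 'y"
  assumes I: "finite I" "disjoint_family_on B I" "\<And>i. i \<in> I \<Longrightarrow> B i \<in> fmeasurable M"
    and h: "h = (\<Sum>i\<in>I. block (B i) (v i))" "N h = 1"
  obtains \<phi> where "\<And>f g. f \<in> S \<Longrightarrow> g \<in> S \<Longrightarrow> \<phi> (f + g) = \<phi> f + \<phi> g"
    "\<And>f a. f \<in> S \<Longrightarrow> \<phi> (\<lambda>x. smul a (f x)) = a * \<phi> f"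
    "\<And>f. f \<in> S \<Longrightarrow> norm (\<phi> f) \<le> mass_on (\<Union>i\<in>I. B i) f"
    "\<phi> h = 1"
proof -
  have "\<exists>u :: 'y \<Rightarrow> real. bounded_linear u \<and> (\<forall>x. \<bar>u x\<bar> \<le> norm x) \<and> u (v i) = norm (v i)" for i
    by (rule norming_functional[of "v i"]) blast
  then obtain u :: "'i \<Rightarrow> 'y \<Rightarrow> real" where u: "\<And>i. bounded_linear (u i)" "\<And>i x. \<bar>u i x\<bar> \<le> norm x"
      "\<And>i. u i (v i) = norm (v i)"
    by metis
  have Bs: "B i \<in> sets M" if "i \<in> I" for i using I(3)[OF that] by (rule fmeasurableD)
  have hS: "h \<in> S" unfolding h using I(3) by (intro sum_closed block_in_L1)
  have int: "integrable M (\<lambda>x. indicator (B i) x * u i (f x))" if i: "i \<in> I" and f: "f \<in> S" for i f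
  proof (rule Bochner_Integration.integrable_bound[OF L1_functionsD(2)[OF f]])
    have "u i \<in> borel_measurable borel"
      using u(1) by (intro borel_measurable_continuous_onI) (auto intro: linear_continuous_on)
    then have "(\<lambda>x. u i (f x)) \<in> borel_measurable M"
      using L1_functionsD(3)[OF f] by (rule measurable_compose[rotated])
    then show "(\<lambda>x. indicator (B i) x * u i (f x)) \<in> borel_measurable M" using Bs[OF i] by measurable
  qed (use u(2) in \<open>auto simp: indicator_def\<close>)
  define U where "U f = (\<Sum>i\<in>I. \<integral>x. indicator (B i) x * u i (f x) \<partial>M)" for f
  have Uadd: "U (f + g) = U f + U g" if "f \<in> S" "g \<in> S" for f g
    unfolding U_def sum.distrib[symmetric]
  proof (rule sum.cong[OF refl])
    fix i assume i: "i \<in> I"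
    have "(\<lambda>x. indicator (B i) x * u i ((f + g) x)) = (\<lambda>x. indicator (B i) x * u i (f x) + indicator (B i) x * u i (g x))"
      using bounded_linear.linear[OF u(1)[of i]] by (auto simp: linear_add algebra_simps)
    then show "(\<integral>x. indicator (B i) x * u i ((f + g) x) \<partial>M)
        = (\<integral>x. indicator (B i) x * u i (f x) \<partial>M) + (\<integral>x. indicator (B i) x * u i (g x) \<partial>M)"
      using int[OF i] that by simp
  qed
  have Uscale: "U (r *\<^sub>R f) = r * U f" if "f \<in> S" for f r
    unfolding U_def sum_distrib_left
  proof (rule sum.cong[OF refl])
    fix i assume i: "i \<in> I"
    have "(\<lambda>x. indicator (B i) x * u i ((r *\<^sub>R f) x)) = (\<lambda>x. r * (indicator (B i) x * u i (f x)))"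
      using bounded_linear.linear[OF u(1)[of i]] by (auto simp: linear_scale algebra_simps)
    then show "(\<integral>x. indicator (B i) x * u i ((r *\<^sub>R f) x) \<partial>M) = r * (\<integral>x. indicator (B i) x * u i (f x) \<partial>M)"
      by simp
  qed
  have Ubound: "\<bar>U f\<bar> \<le> mass_on (\<Union>i\<in>I. B i) f" if f: "f \<in> S" for f
  proof -
    have "\<bar>U f\<bar> \<le> (\<Sum>i\<in>I. \<integral>x. indicator (B i) x * norm (f x) \<partial>M)"
      unfolding U_def
    proof (rule order_trans[OF sum_abs sum_mono])
      fix i assume i: "i \<in> I"
      have "\<bar>\<integral>x. indicator (B i) x * u i (f x) \<partial>M\<bar> \<le> (\<integral>x. \<bar>indicator (B i) x * u i (f x)\<bar> \<partial>M)"
        by (rule integral_abs_bound)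
      also have "\<dots> \<le> (\<integral>x. indicator (B i) x * norm (f x) \<partial>M)"
        using int[OF i f] mass_on_integrable[OF f Bs[OF i]] u(2)
        by (intro integral_mono) (auto simp: indicator_def)
      finally show "\<bar>\<integral>x. indicator (B i) x * u i (f x) \<partial>M\<bar> \<le> \<dots>" .
    qed
    also have "\<dots> = (\<integral>x. (\<Sum>i\<in>I. indicator (B i) x * norm (f x)) \<partial>M)"
      using mass_on_integrable[OF f Bs] by simp
    also have "\<dots> = mass_on (\<Union>i\<in>I. B i) f"
      unfolding mass_on_def using I by (simp add: indicator_UN_disjoint sum_distrib_right)
    finally show ?thesis .
  qed
  have "U h = (\<Sum>i\<in>I. measure M (B i) * norm (v i))"
    unfolding U_def
  proof (rule sum.cong[OF refl])
    fix i assume i: "i \<in> I"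
    have eq: "indicator (B i) x * u i (h x) = indicator (B i) x * norm (v i)" for x
      using sum_blocks_apply[OF I(1,2) i, of x v] u(3)[of i] by (auto simp: h indicator_def)
    then show "(\<integral>x. indicator (B i) x * u i (h x) \<partial>M) = measure M (B i) * norm (v i)"
      unfolding eq using I(3)[OF i] by (simp add: fmeasurable_def)
  qed
  also have "\<dots> = 1" using h L1_norm_sum_blocks[OF I, of v] by simp
  finally have Uh: "U h = 1" .
  have mass_smul: "mass_on B' (\<lambda>x. smul a (f x)) = norm a * mass_on B' f" for B' a f
    by (simp add: mass_on_def norm_scale mult.left_commute)
  show thesis
    using scalar_linear_functional[of U "mass_on (\<Union>i\<in>I. B i)" h, OF Uadd Uscale Ubound mass_smul hS Uh] that
    by blast
qed

lemma cls_eqD: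
  assumes "f \<in> S" "g \<in> S" "cls f = cls g" shows "AE x in M. f x = g x"
proof -
  have "f \<in> cls f" using assms(1) by (auto simp: L1_class_def bochner_integrable_iff)
  with assms(3) have "f \<in> cls g" by simp
  then show ?thesis by (simp add: L1_class_def)
qed

text \<open>The operator is \<open>f \<mapsto> f 1\<^bsub>B\<^sup>c\<^esub> + \<phi>(f) g\<close>. What it loses by cutting \<open>f\<close> off on \<open>B\<close> is enough to pay for
  the second summand. It is well defined on classes because \<open>\<phi>\<close> is bounded by an integral.\<close>

lemma mem_OF_set:
  fixes \<phi> :: "('a \<Rightarrow> 'y) \<Rightarrow> 'k"
  assumes \<phi>: "\<And>f g. f \<in> S \<Longrightarrow> g \<in> S \<Longrightarrow> \<phi> (f + g) = \<phi> f + \<phi> g"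
      "\<And>f a. f \<in> S \<Longrightarrow> \<phi> (\<lambda>x. smul a (f x)) = a * \<phi> f"
      "\<And>f. f \<in> S \<Longrightarrow> norm (\<phi> f) \<le> mass_on B f"
    and B: "B \<in> sets M"
    and h: "h \<in> S" "N h \<le> 1" "\<phi> h = 1" "\<And>x. x \<notin> B \<Longrightarrow> h x = 0"
    and g: "g \<in> S" "N g \<le> 1"
    and xs: "set xs \<subseteq> cls ` {f\<in>S. 2 * mass_on B f < \<epsilon>}" and \<epsilon>: "\<epsilon> > 0"
  shows "cls h \<in> OF_set X xs (cls g) \<epsilon>"
proof -
  define T0 where "T0 f = (\<lambda>x. f x - indicator B x *\<^sub>R f x + smul (\<phi> f) (g x))" for f
  have mass: "0 \<le> mass_on B f" for f by (auto simp: mass_on_def)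
  have T0S: "T0 f \<in> S" if "f \<in> S" for f
  proof -
    have "(f - (\<lambda>x. indicator B x *\<^sub>R f x)) + (\<lambda>x. smul (\<phi> f) (g x)) \<in> S"
      using that B g by (intro add_closed L1_functions_diff L1_functions_restrict smul_closed)
    then show ?thesis by (simp add: T0_def plus_fun_def fun_diff_def)
  qed
  have T0N: "N (T0 f) \<le> N f" if f: "f \<in> S" for f
  proof -
    have int: "integrable M (\<lambda>x. norm (f x) - indicator B x * norm (f x))"
        "integrable M (\<lambda>x. norm (\<phi> f) * norm (g x))"
      using mass_on_integrable[OF f B] L1_functionsD(2)[OF f] L1_functionsD(2)[OF g(1)] by auto
    have "N (T0 f) \<le> (\<integral>x. (norm (f x) - indicator B x * norm (f x)) + norm (\<phi> f) * norm (g x) \<partial>M)"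
      unfolding L1_norm_def
    proof (rule integral_mono)
      fix x
      have "norm (T0 f x) \<le> norm (f x - indicator B x *\<^sub>R f x) + norm (smul (\<phi> f) (g x))"
        unfolding T0_def by (rule norm_triangle_ineq)
      then show "norm (T0 f x) \<le> (norm (f x) - indicator B x * norm (f x)) + norm (\<phi> f) * norm (g x)"
        by (auto simp: norm_scale indicator_def)
    qed (use L1_functionsD(2)[OF T0S[OF f]] int in auto)
    also have "\<dots> = N f - mass_on B f + norm (\<phi> f) * N g"
      using int mass_on_integrable[OF f B] L1_functionsD(2)[OF f]
      by (simp add: L1_norm_def mass_on_def)
    also have "norm (\<phi> f) * N g \<le> norm (\<phi> f)"
      using g by (intro mult_left_le) auto
    also have "\<dots> \<le> mass_on B f" using \<phi>(3)[OF f] .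
    finally show ?thesis by simp
  qed
  have T0add: "T0 (f + f') = T0 f + T0 f'" if "f \<in> S" "f' \<in> S" for f f'
    using \<phi>(1)[OF that] by (auto simp: T0_def fun_eq_iff scale_left_distrib algebra_simps)
  have T0smul: "T0 (\<lambda>x. smul a (f x)) = (\<lambda>x. smul a (T0 f x))" if f: "f \<in> S" for f a
  proof
    fix x
    have "smul a (f x - indicator B x *\<^sub>R f x) = smul a (f x) - indicator B x *\<^sub>R smul a (f x)"
      by (auto simp: indicator_def)
    then show "T0 (\<lambda>x. smul a (f x)) x = smul a (T0 f x)"
      by (simp add: T0_def \<phi>(2)[OF f] scale_right_distrib)
  qed
  have T0cong: "cls (T0 f) = cls (T0 f')" if f: "f \<in> S" "f' \<in> S" "AE x in M. f x = f' x" for f f'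
  proof -
    have fd: "f - f' \<in> S" using f by (intro L1_functions_diff)
    have "mass_on B (f - f') = 0"
      unfolding mass_on_eq using f(3) by (intro L1_norm_AE_zero) auto
    then have "\<phi> (f - f') = 0" using \<phi>(3)[OF fd] by simp
    then have "\<phi> f = \<phi> f'" using \<phi>(1)[OF fd f(2)] by simp
    then show ?thesis using f(3) by (intro cls_cong) (auto simp: T0_def)
  qed
  define T where "T F = cls (T0 (inv_into S cls F))" for F
  have T: "T (cls f) = cls (T0 f)" if f: "f \<in> S" for f
  proof -
    have "inv_into S cls (cls f) \<in> S" "cls (inv_into S cls (cls f)) = cls f"
      using f by (simp_all add: inv_into_into f_inv_into_f)
    then show ?thesis unfolding T_def using f by (intro T0cong cls_eqD)
  qed
  have "bounded_operator X T"
    unfolding bounded_operator_def points_eq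
  proof (intro conjI ballI allI exI[of _ 1])
    fix u assume "u \<in> cls ` S"
    then obtain f where f: "u = cls f" "f \<in> S" by blast
    show "T u \<in> cls ` S" using f T T0S by simp
    show "nnorm X (T u) \<le> 1 * nnorm X u" using f T0N[OF f(2)] by (simp add: T T0S nnorm_cls)
    show "T (nscale X a u) = nscale X a (T u)" for a
      using f T[OF smul_closed[OF f(2)]] by (simp add: nscale_cls T T0S T0smul)
    fix v assume "v \<in> cls ` S"
    then obtain f' where f': "v = cls f'" "f' \<in> S" by blast
    show "T (nadd X u v) = nadd X (T u) (T v)"
      using f f' by (simp add: nadd_cls T T0S T0add add_closed)
  qed
  moreover have "operator_norm X T \<le> 1 + \<epsilon>"
    unfolding operator_norm_def
  proof (rule cSUP_least)
    show "unit_ball X \<noteq> {}" using g by (auto simp: unit_ball_eq)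
    fix u assume "u \<in> unit_ball X"
    then obtain f where f: "u = cls f" "f \<in> S" "N f \<le> 1" by (auto simp: unit_ball_eq)
    then show "nnorm X (T u) \<le> 1 + \<epsilon>" using T0N[OF f(2)] \<epsilon> by (simp add: T T0S nnorm_cls)
  qed
  moreover have "nnorm X (ndiff X (T (cls h)) (cls g)) < \<epsilon>"
  proof -
    have "T0 h = g" using h(3,4) by (auto simp: T0_def fun_eq_iff indicator_def)
    then show ?thesis using h(1) g(1) \<epsilon> by (simp add: T ndiff_cls nnorm_cls L1_functions_zero N_zero)
  qed
  moreover have "nnorm X (ndiff X (T x) x) < \<epsilon>" if x: "x \<in> set xs" for x
  proof -
    obtain f where f: "x = cls f" "f \<in> S" "2 * mass_on B f < \<epsilon>" using x xs by blast
    have rest: "(\<lambda>x. indicator B x *\<^sub>R f x) \<in> S" using f B by (intro L1_functions_restrict)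
    have "T0 f - f = (- 1) *\<^sub>R (\<lambda>x. indicator B x *\<^sub>R f x) + (\<lambda>x. smul (\<phi> f) (g x))"
      by (auto simp: T0_def fun_eq_iff)
    then have "N (T0 f - f) \<le> N ((- 1) *\<^sub>R (\<lambda>x. indicator B x *\<^sub>R f x)) + N (\<lambda>x. smul (\<phi> f) (g x))"
      by (simp only: N_add[OF scaleR_closed[OF rest] smul_closed[OF g(1)]])
    also have "\<dots> = mass_on B f + norm (\<phi> f) * N g"
      using N_scaleR[OF rest, of "- 1"] by (simp add: N_smul mass_on_eq)
    also have "norm (\<phi> f) * N g \<le> norm (\<phi> f)" using g by (intro mult_left_le) auto
    also have "\<dots> \<le> mass_on B f" using \<phi>(3)[OF f(2)] .
    finally show ?thesis using f by (simp add: T T0S ndiff_cls nnorm_cls L1_functions_diff)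
  qed
  ultimately show ?thesis
    using h by (auto simp: OF_set_def cls_in_unit_ball)
qed

end


section \<open>Concentrating a near-maximizer\<close>

context L1_over
begin

text \<open>The choices \<open>(B, c)\<close> for a block on \<open>D\<close> of the simple function, standing for \<open>c\<close> times the value of the
  block on \<open>B\<close>. Their norm does not depend on the choice.\<close>

lemma spread_choices:
  assumes M: "atomless M" and D: "D \<in> fmeasurable M" and \<beta>: "\<beta> > 0"
  shows "\<exists>K w. finite K \<and> (\<forall>k\<in>K. fst k \<in> fmeasurable M \<and> fst k \<subseteq> D \<and>
      \<bar>snd k\<bar> * measure M (fst k) = measure M D \<and> measure M (fst k) < \<beta>) \<and>
      (\<forall>k\<in>K. 0 \<le> w k) \<and> sum w K = (1::real) \<and>
      (AE x in M. (\<Sum>k\<in>K. w k * (snd k * indicator (fst k) x)) = (indicator D x :: real))"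
proof -
  obtain A' K w where A': "A' \<in> fmeasurable M" "A' \<subseteq> D" "measure M (D - A') = 0"
    and K: "finite K" "\<And>B c. (B, c) \<in> K \<Longrightarrow> B \<in> fmeasurable M \<and> B \<subseteq> D \<and> measure M B < \<beta> \<and> 0 \<le> c \<and> c * measure M B = measure M D"
    and w: "\<And>k. k \<in> K \<Longrightarrow> 0 \<le> w k" "sum w K = 1"
    and eq: "\<And>x. (\<Sum>k\<in>K. w k * (snd k * indicator (fst k) x)) = (indicator A' x :: real)"
    using concentrate_indicator[OF M D \<beta>] by blast
  have "D - A' \<in> fmeasurable M" using D A' by (intro fmeasurable_Diff) (auto simp: fmeasurableD)
  then have "D - A' \<in> null_sets M" using A'(3) by (auto simp: null_sets_def emeasure_eq_measure2 fmeasurableD)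
  then have "AE x in M. x \<notin> D - A'" by (rule AE_not_in)
  then have "AE x in M. (\<Sum>k\<in>K. w k * (snd k * indicator (fst k) x)) = (indicator D x :: real)"
    by eventually_elim (unfold eq, use A'(2) in \<open>auto simp: indicator_def\<close>)
  moreover have "fst k \<in> fmeasurable M \<and> fst k \<subseteq> D \<and> \<bar>snd k\<bar> * measure M (fst k) = measure M D \<and> measure M (fst k) < \<beta>"
    if "k \<in> K" for k
    using K(2)[of "fst k" "snd k"] that by simp
  ultimately show ?thesis using K(1) w by (intro exI[of _ K] exI[of _ w]) blast
qed

text \<open>The choices for a block on \<open>D\<close> that serves to enlarge the norm: their mean is zero.\<close>

lemma sign_choices:
  assumes D: "D \<in> fmeasurable M"
  shows "\<exists>K w. finite K \<and> (\<forall>k\<in>K. fst k \<in> fmeasurable M \<and> fst k \<subseteq> D \<and>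
      \<bar>snd k\<bar> * measure M (fst k) = measure M D) \<and>
      (\<forall>k\<in>K. 0 \<le> w k) \<and> sum w K = (1::real) \<and>
      (AE x in M. (\<Sum>k\<in>K. w k * (snd k * indicator (fst k) x)) = (0 :: real))"
  using D by (intro exI[of _ "{(D, 1), (D, - 1)}"] exI[of _ "\<lambda>_. 1 / 2"]) auto

text \<open>Shrinking \<open>f\<close> by the factor \<open>1 - \<rho>\<close> first leaves room in the unit ball for the error of the
  approximation by simple functions.\<close>

lemma simple_near_maximizer:
  fixes p :: "('a \<Rightarrow> 'y) \<Rightarrow> 'b::real_normed_vector"
  assumes p: "second_order p C" and f: "f \<in> S" "N f \<le> 1" and \<tau>: "\<tau> > 0"
  obtains t where "Bochner_Integration.simple_bochner_integrable M t" "N t \<le> 1" "norm (p f) - \<tau> \<le> norm (p t)"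
proof -
  have C: "C \<ge> 0" using p by (simp add: second_order_def)
  define \<rho> where "\<rho> = min (1/2) (\<tau> / (4 * (C + 1)))"
  have \<rho>: "0 < \<rho>" using C \<tau> by (simp add: \<rho>_def)
  have \<rho>2: "\<rho> \<le> 1/2" by (simp only: \<rho>_def min.cobounded1)
  have "\<rho> \<le> \<tau> / (4 * (C + 1))" by (simp add: \<rho>_def)
  then have "4 * (C + 1) * \<rho> \<le> \<tau>" using C by (simp add: field_simps)
  then have \<rho>C: "4 * C * \<rho> \<le> \<tau>" using \<rho> by (simp add: algebra_simps)
  define g where "g = (1 - \<rho>) *\<^sub>R f"
  have g: "g \<in> S" unfolding g_def using f by (intro scaleR_closed)
  obtain t where t: "\<And>n. Bochner_Integration.simple_bochner_integrable M (t n)"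
    "(\<lambda>n. N (g - t n)) \<longlonglongrightarrow> 0"
    using simple_approximation[OF g] by blast
  have "\<forall>\<^sub>F n in sequentially. N (g - t n) < \<rho>" using t(2) \<rho>(1) by (rule order_tendstoD)
  then obtain n where n: "N (g - t n) < \<rho>" by (auto simp: eventually_sequentially)
  have tS: "t n \<in> S" using t(1) by (rule simple_in_L1)
  have gt: "g - t n \<in> S" using g tS by (rule L1_functions_diff)
  define r where "r = - 1 *\<^sub>R (g - t n)"
  have gr: "g + r = t n" by (simp add: r_def)
  have tg: "r \<in> S" "N (r) < \<rho>"
    unfolding r_def using scaleR_closed[OF gt, of "- 1"] N_scaleR[OF gt, of "- 1"] n by auto
  have "N (t n) \<le> N g + N (r)"
    using N_add[OF g tg(1)] by (simp only: gr)
  also have "N g = (1 - \<rho>) * N f" unfolding g_def using f \<rho>2 by (simp add: N_scaleR)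
  also have "\<dots> \<le> (1 - \<rho>) * 1" using f \<rho>2 by (intro mult_left_mono) auto
  finally have Nt: "N (t n) \<le> 1" using tg by simp
  define u where "u = (- \<rho>) *\<^sub>R f + r"
  have u: "u \<in> S" unfolding u_def using f tg by (intro add_closed scaleR_closed)
  have "N u \<le> N ((- \<rho>) *\<^sub>R f) + N r"
    unfolding u_def using f tg by (intro N_add scaleR_closed)
  also have "N ((- \<rho>) *\<^sub>R f) = \<rho> * N f" using f \<rho> N_scaleR[OF f(1), of "- \<rho>"] by simp
  also have "\<dots> \<le> \<rho> * 1" using f \<rho> by (intro mult_left_mono) auto
  finally have Nu: "N u \<le> 2 * \<rho>" using tg by simp
  have fu: "f + u = t n" by (simp add: u_def r_def g_def fun_eq_iff algebra_simps)
  have "norm (p (t n) - p f) \<le> 2 * C * N u"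
    using second_order_lipschitz[OF p f u] Nu \<rho>2 by (simp add: fu)
  also have "\<dots> \<le> 2 * C * (2 * \<rho>)" using Nu C by (intro mult_left_mono) auto
  also have "\<dots> \<le> \<tau>" using \<rho>C by simp
  finally have "norm (p (t n) - p f) \<le> \<tau>" .
  then have "norm (p f) - \<tau> \<le> norm (p (t n))"
    using norm_triangle_ineq2[of "p f" "p (t n)"] by (simp add: norm_minus_commute)
  then show thesis using t(1) Nt by (intro that)
qed

text \<open>Index pairs \<open>(y, D)\<close> with \<open>y \<noteq> 0\<close> are blocks of the simple function, with value \<open>y\<close>; pairs \<open>(0, D)\<close>
  belong to the set \<open>E\<close> on which the norm is enlarged by means of \<open>w0\<close>. The value \<open>0\<close> is free to mark the
  latter because it is not among the values \<open>y\<close>.\<close>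

lemma concentrated_near_maximizer:
  fixes p :: "('a \<Rightarrow> 'y) \<Rightarrow> 'b::real_normed_vector" and G :: "'a \<Rightarrow> real"
  assumes M: "atomless M" and p: "second_order p C" and f: "f \<in> S" "N f \<le> 1"
    and y0: "y0 \<noteq> (0::'y)" and E0: "E0 \<in> fmeasurable M" "measure M E0 > 0"
    and G: "integrable M G" "\<And>x. 0 \<le> G x" and e: "e > 0" and \<tau>: "\<tau> > 0"
  obtains I :: "('y \<times> 'a set) set" and B v where
    "finite I" "disjoint_family_on B I" "\<And>i. i \<in> I \<Longrightarrow> B i \<in> fmeasurable M"
    "N (\<Sum>i\<in>I. block (B i) (v i)) = 1"
    "(\<integral>x. indicator (\<Union>i\<in>I. B i) x * G x \<partial>M) < e"
    "norm (p f) - 3 * \<tau> \<le> norm (p (\<Sum>i\<in>I. block (B i) (v i)))"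
proof -
  have C: "C \<ge> 0" using p by (simp add: second_order_def)
  obtain t where t: "Bochner_Integration.simple_bochner_integrable M t" "N t \<le> 1" "norm (p f) - \<tau> \<le> norm (p t)"
    using simple_near_maximizer[OF p f \<tau>] by blast
  have tS: "t \<in> S" using t(1) by (rule simple_in_L1)
  define \<delta> where "\<delta> = \<tau> / (2 * (C + 1))"
  have \<delta>: "\<delta> > 0" "2 * C * \<delta> \<le> \<tau>"
    using C \<tau> by (auto simp: \<delta>_def field_simps)
  define e' where "e' = min e (min 1 \<delta>)"
  have e': "e' > 0" "e' \<le> e" "e' \<le> 1" "e' \<le> \<delta>" using e \<delta> by (auto simp: e'_def)
  \<comment> \<open>A set of measure below \<open>\<eta>\<close> will carry little of \<open>G\<close> and little of \<open>t\<close>; the set \<open>E\<close> and the blocks off \<open>E\<close> get half of \<open>\<eta>\<close> each.\<close>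
  define H where "H x = G x + norm (t x)" for x
  have H: "integrable M H" "\<And>x. 0 \<le> H x" using G L1_functionsD(2)[OF tS] by (auto simp: H_def[abs_def])
  obtain \<eta> where \<eta>: "0 < \<eta>" "\<And>B. B \<in> fmeasurable M \<Longrightarrow> measure M B < \<eta> \<Longrightarrow> (\<integral>x. indicator B x * H x \<partial>M) < e'"
    using integral_small_on_small_sets[OF H e'(1)] by blast
  have H_int: "integrable M (\<lambda>x. indicator B x * H x)" if "B \<in> sets M" for B
    using integrable_real_mult_indicator[OF that H(1)] by (simp add: mult.commute)
  obtain E where E: "E \<in> fmeasurable M" "0 < measure M E" "measure M E < \<eta> / 2"
    using atomless_small_subset[OF M E0, of "\<eta> / 2"] \<eta>(1) by auto
  have Es: "E \<in> sets M" using E(1) by (rule fmeasurableD)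
  define t1 where "t1 = t + - 1 *\<^sub>R (\<lambda>x. indicator E x *\<^sub>R t x)"
  have tE: "(\<lambda>x. indicator E x *\<^sub>R t x) \<in> S" using tS Es by (rule L1_functions_restrict)
  have t1S: "t1 \<in> S" unfolding t1_def using tS tE by (intro add_closed scaleR_closed)
  have "mass_on E t \<le> (\<integral>x. indicator E x * H x \<partial>M)"
    unfolding mass_on_def using mass_on_integrable[OF tS Es] H_int[OF Es] G(2)
    by (intro integral_mono) (auto simp: H_def indicator_def)
  also have "\<dots> < e'" using E \<eta> by (intro \<eta>(2)) auto
  finally have mE: "mass_on E t < e'" .
  have "norm (p t1 - p t) \<le> 2 * C * N (- 1 *\<^sub>R (\<lambda>x. indicator E x *\<^sub>R t x))"
    unfolding t1_def using mE e' N_scaleR[OF tE, of "- 1"]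
    by (intro second_order_lipschitz[OF p tS t(2) scaleR_closed[OF tE]]) (simp add: mass_on_eq)
  also have "\<dots> = 2 * C * mass_on E t" using N_scaleR[OF tE, of "- 1"] by (simp add: mass_on_eq)
  also have "\<dots> \<le> 2 * C * \<delta>" using mE e' C by (intro mult_left_mono) auto
  finally have "norm (p t1 - p t) \<le> \<tau>" using \<delta> by simp
  then have pt1: "norm (p f) - 2 * \<tau> \<le> norm (p t1)"
    using t(3) norm_triangle_ineq2[of "p t" "p t1"] by (simp add: norm_minus_commute)
  have Nt1: "N t1 \<le> 1"
  proof -
    have "N t1 \<le> N t"
      unfolding L1_norm_def using L1_functionsD(2)[OF tS] L1_functionsD(2)[OF t1S]
      by (intro integral_mono) (auto simp: t1_def indicator_def)
    with t(2) show ?thesis by simp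
  qed
  \<comment> \<open>The value \<open>w0\<close> on \<open>E\<close> makes up for what \<open>t1\<close> lacks to norm \<open>1\<close>.\<close>
  define w0 where "w0 = ((1 - N t1) / (measure M E * norm y0)) *\<^sub>R y0"
  have w0: "measure M E * norm w0 = 1 - N t1" using E y0 Nt1 by (simp add: w0_def)
  define V where "V = t ` space M - {0}"
  have t_simple: "simple_function M t" "emeasure M {x\<in>space M. t x \<noteq> 0} \<noteq> \<infinity>"
    using t(1) by (auto elim: simple_bochner_integrable.cases)
  have V: "finite V" "0 \<notin> V" using t_simple(1) by (auto simp: V_def simple_function_def)
  define A where "A y = (if y = 0 then E else {x\<in>space M. t x = y} - E)" for y
  have A: "A y \<in> fmeasurable M" if "y \<in> insert 0 V" for y
  proof (cases "y = 0")
    case False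
    have ts: "{x\<in>space M. t x = z} \<in> sets M" for z
    proof -
      have "t -` {z} \<inter> space M \<in> sets M" using t_simple(1) by (rule simple_functionD)
      moreover have "t -` {z} \<inter> space M = {x\<in>space M. t x = z}" by auto
      ultimately show ?thesis by simp
    qed
    have "{x\<in>space M. t x \<noteq> 0} = space M - {x\<in>space M. t x = 0}" by auto
    with ts[of 0] have "{x\<in>space M. t x \<noteq> 0} \<in> sets M" by simp
    with t_simple(2) have fin: "{x\<in>space M. t x \<noteq> 0} \<in> fmeasurable M"
      by (auto simp: fmeasurable_def less_top)
    show ?thesis using ts[of y] Es False
      by (intro fmeasurableI2[OF fin]) (auto simp: A_def)
  qed (simp add: A_def E)
  define yv where "yv y = (if y = 0 then w0 else y)" for y
  \<comment> \<open>Sets of measure below \<open>cut y\<close> give blocks of norm at most \<open>\<delta>\<close>. The summand \<open>1\<close> prevents division by zero when \<open>w0 = 0\<close>.\<close>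
  define cut where "cut y = \<delta> / (norm (yv y) + 1)" for y
  have cut: "0 < cut y" for y using \<delta> by (auto simp: cut_def add_nonneg_pos)
  have "\<exists>P. finite P \<and> disjoint P \<and> P \<subseteq> fmeasurable M \<and> \<Union>P = A y \<and> (\<forall>D\<in>P. measure M D < cut y)"
    if y: "y \<in> insert 0 V" for y
    by (rule atomless_finite_partition[OF M A[OF y] cut[of y]]) blast
  then obtain P where P: "\<And>y. y \<in> insert 0 V \<Longrightarrow> finite (P y) \<and> disjoint (P y) \<and> P y \<subseteq> fmeasurable M \<and>
      \<Union>(P y) = A y \<and> (\<forall>D\<in>P y. measure M D < cut y)"
    by metis
  define I where "I = Sigma (insert 0 V) P"
  have I: "finite I" unfolding I_def using V P by (intro finite_SigmaI) auto
  have ID: "snd i \<in> fmeasurable M" "snd i \<subseteq> A (fst i)" "measure M (snd i) < cut (fst i)"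
      "fst i \<in> insert 0 V" if "i \<in> I" for i
  proof -
    have i: "fst i \<in> insert 0 V" "snd i \<in> P (fst i)" using that by (auto simp: I_def)
    with P[OF i(1)] show "snd i \<in> fmeasurable M" "snd i \<subseteq> A (fst i)" "measure M (snd i) < cut (fst i)"
      by blast+
    show "fst i \<in> insert 0 V" by (rule i(1))
  qed
  have A_disj: "A y \<inter> A z = {}" if "y \<noteq> z" for y z using that by (auto simp: A_def)
  have Idisj: "disjoint_family_on snd I"
    unfolding disjoint_family_on_def
  proof (intro ballI impI)
    fix i j assume ij: "i \<in> I" "j \<in> I" "i \<noteq> j"
    show "snd i \<inter> snd j = {}"
    proof (cases "fst i = fst j")
      case True
      with ij have "snd i \<noteq> snd j" by (simp add: prod_eq_iff)
      moreover have "snd i \<in> P (fst i)" "snd j \<in> P (fst i)" using ij True by (auto simp: I_def)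
      moreover have "disjoint (P (fst i))" using P ID(4)[OF ij(1)] by blast
      ultimately show ?thesis by (auto simp: disjoint_def)
    next
      case False
      then show ?thesis using ID(2)[OF ij(1)] ID(2)[OF ij(2)] A_disj by blast
    qed
  qed
  define \<beta> where "\<beta> = \<eta> / (2 * (real (card I) + 1))"
  have \<beta>: "0 < \<beta>" using \<eta> by (simp add: \<beta>_def)
  define choices where "choices i K w \<longleftrightarrow> finite K \<and> (\<forall>k\<in>K. fst k \<in> fmeasurable M \<and> fst k \<subseteq> snd i \<and>
      \<bar>snd k\<bar> * measure M (fst k) = measure M (snd i) \<and> (fst i \<noteq> 0 \<longrightarrow> measure M (fst k) < \<beta>)) \<and>
      (\<forall>k\<in>K. 0 \<le> w k) \<and> sum w K = (1::real) \<and>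
      (AE x in M. (\<Sum>k\<in>K. w k * (snd k * indicator (fst k) x)) = (if fst i = 0 then 0 else indicator (snd i) x :: real))"
    for i :: "'y \<times> 'a set" and K w
  have "\<forall>i\<in>I. \<exists>K w. choices i K w"
  proof
    fix i assume i: "i \<in> I"
    show "\<exists>K w. choices i K w"
    proof (cases "fst i = 0")
      case True
      then show ?thesis unfolding choices_def using sign_choices[OF ID(1)[OF i]] by simp
    next
      case False
      then show ?thesis unfolding choices_def using spread_choices[OF M ID(1)[OF i] \<beta>] by simp
    qed
  qed
  then obtain K w where "\<And>i. i \<in> I \<Longrightarrow> choices i (K i) (w i)"
    by metis
  note Kw = this[unfolded choices_def]
  define b where "b i k = block (fst k) (snd k *\<^sub>R yv (fst i))" for i :: "'y \<times> 'a set" and k :: "'a set \<times> real"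
  define d where "d i = measure M (snd i) * norm (yv (fst i))" for i :: "'y \<times> 'a set"
  have bS: "b i k \<in> S" and bN: "N (b i k) = d i" if "i \<in> I" "k \<in> K i" for i k
  proof -
    have k: "fst k \<in> fmeasurable M" "\<bar>snd k\<bar> * measure M (fst k) = measure M (snd i)" using Kw that by auto
    then show "b i k \<in> S" unfolding b_def by (intro block_in_L1)
    show "N (b i k) = d i" unfolding b_def d_def k(2)[symmetric] L1_norm_block[OF k(1)] by simp
  qed
  have d\<delta>: "0 \<le> d i" "d i \<le> \<delta>" if "i \<in> I" for i
  proof -
    have "d i \<le> cut (fst i) * norm (yv (fst i))"
      unfolding d_def using ID(3)[OF that] by (intro mult_right_mono) auto
    also have "\<dots> = \<delta> * (norm (yv (fst i)) / (norm (yv (fst i)) + 1))" by (simp add: cut_def)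
    also have "\<dots> \<le> \<delta> * 1"
      using \<delta> by (intro mult_left_mono) (auto simp: divide_le_eq_1 add_nonneg_pos)
    finally show "d i \<le> \<delta>" by simp
  qed (simp add: d_def)
  define I0 where "I0 = Sigma V P"
  have I_split: "I = Pair 0 ` P 0 \<union> I0" "Pair 0 ` P 0 \<inter> I0 = {}" using V by (auto simp: I_def I0_def)
  have I0: "finite I0" "I0 \<subseteq> I" using I I_split by auto
  have I0disj: "disjoint_family_on snd I0" using Idisj I0(2) by (rule disjoint_family_on_mono[rotated])
  define h1 where "h1 = (\<Sum>i\<in>I0. block (snd i) (fst i))"
  have h1_eq: "h1 x = t1 x" if x: "x \<in> space M" for x
  proof (cases "t x \<noteq> 0 \<and> x \<notin> E")
    case True
    then have "t x \<in> V" "x \<in> A (t x)" using x by (auto simp: V_def A_def)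
    then obtain D where "D \<in> P (t x)" "x \<in> D" using P[of "t x"] by blast
    then have "(t x, D) \<in> I0" "x \<in> snd (t x, D)" using \<open>t x \<in> V\<close> by (auto simp: I0_def)
    from sum_blocks_apply[OF I0(1) I0disj this, of fst] have "h1 x = t x" by (simp add: h1_def)
    then show ?thesis using True by (simp add: t1_def)
  next
    case False
    have "x \<notin> snd i" if "i \<in> I0" for i
    proof -
      have "fst i \<in> V" "snd i \<subseteq> A (fst i)" using that I0(2) ID(2) by (auto simp: I0_def)
      moreover from this have "fst i \<noteq> 0" using V by auto
      ultimately show ?thesis using False by (auto simp: A_def)
    qed
    then have "h1 x = 0" unfolding h1_def by (rule sum_blocks_outside)
    then show ?thesis using False by (auto simp: t1_def)
  qed
  have h1S: "h1 \<in> S" unfolding h1_def using I0 ID(1) by (intro sum_closed block_in_L1) auto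
  have "N t1 = N h1" using t1S h1S h1_eq by (intro L1_norm_AE_cong AE_I2) auto
  also have "\<dots> = (\<Sum>i\<in>I0. measure M (snd i) * norm (fst i))"
    unfolding h1_def using I0 I0disj ID(1) by (intro L1_norm_sum_blocks) auto
  also have "\<dots> = sum d I0"
    using V by (intro sum.cong) (auto simp: d_def yv_def I0_def)
  finally have N1: "sum d I0 = N t1" by simp
  have "sum d (Pair 0 ` P 0) = (\<Sum>D\<in>P 0. measure M D * norm w0)"
    by (subst sum.reindex) (auto simp: inj_on_def d_def yv_def)
  also have "\<dots> = measure M (\<Union>(P 0)) * norm w0"
    unfolding sum_distrib_right[symmetric] using P[of 0]
    by (subst measure_Union') (auto simp: disjoint_def pairwise_def)
  also have "\<dots> = 1 - N t1" using P[of 0] w0 by (simp add: A_def)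
  finally have "sum d (Pair 0 ` P 0) = 1 - N t1" .
  with N1 have sum_d: "sum d I = 1"
    using I I_split by (metis add.commute diff_add_cancel finite_Un sum.union_disjoint)
  define a where "a = (\<Sum>i\<in>I. \<Sum>k\<in>K i. w i k *\<^sub>R b i k)"
  have aS: "a \<in> S" unfolding a_def using bS by (intro sum_closed scaleR_closed)
  have "\<exists>c. (\<forall>i\<in>I. c i \<in> K i) \<and>
    norm (p (0 + (\<Sum>i\<in>I. \<Sum>k\<in>K i. w i k *\<^sub>R b i k))) - 2 * C * (\<Sum>i\<in>I. (d i)\<^sup>2)
      \<le> norm (p (0 + (\<Sum>i\<in>I. b i (c i))))"
    using Kw bS bN sum_d by (intro successive_choice[OF p I]) (auto simp: L1_functions_zero N_zero)
  then obtain c where c: "\<And>i. i \<in> I \<Longrightarrow> c i \<in> K i"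
     "norm (p a) - 2 * C * (\<Sum>i\<in>I. (d i)\<^sup>2) \<le> norm (p (\<Sum>i\<in>I. b i (c i)))"
    by (auto simp: a_def)
  have "(\<Sum>i\<in>I. (d i)\<^sup>2) \<le> (\<Sum>i\<in>I. \<delta> * d i)"
    using d\<delta> by (intro sum_mono) (auto simp: power2_eq_square intro: mult_right_mono)
  also have "\<dots> = \<delta>" using sum_d by (simp flip: sum_distrib_left)
  finally have "2 * C * (\<Sum>i\<in>I. (d i)\<^sup>2) \<le> \<tau>" using \<delta>(2) C mult_left_mono[of _ \<delta> "2 * C"] by force
  \<comment> \<open>The mean of the choices is \<open>t1\<close> only almost everywhere; Lipschitz continuity takes care of the difference.\<close>
  moreover have "p a = p t1"
  proof -
    have "AE x in M. \<forall>i\<in>I. (\<Sum>k\<in>K i. w i k * (snd k * indicator (fst k) x)) = (if fst i = 0 then 0 else indicator (snd i) x :: real)"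
      using I Kw by (intro AE_finite_allI) auto
    then have "AE x in M. a x = t1 x"
      using AE_space
    proof eventually_elim
      fix x assume eq: "\<forall>i\<in>I. (\<Sum>k\<in>K i. w i k * (snd k * indicator (fst k) x)) = (if fst i = 0 then 0 else indicator (snd i) x :: real)"
        and x: "x \<in> space M"
      have "a x = (\<Sum>i\<in>I. (\<Sum>k\<in>K i. w i k * (snd k * indicator (fst k) x)) *\<^sub>R yv (fst i))"
        unfolding a_def sum_fun_apply b_def scaleR_sum_left
        by (intro sum.cong refl) (simp add: block_def mult.commute mult.left_commute)
      also have "\<dots> = (\<Sum>i\<in>I. (if fst i = 0 then 0 else indicator (snd i) x) *\<^sub>R yv (fst i))"
        using eq by (intro sum.cong) auto
      also have "\<dots> = (\<Sum>i\<in>I0. (if fst i = 0 then 0 else indicator (snd i) x) *\<^sub>R yv (fst i))"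
        using I I0 by (intro sum.mono_neutral_right) (auto simp: I_split(1))
      also have "\<dots> = h1 x"
        unfolding h1_def sum_fun_apply block_def using V by (intro sum.cong) (auto simp: I0_def yv_def)
      finally show "a x = t1 x" using h1_eq[OF x] by simp
    qed
    then have "AE x in M. (a - t1) x = 0" by eventually_elim simp
    then have zero: "N (a - t1) = 0" by (rule L1_norm_AE_zero)
    have "norm (p (t1 + (a - t1)) - p t1) \<le> 2 * C * N (a - t1)"
      using aS t1S zero by (intro second_order_lipschitz[OF p t1S Nt1] L1_functions_diff) auto
    then show ?thesis by (simp add: zero)
  qed
  ultimately have final: "norm (p f) - 3 * \<tau> \<le> norm (p (\<Sum>i\<in>I. b i (c i)))" using c(2) pt1 by simp
  define B where "B i = fst (c i)" for i
  define v where "v i = snd (c i) *\<^sub>R yv (fst i)" for i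
  have bc: "b i (c i) = block (B i) (v i)" for i by (simp add: b_def B_def v_def)
  have Bf: "B i \<in> fmeasurable M" "B i \<subseteq> snd i" "fst i \<noteq> 0 \<Longrightarrow> measure M (B i) < \<beta>" if "i \<in> I" for i
    using Kw[OF that] c(1)[OF that] by (auto simp: B_def)
  have Bdisj: "disjoint_family_on B I"
    using Idisj Bf(2) unfolding disjoint_family_on_def by blast
  show thesis
  proof (rule that[OF I Bdisj Bf(1)])
    have "N (\<Sum>i\<in>I. block (B i) (v i)) = (\<Sum>i\<in>I. measure M (B i) * norm (v i))"
      using I Bdisj Bf(1) by (rule L1_norm_sum_blocks)
    also have "\<dots> = sum d I"
    proof (rule sum.cong[OF refl])
      fix i assume i: "i \<in> I"
      show "measure M (B i) * norm (v i) = d i"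
        using bN[OF i c(1)[OF i]] L1_norm_block[OF Bf(1)[OF i], of "v i"] by (simp add: bc)
    qed
    finally show "N (\<Sum>i\<in>I. block (B i) (v i)) = 1" by (simp add: sum_d)
    show "norm (p f) - 3 * \<tau> \<le> norm (p (\<Sum>i\<in>I. block (B i) (v i)))" using final by (simp add: bc)
    define W where "W = (\<Union>i\<in>I. B i)"
    have W: "W \<in> fmeasurable M" unfolding W_def using I Bf(1) by (intro fmeasurable.finite_UN) auto
    have W0: "(\<Union>i\<in>I0. B i) \<in> fmeasurable M" using I0 Bf(1) by (intro fmeasurable.finite_UN) auto
    have "W \<subseteq> E \<union> (\<Union>i\<in>I0. B i)"
    proof
      fix x assume "x \<in> W"
      then obtain i where i: "i \<in> I" "x \<in> B i" by (auto simp: W_def)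
      show "x \<in> E \<union> (\<Union>i\<in>I0. B i)"
      proof (cases "fst i = 0")
        case True
        have "x \<in> A (fst i)" using i(2) Bf(2)[OF i(1)] ID(2)[OF i(1)] by blast
        with True have "x \<in> E" by (simp add: A_def)
        then show ?thesis by simp
      next
        case False
        then have "i \<in> I0" using i(1) by (auto simp: I_split(1))
        then show ?thesis using i by auto
      qed
    qed
    then have "measure M W \<le> measure M (E \<union> (\<Union>i\<in>I0. B i))"
      using W E W0 by (intro measure_mono_fmeasurable fmeasurable.Un) (auto simp: fmeasurableD)
    also have "\<dots> \<le> measure M E + measure M (\<Union>i\<in>I0. B i)"
      using E W0 by (intro measure_Un_le) (auto simp: fmeasurableD)
    also have "measure M (\<Union>i\<in>I0. B i) \<le> (\<Sum>i\<in>I0. measure M (B i))"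
      using I0 Bf(1) by (intro measure_UNION_le) (auto simp: fmeasurableD)
    also have "\<dots> \<le> (\<Sum>i\<in>I0. \<beta>)"
    proof (rule sum_mono)
      fix i assume "i \<in> I0"
      then have "i \<in> I" "fst i \<noteq> 0" using I0 V by (auto simp: I0_def)
      then show "measure M (B i) \<le> \<beta>" using Bf(3) by (simp add: less_imp_le)
    qed
    also have "\<dots> \<le> real (card I) * \<beta>"
      using \<beta> I I0 by (simp add: card_mono mult_right_mono)
    also have "\<dots> < (real (card I) + 1) * \<beta>" using \<beta> by simp
    also have "(real (card I) + 1) * \<beta> = \<eta> / 2"
      by (auto simp: \<beta>_def divide_simps algebra_simps)
    finally have "measure M W < \<eta>" using E(3) by simp
    then have small: "(\<integral>x. indicator W x * H x \<partial>M) < e'" using W by (intro \<eta>(2))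
    have "(\<integral>x. indicator W x * G x \<partial>M) \<le> (\<integral>x. indicator W x * H x \<partial>M)"
    proof (rule integral_mono)
      show "integrable M (\<lambda>x. indicator W x * G x)"
        using integrable_real_mult_indicator[OF fmeasurableD[OF W] G(1)] by (simp add: mult.commute)
      show "integrable M (\<lambda>x. indicator W x * H x)" using H_int fmeasurableD[OF W] by blast
    qed (auto simp: H_def indicator_def)
    with small e' show "(\<integral>x. indicator (\<Union>i\<in>I. B i) x * G x \<partial>M) < e" by (simp add: W_def)
  qed
qed

end


section \<open>The polynomial weak operator Daugavet property\<close>

context L1_over
begin

text \<open>If \<open>\<mu>\<close> or \<open>Y\<close> is trivial there is no \<open>h\<close> of norm \<open>1\<close>, but any two points are at distance zero.\<close>

lemma identity_in_OF_set:
  assumes zero: "\<And>f. f \<in> S \<Longrightarrow> N f = 0" and f: "f \<in> S" and g: "g \<in> S"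
    and xs: "set xs \<subseteq> points X" and \<epsilon>: "\<epsilon> > 0"
  shows "cls f \<in> OF_set X xs (cls g) \<epsilon>"
proof -
  have small: "nnorm X (ndiff X (cls u) (cls v)) < \<epsilon>" if "u \<in> S" "v \<in> S" for u v
    using that \<epsilon> by (simp add: ndiff_cls nnorm_cls zero L1_functions_diff)
  have "operator_norm X (\<lambda>u. u) \<le> 1 + \<epsilon>"
    unfolding operator_norm_def
  proof (rule cSUP_least)
    show "unit_ball X \<noteq> {}" using f zero by (auto simp: unit_ball_eq)
  qed (use \<epsilon> in \<open>auto simp: unit_ball_def\<close>)
  moreover have "bounded_operator X (\<lambda>u. u)"
    unfolding bounded_operator_def by (auto intro!: exI[of _ 1])
  moreover have "nnorm X (ndiff X x x) < \<epsilon>" if "x \<in> set xs" for x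
    using that xs small by (auto simp: points_eq)
  moreover have "cls f \<in> unit_ball X" using f zero by (simp add: cls_in_unit_ball)
  ultimately show ?thesis using small[OF f g] by (auto simp: OF_set_def)
qed

lemma near_maximizer:
  assumes p: "second_order (\<lambda>f. P (cls f)) C" and P1: "polynomial_norm X P = (1::real)" and \<tau>: "\<tau> > 0"
  obtains f where "f \<in> S" "N f \<le> 1" "1 - \<tau> < norm (P (cls f) :: 'k)"
proof -
  have ball: "unit_ball X \<noteq> {}" using L1_functions_zero N_zero by (force simp: unit_ball_eq)
  have "bdd_above ((\<lambda>x. norm (P x)) ` unit_ball X)"
  proof (rule bdd_aboveI2)
    fix x assume "x \<in> unit_ball X"
    then obtain f where f: "x = cls f" "f \<in> S" "N f \<le> 1" by (auto simp: unit_ball_eq)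
    have "norm (P (cls (0 + f)) - P (cls 0)) \<le> 2 * C * N f"
      using f by (intro second_order_lipschitz[OF p L1_functions_zero]) (auto simp: N_zero)
    also have "\<dots> \<le> 2 * C * 1" using f p by (intro mult_left_mono) (auto simp: second_order_def)
    finally show "norm (P x) \<le> norm (P (cls 0)) + 2 * C"
      using norm_triangle_ineq2[of "P (cls f)" "P (cls 0)"] f by simp
  qed
  then have "\<exists>x\<in>unit_ball X. 1 - \<tau> < norm (P x)"
    using less_cSUP_iff[OF ball, of "\<lambda>x. norm (P x)" "1 - \<tau>"] P1 \<tau> by (simp add: polynomial_norm_def)
  then show thesis using that by (auto simp: unit_ball_eq)
qed

text \<open>A \<open>\<sigma>\<close>-finite measure without sets of positive finite measure vanishes.\<close>

lemma L1_trivial_or_not: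
  assumes "sigma_finite_measure M"
  obtains (trivial) "\<And>f. f \<in> S \<Longrightarrow> N f = 0"
  | (nontrivial) y0 E0 where "y0 \<noteq> (0::'y)" "E0 \<in> fmeasurable M" "measure M E0 > 0"
proof (cases "(\<exists>y0. y0 \<noteq> (0::'y)) \<and> (\<exists>E0\<in>fmeasurable M. measure M E0 > 0)")
  case False
  have "AE x in M. f x = 0" for f :: "'a \<Rightarrow> 'y"
  proof (cases "\<exists>y0. y0 \<noteq> (0::'y)")
    case True
    obtain A :: "nat \<Rightarrow> 'a set" where A: "range A \<subseteq> sets M" "(\<Union>i. A i) = space M" "\<And>i. emeasure M (A i) \<noteq> \<infinity>"
      using sigma_finite_measure.sigma_finite[OF assms] by blast
    have "A i \<in> null_sets M" for i
    proof -
      have Ai: "A i \<in> fmeasurable M" using A by (auto simp: fmeasurable_def less_top)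
      with False True have "\<not> 0 < measure M (A i)" by blast
      then have "measure M (A i) = 0" by (simp add: zero_less_measure_iff)
      with Ai show ?thesis by (simp add: null_sets_def emeasure_eq_measure2 fmeasurableD)
    qed
    then have "(\<Union>i. A i) \<in> null_sets M" by (rule null_sets_UN)
    then have "AE x in M. x \<notin> space M" unfolding A(2) by (rule AE_not_in)
    then show ?thesis using AE_space by eventually_elim simp
  qed auto
  then show thesis using trivial L1_norm_AE_zero by blast
qed (use nontrivial in blast)

end

lemma re_of_real: "re (of_real r :: 'k::rc_field) = r"
  by (simp add: of_real_def re_scaleR_one)

lemma rotate_to_norm:
  fixes z :: "'k::rc_field"
  obtains \<omega> where "norm \<omega> = 1" "re (\<omega> * z) = norm z"
proof (cases "z = 0")
  case True
  have "re (0::'k) = 0" using re_of_real[of 0, where 'k = 'k] by simp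
  with True show thesis by (intro that[of 1]) auto
next
  case False
  then show thesis by (intro that[of "of_real (norm z) / z"]) (auto simp: norm_divide re_of_real)
qed

theorem proposition5p11:
  fixes M :: "'a measure" and smul :: "'k::rc_field \<Rightarrow> 'y::banach \<Rightarrow> 'y"
  assumes "sigma_finite_measure M"
    and "atomless M"
    and "banach_over smul"
  shows "polynomial_WODP (L1_space M smul)"
proof -
  interpret L1_over smul M using assms(3) by (simp add: L1_over_def)
  show ?thesis
    unfolding polynomial_WODP_def
  proof (intro allI impI, elim conjE)
    fix P :: "('a \<Rightarrow> 'y) set \<Rightarrow> 'k" and xs x' and \<alpha> \<epsilon> :: real
    assume P: "continuous_polynomial X P" "polynomial_norm X P = 1"
      and xs: "set xs \<subseteq> unit_sphere X" and x': "x' \<in> unit_ball X" and pos: "\<alpha> > 0" "\<epsilon> > 0"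
    obtain C where C: "second_order (\<lambda>f. P (cls f)) C" using second_order_polynomial[OF P(1)] by blast
    obtain f where f: "f \<in> S" "N f \<le> 1" "1 - \<alpha> / 2 < norm (P (cls f))"
      using near_maximizer[OF C P(2), of "\<alpha> / 2"] pos by auto
    obtain g where g: "x' = cls g" "g \<in> S" "N g \<le> 1" using x' by (auto simp: unit_ball_eq)
    have xsp: "set xs \<subseteq> cls ` S" using xs by (auto simp: unit_sphere_def points_eq)
    have "\<exists>y\<in>OF_set X xs x' \<epsilon>. 1 - \<alpha> < norm (P y)"
      using assms(1)
    proof (cases rule: L1_trivial_or_not)
      case trivial
      have "cls f \<in> OF_set X xs x' \<epsilon>"
        unfolding g(1) using trivial f g xsp pos by (intro identity_in_OF_set) (auto simp: points_eq)
      then show ?thesis using f pos by (intro bexI) auto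
    next
      case (nontrivial y0 E0)
      obtain F where F: "F \<subseteq> S" "finite F" "set xs = cls ` F"
        using finite_subset_image[OF _ xsp] by blast
      define G where "G x = (\<Sum>f\<in>F. norm (f x))" for x
      have G: "integrable M G" "\<And>x. 0 \<le> G x"
        using F(1) by (auto simp: G_def[abs_def] intro!: sum_nonneg Bochner_Integration.integrable_sum L1_functionsD(2))
      have half: "\<epsilon> / 2 > 0" "\<alpha> / 6 > 0" using pos by auto
      obtain I :: "('y \<times> 'a set) set" and B v where IB: "finite I" "disjoint_family_on B I" "\<And>i. i \<in> I \<Longrightarrow> B i \<in> fmeasurable M"
        and h1: "N (\<Sum>i\<in>I. block (B i) (v i)) = 1"
        and GW: "(\<integral>x. indicator (\<Union>i\<in>I. B i) x * G x \<partial>M) < \<epsilon> / 2"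
        and Ph: "norm (P (cls f)) - 3 * (\<alpha> / 6) \<le> norm (P (cls (\<Sum>i\<in>I. block (B i) (v i))))"
        using concentrated_near_maximizer[OF assms(2) C f(1,2) nontrivial G half] by blast
      define h where "h = (\<Sum>i\<in>I. block (B i) (v i))"
      define W where "W = (\<Union>i\<in>I. B i)"
      have hS: "h \<in> S" unfolding h_def using IB by (intro sum_closed block_in_L1)
      have W: "W \<in> sets M" unfolding W_def using IB by (intro sets.finite_UN) (auto intro: fmeasurableD)
      obtain \<phi> where \<phi>: "\<And>f g. f \<in> S \<Longrightarrow> g \<in> S \<Longrightarrow> \<phi> (f + g) = \<phi> f + \<phi> g"
          "\<And>f a. f \<in> S \<Longrightarrow> \<phi> (\<lambda>x. smul a (f x)) = a * \<phi> f"
          "\<And>f. f \<in> S \<Longrightarrow> norm (\<phi> f) \<le> mass_on W f" "\<phi> h = 1"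
        unfolding W_def using norming_functional_of_blocks[OF IB h_def h1[folded h_def]] by blast
      have "2 * mass_on W f < \<epsilon>" if f: "f \<in> F" for f
      proof -
        have "mass_on W f \<le> (\<integral>x. indicator W x * G x \<partial>M)"
          unfolding mass_on_def
        proof (rule integral_mono)
          show "integrable M (\<lambda>x. indicator W x * norm (f x))"
            using f F W by (intro mass_on_integrable) auto
          show "integrable M (\<lambda>x. indicator W x * G x)"
            using integrable_real_mult_indicator[OF W G(1)] by (simp add: mult.commute)
          have "norm (f x) \<le> G x" for x
            unfolding G_def using F f by (intro member_le_sum) auto
          then show "indicator W x * norm (f x) \<le> indicator W x * G x" for x
            by (intro mult_left_mono) auto
        qed
        with GW show ?thesis by (simp add: W_def)
      qed
      then have xsF: "set xs \<subseteq> cls ` {f\<in>S. 2 * mass_on W f < \<epsilon>}" using F by auto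
      have "cls h \<in> OF_set X xs (cls g) \<epsilon>"
        using h1 sum_blocks_outside[of I _ B v]
        by (intro mem_OF_set[OF \<phi>(1-3) W hS _ \<phi>(4) _ g(2,3) xsF pos(2)]) (auto simp: h_def W_def)
      moreover have "1 - \<alpha> < norm (P (cls h))" using Ph f(3) by (simp add: h_def)
      ultimately show ?thesis by (auto simp: g(1))
    qed
    then obtain y where y: "y \<in> OF_set X xs x' \<epsilon>" "1 - \<alpha> < norm (P y)" by blast
    obtain \<omega> where "norm \<omega> = 1" "re (\<omega> * P y) = norm (P y)" by (rule rotate_to_norm)
    with y show "\<exists>y\<in>OF_set X xs x' \<epsilon>. \<exists>\<omega>. norm \<omega> = 1 \<and> re (\<omega> * P y) > 1 - \<alpha>"
      by (intro bexI[of _ y] exI[of _ \<omega>]) auto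
  qed
qed

end
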